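(* Let $\mathcal P=[X:\mathcal R]$ be an inverse monoid presentation of an inverse monoid $M$. Then there exists a short exact sequence of $M$-modules $$0\to \bigsqcup_{e\in E(M)}\pi_e^{\bowtie}\to (S^{\bowtie})^{ab}\xrightarrow{\ \overline{\mathbf r}\ }\mathcal K\to 0$$ in which $(S^{\bowtie})^{ab}$ is a free $M$-module, $\mathcal K$ is the relation module of $\mathcal P$, and $\overline{\mathbf r}$ is induced by the range map $\mathbf r:S^{\bowtie}\to K$.
   Context: Maps are written on the right and composed left to right. $E(S)$ is the semilattice of idempotents of an inverse semigroup $S$, and $\leq$ the natural partial order. **Presentation and factorisation.** $A=X\sqcup X^{-1}$, $A^*$ is the free monoid on $A$ (with formal inverses of words), $\mathcal R\subseteq A^*\times A^*$; $\rho:A^*\to \mathrm{FIM}(X)$ is the canonical map to the free inverse monoid; $M$ is the quotient of $\mathrm{FIM}(X)$ by the congruence generated by the pairs $(l\rho,r\rho)$, $(l,r)\in\mathcal R$, with quotient map $\theta:\mathrm{FIM}(X)\to M$. Let $\theta_{\min}$ be the congruence on $\mathrm{FIM}(X)$: $a\,\theta_{\min}\,b$ iff there is an idempotent $e$ with $ae=be$ and $(a^{-1}a)\theta=e\theta=(b^{-1}b)\theta$. Put $\mathcal T=\mathrm{FIM}(X)/\theta_{\min}$, with quotient map $\tau:\mathrm{FIM}(X)\to\mathcal T$ and induced map $\psi:\mathcal T\to M$, so $\theta=\tau\psi$. Here $\tau$ is idempotent pure and $\psi$ is surjective and idempotent separating, so $\psi$ restricts to a bijection $E(\mathcal T)\to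 E(M)$, by which $E(\mathcal T)$ and $E(M)$ are identified. **$M$-modules (Lausch).** An $M$-module is a presheaf of abelian groups $(A_e,\alpha^e_f)$ over $E(M)$ (homomorphisms $\alpha^e_f:A_e\to A_f$ for $f\leq e$, with $\alpha^e_e=\mathrm{id}$, $\alpha^e_f\alpha^f_g=\alpha^e_g$), with $A=\bigsqcup_e A_e$ carrying the operation $a\oplus b=a\alpha^e_{ef}+b\alpha^f_{ef}$ ($a\in A_e$, $b\in A_f$), together with a map $A\times M\to A$, $(a,s)\mapsto a\lhd s$, such that $(a\oplus b)\lhd s=(a\lhd s)\oplus(b\lhd s)$, $a\lhd st=(a\lhd s)\lhd t$, $a\lhd e=a\oplus 0_e$ and $0_e\lhd s=0_{s^{-1}es}$ for all $a,b\in A$, $s,t\in M$, $e\in E(M)$. The free $M$-module on a family of sets $\{B_e:e\in E(M)\}$ has as component at $e$ the free abelian group on $\{(b,s): b\in B_f,\ s\in M,\ f\geq ss^{-1},\ s^{-1}s=e\}$, structure maps $(b,s)\mapsto(b,se')$ for $e'\leq e$, and action $(b,s)\lhd t=(b,st)$. Kernels, images and exactness are taken componentwise. **Relation module.** For $e\in E(M)$ let $K_e=\{a\in\mathcal T:a\psi=e\}$, a group; $K=\ker\psi=\bigsqcup_e K_e$. The relation module is $\mathcal K=\bigsqcup_{e\in E(M)}K_e^{ab}$ with $M$-action $\bar k\lhd m=\overline{t^{-1}kt}$ for any $t\in\mathcal T$ with $t\psi=m$. **Squier complex.** $\mathrm{Sq}(\mathcal P)$ is the $2$-complex with vertex set $\mathcal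 T$; an edge $(p,l,r,q)$ for all $p,q\in\mathcal T$, $(l,r)\in\mathcal R$, from $p(l\rho\tau)q$ to $p(r\rho\tau)q$; and, for all $p,q,p',q'\in\mathcal T$ and $(l,r),(l',r')\in\mathcal R$, a $2$-cell making the paths $(p,l,r,qp'(l'\rho\tau)q')\circ(p(r\rho\tau)qp',l',r',q')$ and $(p(l\rho\tau)qp',l',r',q')\circ(p,l,r,qp'(r'\rho\tau)q')$ homotopic. Let $\pi=\pi(\mathrm{Sq}(\mathcal P),\mathcal T)$ be its fundamental groupoid on the vertex set $\mathcal T$ (fixed-end-point homotopy classes of edge paths), with domain and range maps $\mathbf d,\mathbf r$ and composition $\circ$. $\mathcal T$ acts on both sides of $\pi$ by the actions induced from $t\rhd(p,l,r,q)=(tp,l,r,q)$ and $(p,l,r,q)\lhd t=(p,l,r,qt)$. Put $\alpha\ast\beta=(\alpha\lhd\beta\mathbf d)\circ(\alpha\mathbf r\rhd\beta)$. For $e\in E(\mathcal T)$ let $\mathrm{star}_e^{\bowtie}=\{e\rhd\alpha\lhd e:\alpha\in\pi,\ \alpha\mathbf d=e\}$, a group under $\ast$ with identity $1_e$, and $\pi_e^{\bowtie}=\{\alpha\in\mathrm{star}_e^{\bowtie}:\alpha\mathbf r=e\}$, an abelian group under $\ast$. Put $S^{\bowtie}=\bigsqcup_e\mathrm{star}_e^{\bowtie}$ and $(S^{\bowtie})^{ab}=\bigsqcup_e(\mathrm{star}_e^{\bowtie})^{ab}$. The range map restricts to homomorphisms $\mathbf r:\mathrm{star}^{\bowtie}_e\to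 K_e$. The $M$-actions on $\bigsqcup_e\pi_e^{\bowtie}$ and on $(S^{\bowtie})^{ab}$ are induced by $\alpha\mapsto t^{-1}\rhd\alpha\lhd t$, where $t\in\mathcal T$ is any element with $t\psi=m$; structure maps for $f\leq e$ are induced by $\alpha\mapsto f\rhd\alpha\lhd f$. *)

theory Defs
  imports "HOL-Algebra.Free_Abelian_Groups" "HOL-Algebra.Solvable_Groups"
begin

text \<open>
  Well-definedness convention: an operation on equivalence classes, or one that depends on a choice
  of representatives, is written as \<open>the_elem\<close> of the set of all the values obtained from all
  representatives.  It is the intended value exactly when the choice does not matter.
\<close>

section \<open>Inverse monoids, congruences, quotients\<close>

locale inverse_monoid = monoid G for G (structure) +
  assumes ex1_sinv:
    "a \<in> carrier G \<Longrightarrow> \<exists>!b. b \<in> carrier G \<and> a \<otimes> b \<otimes> a = a \<and> b \<otimes> a \<otimes> b = b"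

definition sinv :: "('a, 'k) monoid_scheme \<Rightarrow> 'a \<Rightarrow> 'a" where
  "sinv G a = (THE b. b \<in> carrier G \<and> a \<otimes>\<^bsub>G\<^esub> b \<otimes>\<^bsub>G\<^esub> a = a \<and> b \<otimes>\<^bsub>G\<^esub> a \<otimes>\<^bsub>G\<^esub> b = b)"

definition idems :: "('a, 'k) monoid_scheme \<Rightarrow> 'a set" where
  "idems G = {e \<in> carrier G. e \<otimes>\<^bsub>G\<^esub> e = e}"

definition natural_le :: "('a, 'k) monoid_scheme \<Rightarrow> 'a \<Rightarrow> 'a \<Rightarrow> bool" where
  "natural_le G a b \<longleftrightarrow> (\<exists>e\<in>idems G. a = e \<otimes>\<^bsub>G\<^esub> b)"

definition congruence_on :: "('a, 'k) monoid_scheme \<Rightarrow> ('a \<times> 'a) set \<Rightarrow> bool" where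
  "congruence_on G r \<longleftrightarrow> equiv (carrier G) r \<and>
     (\<forall>(a, b)\<in>r. \<forall>c\<in>carrier G.
        (c \<otimes>\<^bsub>G\<^esub> a, c \<otimes>\<^bsub>G\<^esub> b) \<in> r \<and> (a \<otimes>\<^bsub>G\<^esub> c, b \<otimes>\<^bsub>G\<^esub> c) \<in> r)"

definition congruence_generated :: "('a, 'k) monoid_scheme \<Rightarrow> ('a \<times> 'a) set \<Rightarrow> ('a \<times> 'a) set" where
  "congruence_generated G S = \<Inter>{r. congruence_on G r \<and> S \<subseteq> r}"

definition quotient_monoid :: "('a, 'k) monoid_scheme \<Rightarrow> ('a \<times> 'a) set \<Rightarrow> 'a set monoid" where
  "quotient_monoid G r =
     \<lparr>carrier = carrier G // r,
      mult = (\<lambda>A B. the_elem ((\<lambda>(a, b). r `` {a \<otimes>\<^bsub>G\<^esub> b}) ` (A \<times> B))),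
      one = r `` {\<one>\<^bsub>G\<^esub>}\<rparr>"


section \<open>The free inverse monoid\<close>

text \<open>The letter \<open>Inl x\<close> is the generator \<open>x\<close>, and \<open>Inr x\<close> is its formal inverse.\<close>

type_synonym 'x word = "('x + 'x) list"

definition words :: "'x set \<Rightarrow> 'x word set" where
  "words X = lists (X <+> X)"

definition free_monoid :: "'x set \<Rightarrow> 'x word monoid" where
  "free_monoid X = \<lparr>carrier = words X, mult = (@), one = []\<rparr>"

definition word_inv :: "'x word \<Rightarrow> 'x word" where
  "word_inv w = rev (map (case_sum Inr Inl) w)"

text \<open>The Vagner congruence.\<close>

definition vagner :: "'x set \<Rightarrow> ('x word \<times> 'x word) set" where
  "vagner X = congruence_generated (free_monoid X)
     ({(w, w @ word_inv w @ w) | w. w \<in> words X} \<union>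
      {(u @ word_inv u @ w @ word_inv w, w @ word_inv w @ u @ word_inv u) | u w.
         u \<in> words X \<and> w \<in> words X})"

definition fim :: "'x set \<Rightarrow> 'x word set monoid" where
  "fim X = quotient_monoid (free_monoid X) (vagner X)"

definition rho :: "'x set \<Rightarrow> 'x word \<Rightarrow> 'x word set" where
  "rho X w = vagner X `` {w}"


section \<open>Lausch modules over an inverse monoid\<close>

text \<open>
  The disjoint union of the components consists of the pairs \<open>(e, a)\<close> with \<open>a\<close> in the component
  at \<open>e\<close>; \<open>lact\<close> acts on such pairs.  The components are written multiplicatively.
\<close>

record ('m, 'a) lmodule =
  lcomp :: "'m \<Rightarrow> 'a monoid"
  lres :: "'m \<Rightarrow> 'm \<Rightarrow> 'a \<Rightarrow> 'a"
  lact :: "'m \<times> 'a \<Rightarrow> 'm \<Rightarrow> 'm \<times> 'a"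

definition ltotal :: "('m, 'k) monoid_scheme \<Rightarrow> ('m, 'a) lmodule \<Rightarrow> ('m \<times> 'a) set" where
  "ltotal M A = (SIGMA e:idems M. carrier (lcomp A e))"

definition lzero :: "('m, 'a) lmodule \<Rightarrow> 'm \<Rightarrow> 'm \<times> 'a" where
  "lzero A e = (e, \<one>\<^bsub>lcomp A e\<^esub>)"

fun loplus :: "('m, 'k) monoid_scheme \<Rightarrow> ('m, 'a) lmodule \<Rightarrow> 'm \<times> 'a \<Rightarrow> 'm \<times> 'a \<Rightarrow> 'm \<times> 'a" where
  "loplus M A (e, a) (f, b) =
     (e \<otimes>\<^bsub>M\<^esub> f,
      lres A e (e \<otimes>\<^bsub>M\<^esub> f) a \<otimes>\<^bsub>lcomp A (e \<otimes>\<^bsub>M\<^esub> f)\<^esub> lres A f (e \<otimes>\<^bsub>M\<^esub> f) b)"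

locale lausch_module = inverse_monoid M
  for M :: "('m, 'k) monoid_scheme" and A :: "('m, 'a) lmodule" +
  assumes comp_group: "e \<in> idems M \<Longrightarrow> comm_group (lcomp A e)"
    and res_hom:
      "\<lbrakk>e \<in> idems M; f \<in> idems M; natural_le M f e\<rbrakk> \<Longrightarrow> lres A e f \<in> hom (lcomp A e) (lcomp A f)"
    and res_id: "\<lbrakk>e \<in> idems M; a \<in> carrier (lcomp A e)\<rbrakk> \<Longrightarrow> lres A e e a = a"
    and res_res:
      "\<lbrakk>e \<in> idems M; f \<in> idems M; g \<in> idems M; natural_le M f e; natural_le M g f;
        a \<in> carrier (lcomp A e)\<rbrakk> \<Longrightarrow> lres A f g (lres A e f a) = lres A e g a"
    and act_closed: "\<lbrakk>x \<in> ltotal M A; s \<in> carrier M\<rbrakk> \<Longrightarrow> lact A x s \<in> ltotal M A"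
    and act_oplus:
      "\<lbrakk>x \<in> ltotal M A; y \<in> ltotal M A; s \<in> carrier M\<rbrakk>
        \<Longrightarrow> lact A (loplus M A x y) s = loplus M A (lact A x s) (lact A y s)"
    and act_mult:
      "\<lbrakk>x \<in> ltotal M A; s \<in> carrier M; t \<in> carrier M\<rbrakk>
        \<Longrightarrow> lact A x (s \<otimes>\<^bsub>M\<^esub> t) = lact A (lact A x s) t"
    and act_idem: "\<lbrakk>x \<in> ltotal M A; e \<in> idems M\<rbrakk> \<Longrightarrow> lact A x e = loplus M A x (lzero A e)"
    and act_zero:
      "\<lbrakk>e \<in> idems M; s \<in> carrier M\<rbrakk>
        \<Longrightarrow> lact A (lzero A e) s = lzero A (sinv M s \<otimes>\<^bsub>M\<^esub> e \<otimes>\<^bsub>M\<^esub> s)"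

definition lausch_hom ::
  "('m, 'k) monoid_scheme \<Rightarrow> ('m, 'a) lmodule \<Rightarrow> ('m, 'b) lmodule \<Rightarrow> ('m \<Rightarrow> 'a \<Rightarrow> 'b) \<Rightarrow> bool" where
  "lausch_hom M A B h \<longleftrightarrow>
     (\<forall>e\<in>idems M. h e \<in> hom (lcomp A e) (lcomp B e)) \<and>
     (\<forall>e\<in>idems M. \<forall>f\<in>idems M. natural_le M f e \<longrightarrow>
        (\<forall>a\<in>carrier (lcomp A e). h f (lres A e f a) = lres B e f (h e a))) \<and>
     (\<forall>(e, a)\<in>ltotal M A. \<forall>s\<in>carrier M.
        lact B (e, h e a) s = (case lact A (e, a) s of (f, b) \<Rightarrow> (f, h f b)))"

definition lausch_short_exact ::
  "('m, 'k) monoid_scheme \<Rightarrow> ('m, 'a) lmodule \<Rightarrow> ('m \<Rightarrow> 'a \<Rightarrow> 'b) \<Rightarrow> ('m, 'b) lmodule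
    \<Rightarrow> ('m \<Rightarrow> 'b \<Rightarrow> 'c) \<Rightarrow> ('m, 'c) lmodule \<Rightarrow> bool" where
  "lausch_short_exact M A i B p C \<longleftrightarrow>
     lausch_module M A \<and> lausch_module M B \<and> lausch_module M C \<and>
     lausch_hom M A B i \<and> lausch_hom M B C p \<and>
     (\<forall>e\<in>idems M.
        inj_on (i e) (carrier (lcomp A e)) \<and>
        i e ` carrier (lcomp A e) = kernel (lcomp B e) (lcomp C e) (p e) \<and>
        p e ` carrier (lcomp B e) = carrier (lcomp C e))"

text \<open>
  The members of the family \<open>B\<close> need not be disjoint, so a generator \<open>b\<close> in \<open>B f\<close> is
  tagged with \<open>f\<close>.
\<close>

definition free_basis :: "('m, 'k) monoid_scheme \<Rightarrow> ('m \<Rightarrow> 'b set) \<Rightarrow> 'm \<Rightarrow> (('m \<times> 'b) \<times> 'm) set" where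
  "free_basis M B e =
     {((f, b), s) | f b s. f \<in> idems M \<and> b \<in> B f \<and> s \<in> carrier M \<and>
        natural_le M (s \<otimes>\<^bsub>M\<^esub> sinv M s) f \<and> sinv M s \<otimes>\<^bsub>M\<^esub> s = e}"

definition free_lausch ::
  "('m, 'k) monoid_scheme \<Rightarrow> ('m \<Rightarrow> 'b set) \<Rightarrow> ('m, (('m \<times> 'b) \<times> 'm) \<Rightarrow>\<^sub>0 int) lmodule" where
  "free_lausch M B =
     \<lparr>lcomp = (\<lambda>e. free_Abelian_group (free_basis M B e)),
      lres = (\<lambda>e f. frag_extend (\<lambda>(b, s). frag_of (b, s \<otimes>\<^bsub>M\<^esub> f))),
      lact = (\<lambda>(e, a) t. (sinv M t \<otimes>\<^bsub>M\<^esub> e \<otimes>\<^bsub>M\<^esub> t,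
                          frag_extend (\<lambda>(b, s). frag_of (b, s \<otimes>\<^bsub>M\<^esub> t)) a))\<rparr>"

text \<open>
  Taking the generators from the element type of \<open>A\<close> is no restriction: in a free module the
  generators \<open>(b, f)\<close>, \<open>b\<close> in \<open>B f\<close>, are distinct elements of the component at \<open>f\<close>.
\<close>

definition is_free_lausch :: "('m, 'k) monoid_scheme \<Rightarrow> ('m, 'a) lmodule \<Rightarrow> bool" where
  "is_free_lausch M A \<longleftrightarrow>
     (\<exists>(B :: 'm \<Rightarrow> 'a set) h. lausch_hom M (free_lausch M B) A h \<and>
        (\<forall>e\<in>idems M. h e \<in> iso (lcomp (free_lausch M B) e) (lcomp A e)))"


section \<open>Abelianisation\<close>

definition abelianisation :: "('a, 'k) monoid_scheme \<Rightarrow> 'a set monoid" where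
  "abelianisation G = G Mod derived G (carrier G)"

definition ab_class :: "('a, 'k) monoid_scheme \<Rightarrow> 'a \<Rightarrow> 'a set" where
  "ab_class G a = derived G (carrier G) #>\<^bsub>G\<^esub> a"


section \<open>The fundamental groupoid of a 2-complex\<close>

text \<open>
  A directed edge \<open>(x, True)\<close> is \<open>x\<close>, and \<open>(x, False)\<close> is its formal inverse.  A 2-cell is given
  by a pair of parallel edge paths.
\<close>

record ('v, 'e) complex2 =
  vertices :: "'v set"
  edges :: "'e set"
  src :: "'e \<Rightarrow> 'v"
  tgt :: "'e \<Rightarrow> 'v"
  cells :: "(('e \<times> bool) list \<times> ('e \<times> bool) list) set"

fun dsrc :: "('v, 'e) complex2 \<Rightarrow> 'e \<times> bool \<Rightarrow> 'v" where
  "dsrc Q (x, b) = (if b then src Q x else tgt Q x)"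

fun dtgt :: "('v, 'e) complex2 \<Rightarrow> 'e \<times> bool \<Rightarrow> 'v" where
  "dtgt Q (x, b) = (if b then tgt Q x else src Q x)"

fun dinv :: "'e \<times> bool \<Rightarrow> 'e \<times> bool" where
  "dinv (x, b) = (x, \<not> b)"

fun edge_path :: "('v, 'e) complex2 \<Rightarrow> 'v \<Rightarrow> ('e \<times> bool) list \<Rightarrow> 'v \<Rightarrow> bool" where
  "edge_path Q v [] w \<longleftrightarrow> v \<in> vertices Q \<and> w = v"
| "edge_path Q v (d # ds) w \<longleftrightarrow>
     v \<in> vertices Q \<and> fst d \<in> edges Q \<and> dsrc Q d = v \<and> edge_path Q (dtgt Q d) ds w"

inductive homotopic ::
  "('v, 'e) complex2 \<Rightarrow> 'v \<Rightarrow> 'v \<Rightarrow> ('e \<times> bool) list \<Rightarrow> ('e \<times> bool) list \<Rightarrow> bool"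
  for Q v w where
  refl: "edge_path Q v xs w \<Longrightarrow> homotopic Q v w xs xs"
| sym: "homotopic Q v w xs ys \<Longrightarrow> homotopic Q v w ys xs"
| trans: "\<lbrakk>homotopic Q v w xs ys; homotopic Q v w ys zs\<rbrakk> \<Longrightarrow> homotopic Q v w xs zs"
| cancel: "\<lbrakk>edge_path Q v (xs @ [d, dinv d] @ ys) w; edge_path Q v (xs @ ys) w\<rbrakk>
    \<Longrightarrow> homotopic Q v w (xs @ [d, dinv d] @ ys) (xs @ ys)"
| cell: "\<lbrakk>(us, vs) \<in> cells Q; edge_path Q v (xs @ us @ ys) w; edge_path Q v (xs @ vs @ ys) w\<rbrakk>
    \<Longrightarrow> homotopic Q v w (xs @ us @ ys) (xs @ vs @ ys)"

type_synonym ('v, 'e) arrow = "('v \<times> ('e \<times> bool) list \<times> 'v) set"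

definition hclass :: "('v, 'e) complex2 \<Rightarrow> 'v \<Rightarrow> ('e \<times> bool) list \<Rightarrow> 'v \<Rightarrow> ('v, 'e) arrow" where
  "hclass Q v xs w = {(v, ys, w) | ys. homotopic Q v w xs ys}"

definition fund_groupoid :: "('v, 'e) complex2 \<Rightarrow> ('v, 'e) arrow set" where
  "fund_groupoid Q = {hclass Q v xs w | v xs w. edge_path Q v xs w}"

definition gdom :: "('v, 'e) arrow \<Rightarrow> 'v" where
  "gdom \<alpha> = the_elem ((\<lambda>(v, xs, w). v) ` \<alpha>)"

definition gran :: "('v, 'e) arrow \<Rightarrow> 'v" where
  "gran \<alpha> = the_elem ((\<lambda>(v, xs, w). w) ` \<alpha>)"

definition gcomp :: "('v, 'e) complex2 \<Rightarrow> ('v, 'e) arrow \<Rightarrow> ('v, 'e) arrow \<Rightarrow> ('v, 'e) arrow" where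
  "gcomp Q \<alpha> \<beta> =
     the_elem ((\<lambda>((v, xs, w), (v', ys, w')). hclass Q v (xs @ ys) w') ` (\<alpha> \<times> \<beta>))"


section \<open>The monoids of a presentation\<close>

context
  fixes X :: "'x set" and R :: "('x word \<times> 'x word) set"
begin

definition theta_rel :: "('x word set \<times> 'x word set) set" where
  "theta_rel = congruence_generated (fim X) {(rho X l, rho X r) | l r. (l, r) \<in> R}"

definition Mon :: "'x word set set monoid" where
  "Mon = quotient_monoid (fim X) theta_rel"

definition theta :: "'x word set \<Rightarrow> 'x word set set" where
  "theta a = theta_rel `` {a}"

definition theta_min :: "('x word set \<times> 'x word set) set" where
  "theta_min = {(a, b). a \<in> carrier (fim X) \<and> b \<in> carrier (fim X) \<and>
     (\<exists>e\<in>idems (fim X). a \<otimes>\<^bsub>fim X\<^esub> e = b \<otimes>\<^bsub>fim X\<^esub> e \<and>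
        theta (sinv (fim X) a \<otimes>\<^bsub>fim X\<^esub> a) = theta e \<and>
        theta e = theta (sinv (fim X) b \<otimes>\<^bsub>fim X\<^esub> b))}"

definition Tmon :: "'x word set set monoid" where
  "Tmon = quotient_monoid (fim X) theta_min"

definition tau :: "'x word set \<Rightarrow> 'x word set set" where
  "tau a = theta_min `` {a}"

definition psi :: "'x word set set \<Rightarrow> 'x word set set" where
  "psi t = the_elem (theta ` t)"

text \<open>The inverse of the bijection between idempotents that \<open>psi\<close> restricts to.\<close>

definition lift_idem :: "'x word set set \<Rightarrow> 'x word set set" where
  "lift_idem e = (THE x. x \<in> idems Tmon \<and> psi x = e)"


section \<open>The relation module\<close>

definition K_group :: "'x word set set \<Rightarrow> 'x word set set monoid" where
  "K_group e = \<lparr>carrier = {a \<in> carrier Tmon. psi a = e}, mult = mult Tmon, one = lift_idem e\<rparr>"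

text \<open>
  The structure maps are those forced by the axiom on the action of idempotents (\<open>act_idem\<close>).
\<close>

definition relation_module :: "('x word set set, 'x word set set set) lmodule" where
  "relation_module =
     \<lparr>lcomp = (\<lambda>e. abelianisation (K_group e)),
      lres = (\<lambda>e f c. the_elem
        ((\<lambda>k. ab_class (K_group f) (lift_idem f \<otimes>\<^bsub>Tmon\<^esub> k \<otimes>\<^bsub>Tmon\<^esub> lift_idem f)) ` c)),
      lact = (\<lambda>(e, c) m. let f = sinv Mon m \<otimes>\<^bsub>Mon\<^esub> e \<otimes>\<^bsub>Mon\<^esub> m in
        (f, the_elem ((\<lambda>(t, k). ab_class (K_group f) (sinv Tmon t \<otimes>\<^bsub>Tmon\<^esub> k \<otimes>\<^bsub>Tmon\<^esub> t)) `
              ({t \<in> carrier Tmon. psi t = m} \<times> c))))\<rparr>"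


section \<open>The Squier complex\<close>

type_synonym 'y squier_edge = "'y word set set \<times> 'y word \<times> 'y word \<times> 'y word set set"
type_synonym 'y squier_arrow = "('y word set set, 'y squier_edge) arrow"

definition wT :: "'x word \<Rightarrow> 'x word set set" where
  "wT w = tau (rho X w)"

definition squier :: "('x word set set, 'x squier_edge) complex2" where
  "squier =
     \<lparr>vertices = carrier Tmon,
      edges = {(p, l, r, q). p \<in> carrier Tmon \<and> (l, r) \<in> R \<and> q \<in> carrier Tmon},
      src = (\<lambda>(p, l, r, q). p \<otimes>\<^bsub>Tmon\<^esub> wT l \<otimes>\<^bsub>Tmon\<^esub> q),
      tgt = (\<lambda>(p, l, r, q). p \<otimes>\<^bsub>Tmon\<^esub> wT r \<otimes>\<^bsub>Tmon\<^esub> q),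
      cells =
        {([((p, l, r, q \<otimes>\<^bsub>Tmon\<^esub> p' \<otimes>\<^bsub>Tmon\<^esub> wT l' \<otimes>\<^bsub>Tmon\<^esub> q'), True),
           ((p \<otimes>\<^bsub>Tmon\<^esub> wT r \<otimes>\<^bsub>Tmon\<^esub> q \<otimes>\<^bsub>Tmon\<^esub> p', l', r', q'), True)],
          [((p \<otimes>\<^bsub>Tmon\<^esub> wT l \<otimes>\<^bsub>Tmon\<^esub> q \<otimes>\<^bsub>Tmon\<^esub> p', l', r', q'), True),
           ((p, l, r, q \<otimes>\<^bsub>Tmon\<^esub> p' \<otimes>\<^bsub>Tmon\<^esub> wT r' \<otimes>\<^bsub>Tmon\<^esub> q'), True)]) |
         p l r q p' l' r' q'.
           p \<in> carrier Tmon \<and> q \<in> carrier Tmon \<and> p' \<in> carrier Tmon \<and> q' \<in> carrier Tmon \<and>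
           (l, r) \<in> R \<and> (l', r') \<in> R}\<rparr>"

definition left_act :: "'x word set set \<Rightarrow> 'x squier_arrow \<Rightarrow> 'x squier_arrow" where
  "left_act t \<alpha> = the_elem ((\<lambda>(v, xs, w).
     hclass squier (t \<otimes>\<^bsub>Tmon\<^esub> v)
       (map (\<lambda>((p, l, r, q), b). ((t \<otimes>\<^bsub>Tmon\<^esub> p, l, r, q), b)) xs) (t \<otimes>\<^bsub>Tmon\<^esub> w)) ` \<alpha>)"

definition right_act :: "'x squier_arrow \<Rightarrow> 'x word set set \<Rightarrow> 'x squier_arrow" where
  "right_act \<alpha> t = the_elem ((\<lambda>(v, xs, w).
     hclass squier (v \<otimes>\<^bsub>Tmon\<^esub> t)
       (map (\<lambda>((p, l, r, q), b). ((p, l, r, q \<otimes>\<^bsub>Tmon\<^esub> t), b)) xs) (w \<otimes>\<^bsub>Tmon\<^esub> t)) ` \<alpha>)"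

definition star_mult :: "'x squier_arrow \<Rightarrow> 'x squier_arrow \<Rightarrow> 'x squier_arrow" where
  "star_mult \<alpha> \<beta> = gcomp squier (right_act \<alpha> (gdom \<beta>)) (left_act (gran \<alpha>) \<beta>)"

definition star_group :: "'x word set set \<Rightarrow> 'x squier_arrow monoid" where
  "star_group e =
     \<lparr>carrier = {right_act (left_act e \<alpha>) e | \<alpha>. \<alpha> \<in> fund_groupoid squier \<and> gdom \<alpha> = e},
      mult = star_mult,
      one = hclass squier e [] e\<rparr>"

definition pi_group :: "'x word set set \<Rightarrow> 'x squier_arrow monoid" where
  "pi_group e = (star_group e)\<lparr>carrier := {\<alpha> \<in> carrier (star_group e). gran \<alpha> = e}\<rparr>"

definition pi_module :: "('x word set set, 'x squier_arrow) lmodule" where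
  "pi_module =
     \<lparr>lcomp = (\<lambda>e. pi_group (lift_idem e)),
      lres = (\<lambda>e f \<alpha>. right_act (left_act (lift_idem f) \<alpha>) (lift_idem f)),
      lact = (\<lambda>(e, \<alpha>) m. (sinv Mon m \<otimes>\<^bsub>Mon\<^esub> e \<otimes>\<^bsub>Mon\<^esub> m,
        the_elem ((\<lambda>t. right_act (left_act (sinv Tmon t) \<alpha>) t) ` {t \<in> carrier Tmon. psi t = m})))\<rparr>"

definition star_ab_module :: "('x word set set, 'x squier_arrow set) lmodule" where
  "star_ab_module =
     \<lparr>lcomp = (\<lambda>e. abelianisation (star_group (lift_idem e))),
      lres = (\<lambda>e f c. the_elem
        ((\<lambda>\<alpha>. ab_class (star_group (lift_idem f))
                 (right_act (left_act (lift_idem f) \<alpha>) (lift_idem f))) ` c)),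
      lact = (\<lambda>(e, c) m. let f = sinv Mon m \<otimes>\<^bsub>Mon\<^esub> e \<otimes>\<^bsub>Mon\<^esub> m in
        (f, the_elem ((\<lambda>(t, \<alpha>). ab_class (star_group (lift_idem f))
                                   (right_act (left_act (sinv Tmon t) \<alpha>) t)) `
              ({t \<in> carrier Tmon. psi t = m} \<times> c))))\<rparr>"

end

end

(*
  The group star_e behaves like a free crossed module over K_e.  The 2-cells give the
  interchange law, hence the Peiffer identity: conjugation by beta in star_e is the action of the
  range of beta.  So elements of T with the same image in M act on star_e by maps that differ by an
  inner automorphism, the group pi_e is central, and every star_e is generated by the edges
  (p, l, r, (p l)^-1) with p p^-1 = e and p^-1 p <= l l^-1.  Counting edges with sign, labelled by
  (l, r) and the image of p^-1 in M, is a homotopy invariant, which makes these generators a basis of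
  the abelianised star group.  Exactness on the left needs that pi_e meets the derived subgroup of
  star_e trivially.  This holds because K_e is projective, so that the central extension
  pi_e -> star_e -> K_e splits.
*)

theory Submission
  imports Defs
begin

text \<open>The projectivity of \<open>K_e\<close> is the step that needs a construction. The
  elements of \<open>T\<close> are classes modulo \<open>theta_min\<close>, with no normal form on
  which a lifting could be defined. So the lifting is defined on all words, as an action by partial
  bijections: the Vagner relations then hold automatically, and passing to \<open>theta_min\<close>
  costs one further word, which acts as a partial identity.

  All three modules share one difficulty: an element of \<open>M\<close> acts through a chosen
  preimage in \<open>T\<close>. The inner automorphism caused by another choice disappears in an
  abelianisation, and also on the central subgroup \<open>pi_e\<close>.

  The labels of the edges come from the module structure. An edge \<open>(p, l, r, q)\<close> of a
  star is the translate by \<open>p^-1\<close> of the edge with first entry \<open>l l^-1\<close>.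
  Thus each relation gives one generator, in the component at \<open>l l^-1\<close>, and the image
  of \<open>p^-1\<close> is the coefficient from \<open>M\<close>.

  Exactness in the middle and on the right rests on the range map being onto, for then it also maps
  the derived subgroup onto the derived subgroup.\<close>

lemma the_elem_const:
  assumes "A \<noteq> {}" "\<And>x. x \<in> A \<Longrightarrow> f x = c"
  shows "the_elem (f ` A) = c"
proof -
  have "f ` A = {c}" using assms by auto
  then show ?thesis by simp
qed

section \<open>Inverse monoids\<close>

text \<open>Idempotents turn out to be fixed by \<open>j\<close>, so each has the form
  \<open>a (j a)\<close> and any two of them commute by \<open>comm\<close>. A regular monoid with
  commuting idempotents has unique inverses. The criterion serves quotients, where \<open>j\<close>
  is induced from representatives.\<close>

lemma (in monoid) inverse_monoidI:
  assumes j_closed: "\<And>a. a \<in> carrier G \<Longrightarrow> j a \<in> carrier G"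
    and j_inv: "\<And>a. a \<in> carrier G \<Longrightarrow> a \<otimes> j a \<otimes> a = a"
    and j_j: "\<And>a. a \<in> carrier G \<Longrightarrow> j (j a) = a"
    and j_mult: "\<And>a b. \<lbrakk>a \<in> carrier G; b \<in> carrier G\<rbrakk> \<Longrightarrow> j (a \<otimes> b) = j b \<otimes> j a"
    and comm: "\<And>a b. \<lbrakk>a \<in> carrier G; b \<in> carrier G\<rbrakk>
      \<Longrightarrow> a \<otimes> j a \<otimes> (b \<otimes> j b) = b \<otimes> j b \<otimes> (a \<otimes> j a)"
  shows "inverse_monoid G" and "\<And>a. a \<in> carrier G \<Longrightarrow> sinv G a = j a"
proof -
  have j_inv': "j a \<otimes> a \<otimes> j a = j a" if "a \<in> carrier G" for a
    using j_inv[of "j a"] that by (simp add: j_closed j_j)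
  have j_idem: "j e = e" if e: "e \<in> carrier G" "e \<otimes> e = e" for e
  proof -
    have je: "j e \<in> carrier G" using e by (simp add: j_closed)
    have jee: "j e \<otimes> j e = j e" using j_mult[of e e] e by simp
    \<comment> \<open>Here \<open>j e\<close> is the product of \<open>(j e) e\<close> and
      \<open>e (j e)\<close>, both of the form \<open>a (j a)\<close>. After they are swapped, the
      product collapses to \<open>e\<close>.\<close>
    have "j e = j e \<otimes> (e \<otimes> e) \<otimes> j e" using j_inv' e by simp
    also have "\<dots> = (j e \<otimes> j (j e)) \<otimes> (e \<otimes> j e)" using e(1) je by (simp only: j_j m_assoc m_closed)
    also have "\<dots> = (e \<otimes> j e) \<otimes> (j e \<otimes> j (j e))" using e je by (intro comm)
    also have "\<dots> = e \<otimes> (j e \<otimes> j e) \<otimes> e" using e je by (simp add: j_j m_assoc)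
    also have "\<dots> = e" using jee j_inv e by simp
    finally show ?thesis .
  qed
  have idem_comm: "e \<otimes> f = f \<otimes> e"
    if "e \<in> carrier G" "e \<otimes> e = e" "f \<in> carrier G" "f \<otimes> f = f" for e f
    using comm[of e f] that by (simp add: j_idem)
  have uniq: "b = c"
    if a: "a \<in> carrier G" and b: "b \<in> carrier G" "a \<otimes> b \<otimes> a = a" "b \<otimes> a \<otimes> b = b"
      and c: "c \<in> carrier G" "a \<otimes> c \<otimes> a = a" "c \<otimes> a \<otimes> c = c" for a b c
  proof -
    have ab: "(a \<otimes> b) \<otimes> (a \<otimes> b) = a \<otimes> b" and ba: "(b \<otimes> a) \<otimes> (b \<otimes> a) = b \<otimes> a"
      and ac: "(a \<otimes> c) \<otimes> (a \<otimes> c) = a \<otimes> c" and ca: "(c \<otimes> a) \<otimes> (c \<otimes> a) = c \<otimes> a"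
      using a b c by (metis m_assoc m_closed)+
    \<comment> \<open>Inserting \<open>a c a\<close> for \<open>a\<close> and swapping the
      idempotents \<open>a c\<close> and \<open>a b\<close> gives \<open>b = b a c\<close>; the
      mirror argument gives \<open>c = b a c\<close>.\<close>
    have "b = b \<otimes> (a \<otimes> c \<otimes> a) \<otimes> b" using a b c by simp
    also have "\<dots> = b \<otimes> ((a \<otimes> c) \<otimes> (a \<otimes> b))" using a b(1) c(1) by (simp add: m_assoc)
    also have "\<dots> = b \<otimes> ((a \<otimes> b) \<otimes> (a \<otimes> c))"
      using idem_comm[of "a \<otimes> c" "a \<otimes> b"] a b c ab ac by simp
    also have "\<dots> = (b \<otimes> a \<otimes> b) \<otimes> a \<otimes> c" using a b(1) c by (simp add: m_assoc)
    finally have 1: "b = b \<otimes> a \<otimes> c" using b by simp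
    have "c = c \<otimes> (a \<otimes> b \<otimes> a) \<otimes> c" using a b c by simp
    also have "\<dots> = ((c \<otimes> a) \<otimes> (b \<otimes> a)) \<otimes> c" using a b(1) c(1) by (simp add: m_assoc)
    also have "\<dots> = ((b \<otimes> a) \<otimes> (c \<otimes> a)) \<otimes> c"
      using idem_comm[of "c \<otimes> a" "b \<otimes> a"] a b c ba ca by simp
    also have "\<dots> = b \<otimes> a \<otimes> (c \<otimes> a \<otimes> c)" using a b(1) c(1) by (simp add: m_assoc)
    finally show ?thesis using 1 c by simp
  qed
  show "inverse_monoid G"
  proof
    fix a assume a: "a \<in> carrier G"
    show "\<exists>!b. b \<in> carrier G \<and> a \<otimes> b \<otimes> a = a \<and> b \<otimes> a \<otimes> b = b"
    proof (rule ex1I)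
      show j: "j a \<in> carrier G \<and> a \<otimes> j a \<otimes> a = a \<and> j a \<otimes> a \<otimes> j a = j a"
        using a j_closed j_inv j_inv' by simp
      show "b = j a" if "b \<in> carrier G \<and> a \<otimes> b \<otimes> a = a \<and> b \<otimes> a \<otimes> b = b" for b
        using uniq[OF a] that j by simp
    qed
  qed
  show "sinv G a = j a" if "a \<in> carrier G" for a
    unfolding sinv_def
  proof (rule the_equality)
    show j: "j a \<in> carrier G \<and> a \<otimes> j a \<otimes> a = a \<and> j a \<otimes> a \<otimes> j a = j a"
      using that j_closed j_inv j_inv' by simp
    show "b = j a" if "b \<in> carrier G \<and> a \<otimes> b \<otimes> a = a \<and> b \<otimes> a \<otimes> b = b" for b
      using uniq[OF \<open>a \<in> carrier G\<close>] that j by simp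
  qed
qed

section \<open>Calculus of inverses and commuting idempotents\<close>

context inverse_monoid
begin

lemma sinv_closed [simp]: "a \<in> carrier G \<Longrightarrow> sinv G a \<in> carrier G"
  and mult_sinv_mult: "a \<in> carrier G \<Longrightarrow> a \<otimes> sinv G a \<otimes> a = a"
  and sinv_mult_sinv: "a \<in> carrier G \<Longrightarrow> sinv G a \<otimes> a \<otimes> sinv G a = sinv G a"
  using theI'[OF ex1_sinv, of a] unfolding sinv_def by auto

lemma sinv_unique:
  "\<lbrakk>a \<in> carrier G; b \<in> carrier G; a \<otimes> b \<otimes> a = a; b \<otimes> a \<otimes> b = b\<rbrakk> \<Longrightarrow> sinv G a = b"
  by (metis ex1_sinv sinv_closed mult_sinv_mult sinv_mult_sinv)

lemma sinv_sinv [simp]: "a \<in> carrier G \<Longrightarrow> sinv G (sinv G a) = a"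
  by (rule sinv_unique) (auto simp: mult_sinv_mult sinv_mult_sinv)

lemma idems_closed: "e \<in> idems G \<Longrightarrow> e \<in> carrier G"
  and idems_idem: "e \<in> idems G \<Longrightarrow> e \<otimes> e = e"
  by (auto simp: idems_def)

lemma sinv_idem: "e \<in> idems G \<Longrightarrow> sinv G e = e"
  by (rule sinv_unique) (auto simp: idems_def)

lemma idem_left: "\<lbrakk>e \<in> idems G; y \<in> carrier G\<rbrakk> \<Longrightarrow> e \<otimes> (e \<otimes> y) = e \<otimes> y"
  by (metis idems_closed idems_idem m_assoc)

lemma mult_sinv_left: "\<lbrakk>a \<in> carrier G; y \<in> carrier G\<rbrakk> \<Longrightarrow> a \<otimes> (sinv G a \<otimes> (a \<otimes> y)) = a \<otimes> y"
  by (metis m_assoc m_closed mult_sinv_mult sinv_closed)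

lemma sinv_mult_left:
  "\<lbrakk>a \<in> carrier G; y \<in> carrier G\<rbrakk> \<Longrightarrow> sinv G a \<otimes> (a \<otimes> (sinv G a \<otimes> y)) = sinv G a \<otimes> y"
  by (metis m_assoc m_closed sinv_mult_sinv sinv_closed)

lemma mult_sinv_right: "a \<in> carrier G \<Longrightarrow> a \<otimes> (sinv G a \<otimes> a) = a"
  by (metis m_assoc mult_sinv_mult sinv_closed)

lemma sinv_mult_right: "a \<in> carrier G \<Longrightarrow> sinv G a \<otimes> (a \<otimes> sinv G a) = sinv G a"
  by (metis m_assoc sinv_mult_sinv sinv_closed)

lemmas inv_simps = m_assoc mult_sinv_left sinv_mult_left mult_sinv_right sinv_mult_right

lemma range_idem [simp]: "a \<in> carrier G \<Longrightarrow> a \<otimes> sinv G a \<in> idems G"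
  and domain_idem [simp]: "a \<in> carrier G \<Longrightarrow> sinv G a \<otimes> a \<in> idems G"
  by (auto simp: idems_def inv_simps)

text \<open>If \<open>x\<close> is the inverse of \<open>e f\<close>, then \<open>f x e\<close> is
  an inverse as well, so \<open>x = f x e\<close>, and this is idempotent. An idempotent is its own
  inverse, hence \<open>e f = x\<close>.\<close>

lemma idem_mult_idem:
  assumes e: "e \<in> idems G" and f: "f \<in> idems G"
  shows "e \<otimes> f \<in> idems G"
proof -
  note [simp] = idems_closed[OF e] idems_closed[OF f]
  let ?x = "sinv G (e \<otimes> f)"
  have 1: "e \<otimes> (f \<otimes> (?x \<otimes> (e \<otimes> f))) = e \<otimes> f"
    using mult_sinv_mult[of "e \<otimes> f"] by (simp add: m_assoc)
  have 2: "?x \<otimes> (e \<otimes> (f \<otimes> (?x \<otimes> y))) = ?x \<otimes> y" if "y \<in> carrier G" for y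
    using sinv_mult_left[of "e \<otimes> f" y] that by (simp add: m_assoc)
  have x: "?x = f \<otimes> ?x \<otimes> e"
    by (rule sinv_unique) (use e f in \<open>simp_all add: m_assoc idem_left 1 2\<close>)
  have "?x \<otimes> ?x = (f \<otimes> ?x \<otimes> e) \<otimes> (f \<otimes> ?x \<otimes> e)" using x by simp
  also have "\<dots> = f \<otimes> ?x \<otimes> e" using e f 2 by (simp add: m_assoc)
  finally have "?x \<in> idems G" using x by (simp add: idems_def)
  then show ?thesis using sinv_idem[of ?x] sinv_sinv[of "e \<otimes> f"] by simp
qed

text \<open>Since products of idempotents are idempotent, \<open>f e\<close> is an inverse of
  \<open>e f\<close>; but \<open>e f\<close>, being idempotent, is its own inverse.\<close>

lemma idem_comm:
  assumes e: "e \<in> idems G" and f: "f \<in> idems G"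
  shows "e \<otimes> f = f \<otimes> e"
proof -
  note [simp] = idems_closed[OF e] idems_closed[OF f]
  have ef: "e \<otimes> (f \<otimes> (e \<otimes> f)) = e \<otimes> f" and fe: "f \<otimes> (e \<otimes> (f \<otimes> e)) = f \<otimes> e"
    using idem_mult_idem[OF e f] idem_mult_idem[OF f e] by (simp_all add: idems_def m_assoc)
  have "sinv G (e \<otimes> f) = f \<otimes> e"
    by (rule sinv_unique) (use e f ef fe in \<open>auto simp: m_assoc idem_left\<close>)
  then show ?thesis using sinv_idem[OF idem_mult_idem[OF e f]] by simp
qed

lemma idem_left_comm: "\<lbrakk>e \<in> idems G; f \<in> idems G; y \<in> carrier G\<rbrakk> \<Longrightarrow> e \<otimes> (f \<otimes> y) = f \<otimes> (e \<otimes> y)"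
  by (metis idem_comm idems_closed m_assoc)

lemma sinv_mult:
  assumes a: "a \<in> carrier G" and b: "b \<in> carrier G"
  shows "sinv G (a \<otimes> b) = sinv G b \<otimes> sinv G a"
proof (rule sinv_unique)
  have c: "(b \<otimes> sinv G b) \<otimes> (sinv G a \<otimes> a) = (sinv G a \<otimes> a) \<otimes> (b \<otimes> sinv G b)"
    using a b by (intro idem_comm) auto
  have "a \<otimes> b \<otimes> (sinv G b \<otimes> sinv G a) \<otimes> (a \<otimes> b)
      = a \<otimes> ((b \<otimes> sinv G b) \<otimes> (sinv G a \<otimes> a)) \<otimes> b" using a b by (simp add: m_assoc)
  also have "\<dots> = a \<otimes> b" unfolding c using a b by (simp add: inv_simps)
  finally show "a \<otimes> b \<otimes> (sinv G b \<otimes> sinv G a) \<otimes> (a \<otimes> b) = a \<otimes> b" .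
  have "sinv G b \<otimes> sinv G a \<otimes> (a \<otimes> b) \<otimes> (sinv G b \<otimes> sinv G a)
      = sinv G b \<otimes> ((sinv G a \<otimes> a) \<otimes> (b \<otimes> sinv G b)) \<otimes> sinv G a"
    using a b by (simp add: m_assoc)
  also have "\<dots> = sinv G b \<otimes> sinv G a" unfolding c[symmetric] using a b by (simp add: inv_simps)
  finally show "sinv G b \<otimes> sinv G a \<otimes> (a \<otimes> b) \<otimes> (sinv G b \<otimes> sinv G a) = sinv G b \<otimes> sinv G a" .
qed (use a b in auto)

lemma conj_idem:
  assumes e: "e \<in> idems G" and a: "a \<in> carrier G"
  shows "sinv G a \<otimes> e \<otimes> a \<in> idems G"
proof -
  note [simp] = idems_closed[OF e] a
  have "sinv G a \<otimes> e \<otimes> a \<otimes> (sinv G a \<otimes> e \<otimes> a) = sinv G a \<otimes> (e \<otimes> ((a \<otimes> sinv G a) \<otimes> (e \<otimes> a)))"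
    by (simp add: m_assoc)
  also have "(a \<otimes> sinv G a) \<otimes> (e \<otimes> a) = e \<otimes> ((a \<otimes> sinv G a) \<otimes> a)"
    using e by (intro idem_left_comm) auto
  also have "sinv G a \<otimes> (e \<otimes> (e \<otimes> ((a \<otimes> sinv G a) \<otimes> a))) = sinv G a \<otimes> e \<otimes> a"
    using e by (simp add: inv_simps idem_left)
  finally show ?thesis by (simp add: idems_def)
qed

text \<open>The standard way to move an idempotent through an arbitrary element: it reappears
  conjugated on the other side.\<close>

lemma idem_mult_shift:
  assumes e: "e \<in> idems G" and a: "a \<in> carrier G"
  shows "e \<otimes> a = a \<otimes> (sinv G a \<otimes> e \<otimes> a)"
proof -
  note [simp] = idems_closed[OF e] a
  have "a \<otimes> (sinv G a \<otimes> e \<otimes> a) = (a \<otimes> sinv G a) \<otimes> (e \<otimes> a)" by (simp add: m_assoc)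
  also have "\<dots> = e \<otimes> ((a \<otimes> sinv G a) \<otimes> a)" using e by (intro idem_left_comm) auto
  finally show ?thesis by (simp add: inv_simps)
qed

text \<open>Trades the order on idempotents for an equation that rewriting can use.\<close>

lemma natural_le_idem_iff:
  assumes "e \<in> idems G" "f \<in> idems G"
  shows "natural_le G f e \<longleftrightarrow> f \<otimes> e = f"
proof
  assume "natural_le G f e"
  then obtain g where "g \<in> idems G" "f = g \<otimes> e" by (auto simp: natural_le_def)
  then show "f \<otimes> e = f" using assms by (simp add: m_assoc idems_closed idems_idem)
next
  assume "f \<otimes> e = f"
  then show "natural_le G f e" unfolding natural_le_def using assms by metis
qed

lemma range_le_imp_left_id:
  assumes "a \<in> carrier G" "e \<in> carrier G" "e \<otimes> (a \<otimes> sinv G a) = a \<otimes> sinv G a"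
  shows "e \<otimes> a = a"
proof -
  have "e \<otimes> a = e \<otimes> (a \<otimes> sinv G a) \<otimes> a" using assms(1,2) by (simp add: inv_simps)
  then show ?thesis using assms by (simp add: inv_simps)
qed

end

section \<open>Quotients by congruences\<close>

lemma congruence_on_equiv: "congruence_on G r \<Longrightarrow> equiv (carrier G) r"
  by (simp add: congruence_on_def)

lemma (in monoid) congruence_on_mult:
  assumes r: "congruence_on G r" and "(a, a') \<in> r" "(b, b') \<in> r"
  shows "(a \<otimes> b, a' \<otimes> b') \<in> r"
proof -
  have eq: "equiv (carrier G) r" using r by (rule congruence_on_equiv)
  have c: "a \<in> carrier G" "a' \<in> carrier G" "b \<in> carrier G" "b' \<in> carrier G"
    using assms equiv_type[OF eq] by auto
  have "(a \<otimes> b, a' \<otimes> b) \<in> r" "(a' \<otimes> b, a' \<otimes> b') \<in> r"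
    using r assms c by (auto simp: congruence_on_def)
  then show ?thesis using eq by (meson equivE transD)
qed

locale monoid_congruence = monoid G for G (structure) +
  fixes r
  assumes cong: "congruence_on G r"
begin

abbreviation "Q \<equiv> quotient_monoid G r"
abbreviation cls where "cls a \<equiv> r `` {a}"

lemma equiv_r: "equiv (carrier G) r"
  using cong by (rule congruence_on_equiv)

lemma cls_eq_iff: "\<lbrakk>a \<in> carrier G; b \<in> carrier G\<rbrakk> \<Longrightarrow> cls a = cls b \<longleftrightarrow> (a, b) \<in> r"
  using eq_equiv_class_iff[OF equiv_r] by blast

lemma cls_closed: "a \<in> carrier G \<Longrightarrow> cls a \<in> carrier Q"
  by (simp add: quotient_monoid_def quotientI)

lemma carrierE:
  assumes "A \<in> carrier Q" obtains a where "a \<in> carrier G" "A = cls a"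
  using assms by (auto simp: quotient_monoid_def elim: quotientE)

lemma one_eq: "\<one>\<^bsub>Q\<^esub> = cls \<one>"
  by (simp add: quotient_monoid_def)

lemma mult_eq:
  assumes "a \<in> carrier G" "b \<in> carrier G"
  shows "cls a \<otimes>\<^bsub>Q\<^esub> cls b = cls (a \<otimes> b)"
proof -
  have ne: "cls a \<times> cls b \<noteq> {}" using assms equiv_class_self[OF equiv_r] by auto
  have c: "(case p of (x, y) \<Rightarrow> cls (x \<otimes> y)) = cls (a \<otimes> b)" if "p \<in> cls a \<times> cls b" for p
    using that congruence_on_mult[OF cong] by (auto intro!: equiv_class_eq[OF equiv_r, symmetric])
  show ?thesis unfolding quotient_monoid_def using the_elem_const[OF ne c] by simp
qed

lemma quotient_is_monoid: "monoid Q"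
proof (rule monoidI)
  fix A B C assume "A \<in> carrier Q" "B \<in> carrier Q" "C \<in> carrier Q"
  then show "A \<otimes>\<^bsub>Q\<^esub> B \<otimes>\<^bsub>Q\<^esub> C = A \<otimes>\<^bsub>Q\<^esub> (B \<otimes>\<^bsub>Q\<^esub> C)"
    by (elim carrierE) (simp add: mult_eq m_assoc)
qed (auto elim!: carrierE simp: one_eq mult_eq cls_closed)

text \<open>The base monoid need not have inverses. In the free monoid \<open>word_inv\<close> is an
  involution on the nose, while regularity and commutation hold only modulo the Vagner congruence;
  hence the mixture of equations and memberships in \<open>r\<close>.\<close>

lemma quotient_inverse_monoid:
  assumes j_closed: "\<And>a. a \<in> carrier G \<Longrightarrow> j a \<in> carrier G"
    and j_r: "\<And>a b. (a, b) \<in> r \<Longrightarrow> (j a, j b) \<in> r"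
    and j_inv: "\<And>a. a \<in> carrier G \<Longrightarrow> (a \<otimes> j a \<otimes> a, a) \<in> r"
    and j_j: "\<And>a. a \<in> carrier G \<Longrightarrow> j (j a) = a"
    and j_mult: "\<And>a b. \<lbrakk>a \<in> carrier G; b \<in> carrier G\<rbrakk> \<Longrightarrow> j (a \<otimes> b) = j b \<otimes> j a"
    and comm: "\<And>a b. \<lbrakk>a \<in> carrier G; b \<in> carrier G\<rbrakk>
      \<Longrightarrow> (a \<otimes> j a \<otimes> (b \<otimes> j b), b \<otimes> j b \<otimes> (a \<otimes> j a)) \<in> r"
  shows "inverse_monoid Q" and "\<And>a. a \<in> carrier G \<Longrightarrow> sinv Q (cls a) = cls (j a)"
proof -
  define J where "J A = the_elem ((\<lambda>a. cls (j a)) ` A)" for A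
  have J: "J (cls a) = cls (j a)" if "a \<in> carrier G" for a
    unfolding J_def using that equiv_class_self[OF equiv_r]
    by (intro the_elem_const) (auto intro!: equiv_class_eq[OF equiv_r, symmetric] j_r)
  interpret Q: monoid Q by (rule quotient_is_monoid)
  have "inverse_monoid Q \<and> (\<forall>A\<in>carrier Q. sinv Q A = J A)"
  proof (intro conjI ballI)
    have j_inv': "cls (a \<otimes> j a \<otimes> a) = cls a" if "a \<in> carrier G" for a
      using that by (simp add: cls_eq_iff j_inv j_closed)
    have comm': "cls (a \<otimes> j a \<otimes> (b \<otimes> j b)) = cls (b \<otimes> j b \<otimes> (a \<otimes> j a))"
      if "a \<in> carrier G" "b \<in> carrier G" for a b
      using that by (simp add: cls_eq_iff comm j_closed)
    show "inverse_monoid Q"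
      by (rule Q.inverse_monoidI(1)[of J])
        (auto elim!: carrierE simp: J mult_eq j_closed cls_closed j_j j_mult j_inv' comm')
    show "sinv Q A = J A" if "A \<in> carrier Q" for A
      by (rule Q.inverse_monoidI(2)[of J, OF _ _ _ _ _ that])
        (auto elim!: carrierE simp: J mult_eq j_closed cls_closed j_j j_mult j_inv' comm')
  qed
  then show "inverse_monoid Q" "\<And>a. a \<in> carrier G \<Longrightarrow> sinv Q (cls a) = cls (j a)"
    using J by (auto simp: cls_closed)
qed

end

text \<open>The classes \<open>x\<close> and \<open>y\<close> of the two inverses are both inverses
  of the common class \<open>z\<close>. Uniqueness of inverses is not yet available in the quotient,
  but its proof only swaps \<open>z x\<close> with \<open>z y\<close> and \<open>x z\<close> with
  \<open>y z\<close>. These are classes of idempotents of \<open>G\<close>, which commute already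
  there.\<close>

lemma (in inverse_monoid) congruence_on_sinv:
  assumes r: "congruence_on G r" and ab: "(a, b) \<in> r"
  shows "(sinv G a, sinv G b) \<in> r"
proof -
  interpret monoid_congruence G r by (unfold_locales) (rule r)
  interpret Q: monoid Q by (rule quotient_is_monoid)
  have c [simp]: "a \<in> carrier G" "b \<in> carrier G"
    using ab equiv_type[OF equiv_r] by auto
  define x where "x = cls (sinv G a)"
  define y where "y = cls (sinv G b)"
  define z where "z = cls a"
  have z': "z = cls b" unfolding z_def using ab by (simp add: cls_eq_iff)
  have cl: "x \<in> carrier Q" "y \<in> carrier Q" "z \<in> carrier Q"
    unfolding x_def y_def z_def by (auto intro: cls_closed)
  have 1: "x \<otimes>\<^bsub>Q\<^esub> z \<otimes>\<^bsub>Q\<^esub> x = x" "z \<otimes>\<^bsub>Q\<^esub> x \<otimes>\<^bsub>Q\<^esub> z = z"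
    unfolding x_def z_def by (simp_all add: mult_eq mult_sinv_mult sinv_mult_sinv)
  have 2: "y \<otimes>\<^bsub>Q\<^esub> z \<otimes>\<^bsub>Q\<^esub> y = y" "z \<otimes>\<^bsub>Q\<^esub> y \<otimes>\<^bsub>Q\<^esub> z = z"
    unfolding y_def z' by (simp_all add: mult_eq mult_sinv_mult sinv_mult_sinv)
  have 3: "(z \<otimes>\<^bsub>Q\<^esub> x) \<otimes>\<^bsub>Q\<^esub> (z \<otimes>\<^bsub>Q\<^esub> y) = (z \<otimes>\<^bsub>Q\<^esub> y) \<otimes>\<^bsub>Q\<^esub> (z \<otimes>\<^bsub>Q\<^esub> x)"
    using idem_comm[of "a \<otimes> sinv G a" "b \<otimes> sinv G b"]
    unfolding x_def y_def by (subst (1 4) z_def, subst (1 2) z') (simp add: mult_eq)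
  have 4: "(x \<otimes>\<^bsub>Q\<^esub> z) \<otimes>\<^bsub>Q\<^esub> (y \<otimes>\<^bsub>Q\<^esub> z) = (y \<otimes>\<^bsub>Q\<^esub> z) \<otimes>\<^bsub>Q\<^esub> (x \<otimes>\<^bsub>Q\<^esub> z)"
    using idem_comm[of "sinv G a \<otimes> a" "sinv G b \<otimes> b"]
    unfolding x_def y_def by (subst (1 4) z_def, subst (1 2) z') (simp add: mult_eq)
  have "x = x \<otimes>\<^bsub>Q\<^esub> ((z \<otimes>\<^bsub>Q\<^esub> y) \<otimes>\<^bsub>Q\<^esub> (z \<otimes>\<^bsub>Q\<^esub> x))"
    using 1 2 cl by (metis Q.m_assoc Q.m_closed)
  also have "\<dots> = x \<otimes>\<^bsub>Q\<^esub> z \<otimes>\<^bsub>Q\<^esub> y"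
    unfolding 3[symmetric] using 1 2 cl by (metis Q.m_assoc Q.m_closed)
  also have "\<dots> = ((x \<otimes>\<^bsub>Q\<^esub> z) \<otimes>\<^bsub>Q\<^esub> (y \<otimes>\<^bsub>Q\<^esub> z)) \<otimes>\<^bsub>Q\<^esub> y"
    using 1 2 cl by (metis Q.m_assoc Q.m_closed)
  also have "\<dots> = y"
    unfolding 4 using 1 2 cl by (metis Q.m_assoc Q.m_closed)
  finally show ?thesis unfolding x_def y_def by (simp add: cls_eq_iff)
qed

locale inverse_congruence = inverse_monoid G for G (structure) +
  fixes r
  assumes icong: "congruence_on G r"
begin

sublocale monoid_congruence G r
  by (unfold_locales) (rule icong)

lemma quotient_is_inverse: "inverse_monoid Q"
  and sinv_cls: "a \<in> carrier G \<Longrightarrow> sinv Q (cls a) = cls (sinv G a)"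
proof -
  have comm: "a \<otimes> sinv G a \<otimes> (b \<otimes> sinv G b) = b \<otimes> sinv G b \<otimes> (a \<otimes> sinv G a)"
    if "a \<in> carrier G" "b \<in> carrier G" for a b
    using that by (intro idem_comm) auto
  have refl: "(a, a) \<in> r" if "a \<in> carrier G" for a
    using that equiv_r by (meson equivE refl_onD)
  note q = quotient_inverse_monoid[of "sinv G"]
  show "inverse_monoid Q"
    by (rule q(1)) (auto simp: congruence_on_sinv[OF icong] mult_sinv_mult sinv_mult comm intro: refl)
  show "a \<in> carrier G \<Longrightarrow> sinv Q (cls a) = cls (sinv G a)"
    by (rule q(2)) (auto simp: congruence_on_sinv[OF icong] mult_sinv_mult sinv_mult comm intro: refl)
qed

text \<open>An idempotent class equals \<open>A A^-1\<close>, so the range idempotent of any of its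
  representatives represents it too.\<close>

lemma idems_quotientE:
  assumes "A \<in> idems Q" obtains a where "a \<in> idems G" "A = cls a"
proof -
  interpret Q: inverse_monoid Q by (rule quotient_is_inverse)
  obtain a where a: "a \<in> carrier G" "A = cls a" using assms Q.idems_closed carrierE by metis
  have "A = A \<otimes>\<^bsub>Q\<^esub> sinv Q A" using assms Q.sinv_idem Q.idems_idem by simp
  then have "A = cls (a \<otimes> sinv G a)" using a by (simp add: sinv_cls mult_eq)
  then show ?thesis using that[OF range_idem] a by simp
qed

lemma cls_idem: "e \<in> idems G \<Longrightarrow> cls e \<in> idems Q"
  by (auto simp: idems_def mult_eq cls_closed)

end

text \<open>Provides a member of the family whose intersection is the generated congruence, so that
  the intersection stays inside the carrier.\<close>

lemma (in monoid) congruence_on_full: "congruence_on G (carrier G \<times> carrier G)"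
  by (auto simp: congruence_on_def equiv_def refl_on_def sym_def trans_def)

lemma (in monoid)
  assumes S: "S \<subseteq> carrier G \<times> carrier G"
  shows congruence_generated_congruence: "congruence_on G (congruence_generated G S)"
    and congruence_generated_incl: "S \<subseteq> congruence_generated G S"
proof -
  let ?F = "{r. congruence_on G r \<and> S \<subseteq> r}"
  have full: "carrier G \<times> carrier G \<in> ?F" using congruence_on_full S by auto
  have "equiv (carrier G) (\<Inter>?F)"
  proof (rule equivI)
    show "\<Inter>?F \<subseteq> carrier G \<times> carrier G" using full by blast
    show "refl_on (carrier G) (\<Inter>?F)"
      by (auto simp: refl_on_def congruence_on_def equiv_def)
    show "sym (\<Inter>?F)"
      by (auto simp: sym_def congruence_on_def equiv_def)
    show "trans (\<Inter>?F)"
      by (rule transI) (auto simp: congruence_on_def equiv_def elim: transE)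
  qed
  then show "congruence_on G (congruence_generated G S)"
    unfolding congruence_generated_def congruence_on_def by blast
  show "S \<subseteq> congruence_generated G S"
    by (auto simp: congruence_generated_def)
qed

lemma congruence_generated_least:
  "\<lbrakk>congruence_on G r; S \<subseteq> r\<rbrakk> \<Longrightarrow> congruence_generated G S \<subseteq> r"
  by (auto simp: congruence_generated_def)

section \<open>The monoids of an inverse monoid presentation\<close>

lemma monoid_free_monoid: "monoid (free_monoid X)"
  by (rule monoidI) (auto simp: free_monoid_def words_def)

lemma append_words [simp]: "u @ v \<in> words X \<longleftrightarrow> u \<in> words X \<and> v \<in> words X"
  by (simp add: words_def)

lemma Nil_words [simp]: "[] \<in> words X"
  by (simp add: words_def)

lemma Inl_in_Plus_iff [simp]: "Inl x \<in> A <+> B \<longleftrightarrow> x \<in> A"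
  and Inr_in_Plus_iff [simp]: "Inr y \<in> A <+> B \<longleftrightarrow> y \<in> B"
  by auto

lemma Cons_words [simp]: "a # w \<in> words X \<longleftrightarrow> a \<in> X <+> X \<and> w \<in> words X"
  by (simp add: words_def)

lemma word_inv_append [simp]: "word_inv (u @ v) = word_inv v @ word_inv u"
  by (simp add: word_inv_def)

lemma word_inv_Nil [simp]: "word_inv [] = []"
  by (simp add: word_inv_def)

lemma word_inv_Cons: "word_inv (a # w) = word_inv w @ [case_sum Inr Inl a]"
  by (simp add: word_inv_def)

lemma word_inv_word_inv [simp]: "word_inv (word_inv w) = w"
  by (induction w) (auto simp: word_inv_Cons split: sum.split)

lemma word_inv_words [simp]: "word_inv w \<in> words X \<longleftrightarrow> w \<in> words X"
proof -
  have *: "word_inv w \<in> words X" if "w \<in> words X" for w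
    using that by (induction w) (auto simp: word_inv_Cons)
  show ?thesis using *[of w] *[of "word_inv w"] by auto
qed

section \<open>The Vagner congruence and the free inverse monoid\<close>

abbreviation vagner_pairs :: "'x set \<Rightarrow> ('x word \<times> 'x word) set" where
  "vagner_pairs X \<equiv> {(w, w @ word_inv w @ w) | w. w \<in> words X} \<union>
      {(u @ word_inv u @ w @ word_inv w, w @ word_inv w @ u @ word_inv u) | u w.
         u \<in> words X \<and> w \<in> words X}"

lemma vagner_pairs_carrier:
  "vagner_pairs X \<subseteq> carrier (free_monoid X) \<times> carrier (free_monoid X)"
  by (auto simp: free_monoid_def)

lemma vagner_congruence: "congruence_on (free_monoid X) (vagner X)"
  unfolding vagner_def
  by (rule monoid.congruence_generated_congruence[OF monoid_free_monoid vagner_pairs_carrier])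

lemma vagner_pairs_incl: "vagner_pairs X \<subseteq> vagner X"
  unfolding vagner_def
  by (rule monoid.congruence_generated_incl[OF monoid_free_monoid vagner_pairs_carrier])

text \<open>Serves as an induction principle: a statement about Vagner equivalent words follows once
  the pairs satisfying it form a congruence that contains both kinds of generating pairs.\<close>

lemma vagner_least:
  assumes "equiv (words X) r"
    and "\<And>a b c. \<lbrakk>(a, b) \<in> r; c \<in> words X\<rbrakk> \<Longrightarrow> (c @ a, c @ b) \<in> r \<and> (a @ c, b @ c) \<in> r"
    and "\<And>w. w \<in> words X \<Longrightarrow> (w, w @ word_inv w @ w) \<in> r"
    and "\<And>u w. \<lbrakk>u \<in> words X; w \<in> words X\<rbrakk>
      \<Longrightarrow> (u @ word_inv u @ w @ word_inv w, w @ word_inv w @ u @ word_inv u) \<in> r"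
  shows "vagner X \<subseteq> r"
  unfolding vagner_def
  by (rule congruence_generated_least)
    (use assms in \<open>fastforce simp: congruence_on_def free_monoid_def\<close>)+

lemma vagner_equiv: "equiv (words X) (vagner X)"
  using congruence_on_equiv[OF vagner_congruence[of X]] by (simp add: free_monoid_def)

lemma vagner_append:
  "\<lbrakk>(a, b) \<in> vagner X; c \<in> words X\<rbrakk> \<Longrightarrow> (c @ a, c @ b) \<in> vagner X \<and> (a @ c, b @ c) \<in> vagner X"
  using vagner_congruence[of X] by (fastforce simp: congruence_on_def free_monoid_def)

text \<open>Formal inversion permutes the generating pairs: the pair of \<open>w\<close> goes to
  that of \<open>word_inv w\<close>, and a commutation pair goes to itself with the roles of
  \<open>u\<close> and \<open>w\<close> exchanged.\<close>

lemma vagner_word_inv: "(a, b) \<in> vagner X \<Longrightarrow> (word_inv a, word_inv b) \<in> vagner X"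
proof -
  let ?r = "{(a, b). a \<in> words X \<and> b \<in> words X \<and> (word_inv a, word_inv b) \<in> vagner X}"
  have "vagner X \<subseteq> ?r"
  proof (rule vagner_least)
    show "equiv (words X) ?r"
    proof (rule equivI)
      show "refl_on (words X) ?r"
        using vagner_equiv[of X] by (auto simp: refl_on_def equiv_def)
      show "sym ?r" using vagner_equiv[of X] by (auto simp: sym_def equiv_def)
      show "trans ?r" using vagner_equiv[of X] unfolding trans_def equiv_def by blast
    qed auto
    show "(c @ a, c @ b) \<in> ?r \<and> (a @ c, b @ c) \<in> ?r" if "(a, b) \<in> ?r" "c \<in> words X" for a b c
      using that by (auto simp: vagner_append)
    show "(w, w @ word_inv w @ w) \<in> ?r" if "w \<in> words X" for w
    proof -
      have "(word_inv w, word_inv w @ word_inv (word_inv w) @ word_inv w) \<in> vagner_pairs X"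
        using that word_inv_words by blast
      then show ?thesis using that vagner_pairs_incl[of X] by auto
    qed
    show "(u @ word_inv u @ w @ word_inv w, w @ word_inv w @ u @ word_inv u) \<in> ?r"
      if "u \<in> words X" "w \<in> words X" for u w
    proof -
      have "(w @ word_inv w @ u @ word_inv u, u @ word_inv u @ w @ word_inv w) \<in> vagner_pairs X"
        using that by blast
      then show ?thesis using that vagner_pairs_incl[of X] by auto
    qed
  qed
  then show "(a, b) \<in> vagner X \<Longrightarrow> (word_inv a, word_inv b) \<in> vagner X" by auto
qed

lemma
  shows fim_inverse_monoid: "inverse_monoid (fim X)"
    and sinv_rho: "w \<in> words X \<Longrightarrow> sinv (fim X) (rho X w) = rho X (word_inv w)"
    and rho_closed: "w \<in> words X \<Longrightarrow> rho X w \<in> carrier (fim X)"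
    and rho_append: "\<lbrakk>u \<in> words X; w \<in> words X\<rbrakk>
      \<Longrightarrow> rho X (u @ w) = rho X u \<otimes>\<^bsub>fim X\<^esub> rho X w"
    and rho_Nil: "rho X [] = \<one>\<^bsub>fim X\<^esub>"
    and rho_surj: "a \<in> carrier (fim X) \<Longrightarrow> \<exists>w\<in>words X. a = rho X w"
    and rho_eq_iff: "\<lbrakk>u \<in> words X; w \<in> words X\<rbrakk> \<Longrightarrow> rho X u = rho X w \<longleftrightarrow> (u, w) \<in> vagner X"
proof -
  interpret free: monoid "free_monoid X" by (rule monoid_free_monoid)
  interpret V: monoid_congruence "free_monoid X" "vagner X"
    by (unfold_locales) (rule vagner_congruence)
  have car: "carrier (free_monoid X) = words X" and mult: "a \<otimes>\<^bsub>free_monoid X\<^esub> b = a @ b"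
    and one: "\<one>\<^bsub>free_monoid X\<^esub> = []" for a b
    by (simp_all add: free_monoid_def)
  have w3: "(w @ word_inv w @ w, w) \<in> vagner X" if "w \<in> words X" for w
  proof -
    have "(w, w @ word_inv w @ w) \<in> vagner X" using that vagner_pairs_incl[of X] by auto
    then show ?thesis using vagner_equiv by (meson equivE symD)
  qed
  have w4: "(u @ word_inv u @ w @ word_inv w, w @ word_inv w @ u @ word_inv u) \<in> vagner X"
    if "u \<in> words X" "w \<in> words X" for u w
    using that vagner_pairs_incl[of X] by auto
  note q = V.quotient_inverse_monoid[of word_inv]
  show "inverse_monoid (fim X)" unfolding fim_def
    by (rule q(1)) (auto simp: car mult vagner_word_inv w3 w4)
  show "sinv (fim X) (rho X w) = rho X (word_inv w)" if "w \<in> words X"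
    unfolding fim_def rho_def
    by (rule q(2)) (use that in \<open>auto simp: car mult vagner_word_inv w3 w4\<close>)
  show "w \<in> words X \<Longrightarrow> rho X w \<in> carrier (fim X)"
    using V.cls_closed by (simp add: fim_def rho_def car)
  show "\<lbrakk>u \<in> words X; w \<in> words X\<rbrakk> \<Longrightarrow> rho X (u @ w) = rho X u \<otimes>\<^bsub>fim X\<^esub> rho X w"
    using V.mult_eq by (simp add: fim_def rho_def car mult)
  show "rho X [] = \<one>\<^bsub>fim X\<^esub>" using V.one_eq by (simp add: fim_def rho_def one)
  show "a \<in> carrier (fim X) \<Longrightarrow> \<exists>w\<in>words X. a = rho X w"
    unfolding fim_def rho_def by (elim V.carrierE) (auto simp: car)
  show "\<lbrakk>u \<in> words X; w \<in> words X\<rbrakk> \<Longrightarrow> rho X u = rho X w \<longleftrightarrow> (u, w) \<in> vagner X"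
    using V.cls_eq_iff by (simp add: rho_def car)
qed

section \<open>The congruences defining \<open>M\<close> and \<open>T\<close>\<close>

locale presentation =
  fixes X :: "'x set" and R :: "('x word \<times> 'x word) set"
  assumes R_words: "R \<subseteq> words X \<times> words X"
begin

sublocale F: inverse_monoid "fim X"
  by (rule fim_inverse_monoid)

abbreviation F_mult (infixl \<open>\<odot>\<close> 70) where "a \<odot> b \<equiv> a \<otimes>\<^bsub>fim X\<^esub> b"
abbreviation FC where "FC \<equiv> carrier (fim X)"
abbreviation EF where "EF \<equiv> idems (fim X)"
abbreviation F_sinv where "F_sinv \<equiv> sinv (fim X)"
abbreviation \<theta> where "\<theta> \<equiv> theta X R"
abbreviation \<theta>\<^sub>m where "\<theta>\<^sub>m \<equiv> theta_min X R"

abbreviation rel_pairs where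
  "rel_pairs \<equiv> {(rho X l, rho X r) | l r. (l, r) \<in> R}"

lemma rel_pairs_carrier: "rel_pairs \<subseteq> FC \<times> FC"
  using R_words by (auto intro: rho_closed)

sublocale Th: inverse_congruence "fim X" "theta_rel X R"
  by unfold_locales (simp add: theta_rel_def F.congruence_generated_congruence[OF rel_pairs_carrier])

lemma theta_eq_cls: "\<theta> a = Th.cls a"
  by (simp add: theta_def)

sublocale M: inverse_monoid "Mon X R"
  unfolding Mon_def by (rule Th.quotient_is_inverse)

lemma theta_closed: "a \<in> FC \<Longrightarrow> \<theta> a \<in> carrier (Mon X R)"
  and theta_mult: "\<lbrakk>a \<in> FC; b \<in> FC\<rbrakk>
    \<Longrightarrow> \<theta> (a \<odot> b) = \<theta> a \<otimes>\<^bsub>Mon X R\<^esub> \<theta> b"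
  and theta_sinv: "a \<in> FC \<Longrightarrow> \<theta> (F_sinv a) = sinv (Mon X R) (\<theta> a)"
  and theta_one: "\<theta> \<one>\<^bsub>fim X\<^esub> = \<one>\<^bsub>Mon X R\<^esub>"
  unfolding Mon_def theta_eq_cls
  by (simp_all add: Th.cls_closed Th.mult_eq Th.sinv_cls Th.one_eq)

lemma theta_idem: "e \<in> EF \<Longrightarrow> \<theta> e \<in> idems (Mon X R)"
  unfolding Mon_def theta_eq_cls by (rule Th.cls_idem)

text \<open>In \<open>a = a (a^-1 a)\<close> the last factor may be replaced by \<open>e\<close>
  once \<open>theta\<close> is applied. So \<open>a\<close> has the image of
  \<open>a e = b e\<close>, and so has \<open>b\<close>. This is what makes \<open>psi\<close> well
  defined.\<close>

lemma theta_min_imp_theta_eq: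
  assumes "(a, b) \<in> \<theta>\<^sub>m"
  shows "\<theta> a = \<theta> b"
proof -
  obtain e where e: "e \<in> EF" "a \<odot> e = b \<odot> e"
      "\<theta> (F_sinv a \<odot> a) = \<theta> e"
      "\<theta> e = \<theta> (F_sinv b \<odot> b)"
    and [simp]: "a \<in> FC" "b \<in> FC"
    using assms by (auto simp: theta_min_def)
  have [simp]: "e \<in> FC" using e(1) by (rule F.idems_closed)
  have "\<theta> a = \<theta> (a \<odot> (F_sinv a \<odot> a))"
    by (simp add: F.inv_simps)
  also have "\<dots> = \<theta> (a \<odot> e)" using e(3) by (simp add: theta_mult)
  also have "\<dots> = \<theta> (b \<odot> (F_sinv b \<odot> b))"
    using e(2,4) by (simp add: theta_mult)
  finally show ?thesis by (simp add: F.inv_simps)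
qed

lemma theta_minI:
  "\<lbrakk>a \<in> FC; b \<in> FC; e \<in> EF;
    a \<odot> e = b \<odot> e; \<theta> (F_sinv a \<odot> a) = \<theta> e;
    \<theta> e = \<theta> (F_sinv b \<odot> b)\<rbrakk> \<Longrightarrow> (a, b) \<in> \<theta>\<^sub>m"
  by (auto simp: theta_min_def)

lemma theta_min_equiv: "equiv (FC) (\<theta>\<^sub>m)"
proof (rule equivI)
  show "\<theta>\<^sub>m \<subseteq> FC \<times> FC" by (auto simp: theta_min_def)
  show "refl_on (FC) (\<theta>\<^sub>m)"
  proof (rule refl_onI)
    fix a assume "a \<in> FC"
    then show "(a, a) \<in> \<theta>\<^sub>m"
      by (intro theta_minI[where e = "F_sinv a \<odot> a"]) auto
  qed
  show "sym (\<theta>\<^sub>m)" by (fastforce simp: sym_def theta_min_def)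
  show "trans (\<theta>\<^sub>m)"
  proof (rule transI)
    fix a b c assume ab: "(a, b) \<in> \<theta>\<^sub>m" and bc: "(b, c) \<in> \<theta>\<^sub>m"
    from ab obtain e where e: "e \<in> EF" "a \<odot> e = b \<odot> e"
        "\<theta> (F_sinv a \<odot> a) = \<theta> e"
        "\<theta> e = \<theta> (F_sinv b \<odot> b)"
      and [simp]: "a \<in> FC" "b \<in> FC"
      by (auto simp: theta_min_def)
    from bc obtain f where f: "f \<in> EF" "b \<odot> f = c \<odot> f"
        "\<theta> (F_sinv b \<odot> b) = \<theta> f"
        "\<theta> f = \<theta> (F_sinv c \<odot> c)"
      and [simp]: "c \<in> FC"
      by (auto simp: theta_min_def)
    have [simp]: "e \<in> FC" "f \<in> FC"
      using e f F.idems_closed by blast+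
    \<comment> \<open>Both witnesses have the image of \<open>b^-1 b\<close>, so their product is a
      witness with that same image.\<close>
    have th: "\<theta> (e \<odot> f) = \<theta> e"
      using e f theta_idem[OF e(1)] by (simp add: theta_mult M.idems_idem)
    show "(a, c) \<in> \<theta>\<^sub>m"
    proof (rule theta_minI[where e = "e \<odot> f"])
      have "a \<odot> (e \<odot> f) = b \<odot> (e \<odot> f)"
        using e(2) by (simp flip: F.m_assoc)
      also have "\<dots> = c \<odot> (e \<odot> f)"
        unfolding F.idem_comm[OF e(1) f(1)] using f(2) by (simp flip: F.m_assoc)
      finally show "a \<odot> (e \<odot> f) = c \<odot> (e \<odot> f)" .
    qed (use e f th F.idem_mult_idem in auto)
  qed
qed

lemma theta_min_congruence: "congruence_on (fim X) (\<theta>\<^sub>m)"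
  unfolding congruence_on_def
proof (intro conjI ballI theta_min_equiv, clarify)
  fix a b c assume ab: "(a, b) \<in> \<theta>\<^sub>m" and c [simp]: "c \<in> FC"
  from ab obtain e where e: "e \<in> EF" "a \<odot> e = b \<odot> e"
      "\<theta> (F_sinv a \<odot> a) = \<theta> e"
      "\<theta> e = \<theta> (F_sinv b \<odot> b)"
    and [simp]: "a \<in> FC" "b \<in> FC"
    by (auto simp: theta_min_def)
  have [simp]: "e \<in> FC" using e(1) by (rule F.idems_closed)
  have th: "\<theta> a = \<theta> b" using ab by (rule theta_min_imp_theta_eq)
  have ae: "a \<odot> (e \<odot> y) = b \<odot> (e \<odot> y)" if "y \<in> FC" for y
    using e(2) that by (simp flip: F.m_assoc)
  let ?d = "F_sinv (c \<odot> a) \<odot> (c \<odot> a)"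
  have d: "?d \<in> EF" by simp
  have thd: "\<theta> (e \<odot> ?d) = \<theta> ?d"
  proof -
    have "\<theta> (e \<odot> ?d) = \<theta> ((F_sinv a \<odot> a) \<odot> ?d)"
      using e(3) by (simp add: theta_mult)
    also have "(F_sinv a \<odot> a) \<odot> ?d = ?d"
      by (simp add: F.sinv_mult F.inv_simps)
    finally show ?thesis .
  qed
  \<comment> \<open>The old witness \<open>e\<close> has the image of \<open>a^-1 a\<close>, which
    is in general too large for \<open>c a\<close>. Multiplying it by the domain idempotent
    \<open>?d\<close> of \<open>c a\<close> corrects this.\<close>
  have 1: "(c \<odot> a, c \<odot> b) \<in> \<theta>\<^sub>m"
  proof (rule theta_minI[where e = "e \<odot> ?d"])
    show "c \<odot> a \<odot> (e \<odot> ?d) = c \<odot> b \<odot> (e \<odot> ?d)"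
      by (simp add: F.m_assoc ae)
    show "\<theta> (e \<odot> ?d) = \<theta> (F_sinv (c \<odot> b) \<odot> (c \<odot> b))"
      unfolding thd by (simp add: theta_mult theta_sinv th)
  qed (use thd e(1) d F.idem_mult_idem in auto)
  \<comment> \<open>For multiplication on the right the witness is the conjugate of \<open>e\<close>
    by \<open>c\<close>, and this equation carries it through \<open>c\<close>.\<close>
  have shift: "e \<odot> c = c \<odot> (F_sinv c \<odot> e \<odot> c)"
    using e(1) by (intro F.idem_mult_shift) auto
  have 2: "(a \<odot> c, b \<odot> c) \<in> \<theta>\<^sub>m"
  proof (rule theta_minI[where e = "F_sinv c \<odot> e \<odot> c"])
    show "a \<odot> c \<odot> (F_sinv c \<odot> e \<odot> c)
        = b \<odot> c \<odot> (F_sinv c \<odot> e \<odot> c)"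
      using shift by (simp add: F.m_assoc flip: ae)
    have *: "\<theta> (F_sinv c \<odot> e \<odot> c)
        = \<theta> (F_sinv (a \<odot> c) \<odot> (a \<odot> c))"
      using e(3) by (simp add: theta_mult F.sinv_mult F.m_assoc M.m_assoc theta_closed flip: e(3))
    then show "\<theta> (F_sinv (a \<odot> c) \<odot> (a \<odot> c))
        = \<theta> (F_sinv c \<odot> e \<odot> c)" by simp
    show "\<theta> (F_sinv c \<odot> e \<odot> c)
        = \<theta> (F_sinv (b \<odot> c) \<odot> (b \<odot> c))"
      unfolding * by (simp add: theta_mult theta_sinv th)
  qed (use e(1) F.conj_idem in auto)
  show "(c \<odot> a, c \<odot> b) \<in> \<theta>\<^sub>m \<and>
        (a \<odot> c, b \<odot> c) \<in> \<theta>\<^sub>m"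
    using 1 2 by simp
qed

sublocale Tm: inverse_congruence "fim X" "\<theta>\<^sub>m"
  by unfold_locales (rule theta_min_congruence)

section \<open>The monoid \<open>T\<close> over \<open>M\<close> and the identification of their
  idempotents\<close>

sublocale T: inverse_monoid "Tmon X R"
  unfolding Tmon_def by (rule Tm.quotient_is_inverse)

abbreviation T_mult (infixl \<open>\<cdot>\<close> 70) where "a \<cdot> b \<equiv> a \<otimes>\<^bsub>Tmon X R\<^esub> b"
abbreviation M_mult (infixl \<open>\<bullet>\<close> 70) where "a \<bullet> b \<equiv> a \<otimes>\<^bsub>Mon X R\<^esub> b"
abbreviation T_sinv (\<open>_\<star>\<close> [1000] 999) where "a\<star> \<equiv> sinv (Tmon X R) a"
abbreviation M_sinv (\<open>_\<diamond>\<close> [1000] 999) where "a\<diamond> \<equiv> sinv (Mon X R) a"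
abbreviation TC where "TC \<equiv> carrier (Tmon X R)"
abbreviation MC where "MC \<equiv> carrier (Mon X R)"
abbreviation ET where "ET \<equiv> idems (Tmon X R)"
abbreviation EM where "EM \<equiv> idems (Mon X R)"
abbreviation \<psi> where "\<psi> \<equiv> psi X R"
abbreviation lft where "lft \<equiv> lift_idem X R"
abbreviation w\<^sub>T where "w\<^sub>T \<equiv> wT X R"

lemma tau_eq_cls: "tau X R a = Tm.cls a"
  by (simp add: tau_def)

lemma tau_closed: "a \<in> FC \<Longrightarrow> tau X R a \<in> TC"
  and tau_mult: "\<lbrakk>a \<in> FC; b \<in> FC\<rbrakk>
    \<Longrightarrow> tau X R (a \<odot> b) = tau X R a \<cdot> tau X R b"
  and tau_sinv: "a \<in> FC \<Longrightarrow> tau X R (F_sinv a) = (tau X R a)\<star>"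
  and tau_one: "tau X R \<one>\<^bsub>fim X\<^esub> = \<one>\<^bsub>Tmon X R\<^esub>"
  and tau_eq_iff: "\<lbrakk>a \<in> FC; b \<in> FC\<rbrakk>
    \<Longrightarrow> tau X R a = tau X R b \<longleftrightarrow> (a, b) \<in> \<theta>\<^sub>m"
  unfolding Tmon_def tau_eq_cls
  by (simp_all add: Tm.cls_closed Tm.mult_eq Tm.sinv_cls Tm.one_eq Tm.cls_eq_iff)

lemma tau_surj: assumes "t \<in> TC" obtains a where "a \<in> FC" "t = tau X R a"
  using assms unfolding Tmon_def tau_eq_cls by (elim Tm.carrierE)

lemma psi_tau: assumes "a \<in> FC" shows "\<psi> (tau X R a) = \<theta> a"
  unfolding psi_def tau_def
  by (rule the_elem_const)
    (use assms equiv_class_self[OF theta_min_equiv] theta_min_imp_theta_eq in fastforce)+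

lemma psi_closed [simp]: "t \<in> TC \<Longrightarrow> \<psi> t \<in> MC"
  by (elim tau_surj) (simp add: psi_tau theta_closed)

lemma psi_mult: "\<lbrakk>t \<in> TC; u \<in> TC\<rbrakk> \<Longrightarrow> \<psi> (t \<cdot> u) = \<psi> t \<bullet> \<psi> u"
  by (elim tau_surj) (simp add: psi_tau theta_mult flip: tau_mult)

lemma psi_sinv: "t \<in> TC \<Longrightarrow> \<psi> (t\<star>) = (\<psi> t)\<diamond>"
  by (elim tau_surj) (simp add: psi_tau theta_sinv flip: tau_sinv)

lemma psi_one: "\<psi> \<one>\<^bsub>Tmon X R\<^esub> = \<one>\<^bsub>Mon X R\<^esub>"
  by (simp add: psi_tau theta_one flip: tau_one)

lemma psi_surj: assumes "m \<in> MC" obtains t where "t \<in> TC" "\<psi> t = m"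
proof -
  obtain a where "a \<in> FC" "m = \<theta> a"
    using assms unfolding Mon_def theta_eq_cls by (elim Th.carrierE)
  then show ?thesis using that psi_tau tau_closed by metis
qed

lemma psi_idem: "e \<in> ET \<Longrightarrow> \<psi> e \<in> EM"
  unfolding idems_def by (auto simp flip: psi_mult)

text \<open>Both idempotents come from idempotents \<open>a\<close> and \<open>b\<close> of the free
  inverse monoid. If these have the same image in \<open>M\<close>, then \<open>a b\<close> is a
  witness for \<open>theta_min\<close>. Most later equations between idempotents of \<open>T\<close>
  are checked in \<open>M\<close> through this fact.\<close>

lemma psi_idem_inj:
  assumes "e \<in> ET" "f \<in> ET" "\<psi> e = \<psi> f"
  shows "e = f"
proof -
  obtain a b where a: "a \<in> EF" "e = tau X R a" and b: "b \<in> EF" "f = tau X R b"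
    using assms(1,2) Tm.idems_quotientE unfolding Tmon_def tau_eq_cls by metis
  note [simp] = F.idems_closed[OF a(1)] F.idems_closed[OF b(1)]
  have ab: "a \<odot> b \<in> EF" using a b F.idem_mult_idem by blast
  have th: "\<theta> a = \<theta> b" using assms a b by (simp add: psi_tau)
  have "(a, b) \<in> \<theta>\<^sub>m"
  proof (rule theta_minI[OF _ _ ab])
    show "a \<odot> (a \<odot> b) = b \<odot> (a \<odot> b)"
      using a b by (simp add: F.idem_left F.idem_left_comm[OF b(1) a(1)] F.idems_idem)
    show "\<theta> (F_sinv a \<odot> a) = \<theta> (a \<odot> b)"
      "\<theta> (a \<odot> b) = \<theta> (F_sinv b \<odot> b)"
      using a b th by (simp_all add: F.sinv_idem theta_mult)
  qed auto
  then show ?thesis using a b by (simp add: tau_eq_iff)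
qed

text \<open>Any preimage \<open>t\<close> of \<open>e\<close> supplies the idempotent
  \<open>t t^-1\<close> over \<open>e\<close>; \<open>psi_idem_inj\<close> makes it unique.\<close>

lemma lift_idem: "e \<in> EM \<Longrightarrow> lft e \<in> ET \<and> \<psi> (lft e) = e"
proof -
  assume e: "e \<in> EM"
  obtain t where t: "t \<in> TC" "\<psi> t = e" using psi_surj[OF M.idems_closed[OF e]] .
  have "\<psi> (t \<cdot> t\<star>) = e" using t e by (simp add: psi_mult psi_sinv M.sinv_idem M.idems_idem)
  then have "\<exists>!x. x \<in> ET \<and> \<psi> x = e"
    using t psi_idem_inj by (intro ex1I[of _ "t \<cdot> t\<star>"]) auto
  then show ?thesis unfolding lift_idem_def by (rule theI')
qed

lemma lift_psi: "e \<in> ET \<Longrightarrow> lft (\<psi> e) = e"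
  by (metis lift_idem psi_idem psi_idem_inj)

lemma lift_eqI: "\<lbrakk>x \<in> ET; \<psi> x = e\<rbrakk> \<Longrightarrow> lft e = x"
  by (metis lift_psi)

lemma wT_closed [simp]: "w \<in> words X \<Longrightarrow> w\<^sub>T w \<in> TC"
  by (simp add: wT_def rho_closed tau_closed)

lemma wT_append: "\<lbrakk>u \<in> words X; w \<in> words X\<rbrakk> \<Longrightarrow> w\<^sub>T (u @ w) = w\<^sub>T u \<cdot> w\<^sub>T w"
  by (simp add: wT_def rho_append tau_mult rho_closed)

lemma wT_Nil: "w\<^sub>T [] = \<one>\<^bsub>Tmon X R\<^esub>"
  by (simp add: wT_def rho_Nil tau_one)

lemma wT_word_inv: "w \<in> words X \<Longrightarrow> w\<^sub>T (word_inv w) = (w\<^sub>T w)\<star>"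
  by (simp add: wT_def tau_sinv rho_closed flip: sinv_rho)

lemma wT_surj: assumes "t \<in> TC" obtains w where "w \<in> words X" "w\<^sub>T w = t"
  using assms tau_surj rho_surj unfolding wT_def by metis

lemma psi_wT: "w \<in> words X \<Longrightarrow> \<psi> (w\<^sub>T w) = \<theta> (rho X w)"
  by (simp add: wT_def psi_tau rho_closed)

lemma R_wordsD: "(l, r) \<in> R \<Longrightarrow> l \<in> words X" "(l, r) \<in> R \<Longrightarrow> r \<in> words X"
  using R_words by auto

lemma psi_wT_rel: "(l, r) \<in> R \<Longrightarrow> \<psi> (w\<^sub>T l) = \<psi> (w\<^sub>T r)"
proof -
  assume "(l, r) \<in> R"
  then have "(rho X l, rho X r) \<in> theta_rel X R"
    unfolding theta_rel_def
    using F.congruence_generated_incl[OF rel_pairs_carrier] by auto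
  then show ?thesis
    using R_wordsD[OF \<open>(l, r) \<in> R\<close>] by (simp add: psi_wT theta_eq_cls Th.cls_eq_iff rho_closed)
qed

text \<open>The kernel congruence of \<open>psi\<close> is generated by the relations: the pullback
  of \<open>r\<close> to the free inverse monoid is a congruence containing the relation pairs,
  hence contains \<open>theta_rel\<close>. It is applied with \<open>r\<close> being reachability in
  the Squier complex.\<close>

lemma psi_eq_imp_congruent:
  assumes r: "congruence_on (Tmon X R) r" and lr: "\<And>l r'. (l, r') \<in> R \<Longrightarrow> (w\<^sub>T l, w\<^sub>T r') \<in> r"
    and t: "t \<in> TC" and u: "u \<in> TC" and eq: "\<psi> t = \<psi> u"
  shows "(t, u) \<in> r"
proof -
  let ?r = "{(a, b). a \<in> FC \<and> b \<in> FC \<and> (tau X R a, tau X R b) \<in> r}"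
  have e: "equiv TC r" using r by (rule congruence_on_equiv)
  have "congruence_on (fim X) ?r"
    unfolding congruence_on_def
  proof (intro conjI ballI)
    show "equiv (FC) ?r"
    proof (rule equivI)
      show "refl_on (FC) ?r"
        using e tau_closed by (auto simp: refl_on_def equiv_def)
      show "sym ?r" using e by (auto simp: sym_def equiv_def)
      show "trans ?r" using e unfolding trans_def equiv_def by blast
    qed auto
    fix p assume "p \<in> ?r"
    then show "case p of (a, b) \<Rightarrow> \<forall>c\<in>FC.
        (c \<odot> a, c \<odot> b) \<in> ?r \<and> (a \<odot> c, b \<odot> c) \<in> ?r"
      using r tau_closed by (auto simp: congruence_on_def tau_mult)
  qed
  moreover have "rel_pairs \<subseteq> ?r"
    using lr R_words by (auto simp: wT_def rho_closed)
  ultimately have sub: "theta_rel X R \<subseteq> ?r"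
    unfolding theta_rel_def by (rule congruence_generated_least)
  obtain a where a: "a \<in> FC" "t = tau X R a" using tau_surj[OF t] .
  obtain b where b: "b \<in> FC" "u = tau X R b" using tau_surj[OF u] .
  have "(a, b) \<in> theta_rel X R" using eq a b by (simp add: psi_tau theta_eq_cls Th.cls_eq_iff)
  then show ?thesis using sub a b by auto
qed

end

section \<open>Abelianisations\<close>

text \<open>A central extension that splits is the product of its kernel and the image of the
  section, and \<open>f\<close> is the projection to the kernel. Centrality makes \<open>f\<close> a
  homomorphism, its abelian target makes it trivial on the derived subgroup, and it fixes each
  element of the kernel.\<close>

lemma (in group_hom) kernel_derived_trivial:
  assumes \<sigma>: "\<sigma> \<in> hom H G" "\<And>k. k \<in> carrier H \<Longrightarrow> h (\<sigma> k) = k"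
    and central: "\<And>z g. \<lbrakk>z \<in> kernel G H h; g \<in> carrier G\<rbrakk> \<Longrightarrow> z \<otimes> g = g \<otimes> z"
    and z: "z \<in> kernel G H h" "z \<in> derived G (carrier G)"
  shows "z = \<one>"
proof -
  interpret S: group_hom H G \<sigma>
    by (unfold_locales) (rule \<sigma>)
  let ?Z = "G\<lparr>carrier := kernel G H h\<rparr>"
  have sub: "subgroup (kernel G H h) G" by (rule subgroup_kernel)
  interpret Z: comm_group ?Z
    by (rule group.group_comm_groupI[OF G.subgroup_imp_group[OF sub]])
      (simp add: central subgroup.mem_carrier[OF sub])
  define f where "f g = g \<otimes> inv (\<sigma> (h g))" for g
  have f: "f \<in> hom G ?Z"
  proof (rule homI)
    show fZ: "f g \<in> carrier ?Z" if "g \<in> carrier G" for g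
      using that \<sigma>(2) by (simp add: f_def kernel_def)
    fix a b assume a: "a \<in> carrier G" and b: "b \<in> carrier G"
    have "f (a \<otimes> b) = a \<otimes> f b \<otimes> inv (\<sigma> (h a))"
      using a b by (simp add: f_def G.m_assoc G.inv_mult_group)
    also have "\<dots> = f b \<otimes> a \<otimes> inv (\<sigma> (h a))" using fZ[OF b] central a by simp
    also have "\<dots> = f b \<otimes> f a" using a b by (simp add: f_def G.m_assoc)
    also have "\<dots> = f a \<otimes> f b" using fZ[OF a] fZ[OF b] Z.m_comm by simp
    finally show "f (a \<otimes> b) = f a \<otimes>\<^bsub>?Z\<^esub> f b" by simp
  qed
  interpret f: group_hom G ?Z f by (unfold_locales) (rule f)
  have "derived ?Z (f ` carrier G) = {\<one>}"
    using Z.derived_eq_singleton[of "f ` carrier G"] f.hom_closed by auto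
  then have "f z = \<one>" using f.derived_img[of "carrier G"] z(2) by auto
  then show ?thesis using z(1) by (simp add: f_def kernel_def)
qed

context group
begin

lemma ab_comm_group: "comm_group (abelianisation G)"
  unfolding abelianisation_def by (rule derived_quot_is_comm_group)

lemma ab_class_hom: "ab_class G \<in> hom G (abelianisation G)"
proof -
  have "ab_class G = (\<lambda>a. derived G (carrier G) #> a)" by (simp add: ab_class_def fun_eq_iff)
  then show ?thesis
    unfolding abelianisation_def using normal.r_coset_hom_Mod[OF derived_self_is_normal] by simp
qed

lemma ab_class_closed: "a \<in> carrier G \<Longrightarrow> ab_class G a \<in> carrier (abelianisation G)"
  using ab_class_hom by (rule hom_in_carrier)

lemma ab_class_mult: "\<lbrakk>a \<in> carrier G; b \<in> carrier G\<rbrakk>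
    \<Longrightarrow> ab_class G (a \<otimes> b) = ab_class G a \<otimes>\<^bsub>abelianisation G\<^esub> ab_class G b"
  using ab_class_hom by (rule hom_mult)

lemma ab_group_hom: "group_hom G (abelianisation G) (ab_class G)"
  using ab_comm_group ab_class_hom by (auto simp: group_hom_def group_hom_axioms_def comm_group_def)

lemma ab_class_one: "ab_class G \<one> = \<one>\<^bsub>abelianisation G\<^esub>"
  using group_hom.hom_one[OF ab_group_hom] .

lemma ab_class_inv: "a \<in> carrier G \<Longrightarrow> ab_class G (inv a) = inv\<^bsub>abelianisation G\<^esub> ab_class G a"
  using group_hom.hom_inv[OF ab_group_hom] .

lemma ab_carrierE:
  assumes "c \<in> carrier (abelianisation G)" obtains a where "a \<in> carrier G" "c = ab_class G a"
  using assms by (auto simp: abelianisation_def ab_class_def FactGroup_def RCOSETS_def)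

lemma ab_class_self: "a \<in> carrier G \<Longrightarrow> a \<in> ab_class G a"
  unfolding ab_class_def by (rule rcos_self[OF _ derived_is_subgroup]) auto

lemma ab_class_eqI: assumes "b \<in> ab_class G a" "a \<in> carrier G"
  shows "b \<in> carrier G" "ab_class G b = ab_class G a"
proof -
  have sub: "subgroup (derived G (carrier G)) G" by (rule derived_is_subgroup) auto
  show "b \<in> carrier G" using assms r_coset_subset_G subgroup.subset[OF sub]
    unfolding ab_class_def by blast
  show "ab_class G b = ab_class G a" using repr_independence[OF _ _ sub] assms
    unfolding ab_class_def by auto
qed

lemma ab_class_eq_one_iff:
  "a \<in> carrier G \<Longrightarrow> ab_class G a = \<one>\<^bsub>abelianisation G\<^esub> \<longleftrightarrow> a \<in> derived G (carrier G)"
proof -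
  assume a: "a \<in> carrier G"
  have sub: "subgroup (derived G (carrier G)) G" by (rule derived_is_subgroup) auto
  have "\<one>\<^bsub>abelianisation G\<^esub> = derived G (carrier G)" by (simp add: abelianisation_def FactGroup_def)
  then show ?thesis
    using a coset_join2[OF a sub] coset_join1[OF _ a sub] subgroup.subset[OF sub]
    by (auto simp: ab_class_def)
qed

text \<open>The equation says that \<open>c\<close> is a conjugate of \<open>a\<close>. It is kept
  free of inverses because the Peiffer identity delivers conjugacy in exactly this form.\<close>

lemma ab_class_conj:
  assumes "a \<in> carrier G" "b \<in> carrier G" "c \<in> carrier G" "a \<otimes> b = b \<otimes> c"
  shows "ab_class G c = ab_class G a"
proof -
  interpret A: comm_group "abelianisation G" by (rule ab_comm_group)
  have "ab_class G a \<otimes>\<^bsub>abelianisation G\<^esub> ab_class G b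
      = ab_class G c \<otimes>\<^bsub>abelianisation G\<^esub> ab_class G b"
    using assms ab_class_mult A.m_comm ab_class_closed by metis
  then show ?thesis using assms ab_class_closed A.right_cancel by auto
qed

end

lemma (in group_hom) hom_comm_group_derived:
  assumes "comm_group H" "a \<in> derived G (carrier G)"
  shows "h a = \<one>\<^bsub>H\<^esub>"
proof -
  have "derived H (h ` carrier G) = {\<one>\<^bsub>H\<^esub>}"
    using comm_group.derived_eq_singleton[OF assms(1)] hom_closed by blast
  then show ?thesis using derived_img[of "carrier G"] assms(2) by auto
qed

text \<open>Elements of one class differ by an element of the derived subgroup, which a map to an
  abelian group kills. This gives well-definedness of functions on classes.\<close>

lemma (in group_hom) hom_comm_group_ab_class:
  assumes "comm_group H" "a \<in> carrier G" "b \<in> carrier G" "ab_class G a = ab_class G b"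
  shows "h a = h b"
proof -
  interpret A: comm_group "abelianisation G" by (rule G.ab_comm_group)
  have "ab_class G (a \<otimes> inv b) = \<one>\<^bsub>abelianisation G\<^esub>"
    using assms G.ab_class_closed by (simp add: G.ab_class_mult G.ab_class_inv)
  then have "h (a \<otimes> inv b) = \<one>\<^bsub>H\<^esub>"
    using assms by (intro hom_comm_group_derived) (auto simp flip: G.ab_class_eq_one_iff)
  then show ?thesis using assms by (simp add: H.inv_solve_right')
qed

lemma (in group_hom) ab_class_cong:
  assumes "a \<in> carrier G" "b \<in> carrier G" "ab_class G a = ab_class G b"
  shows "ab_class H (h a) = ab_class H (h b)"
proof -
  interpret c: group_hom G "abelianisation H" "ab_class H \<circ> h"
    using Group.hom_compose[OF homh H.ab_class_hom] H.ab_comm_group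
    by (simp add: group_hom_def group_hom_axioms_def comm_group_def)
  show ?thesis using c.hom_comm_group_ab_class[OF H.ab_comm_group assms] by (simp only: o_apply)
qed


section \<open>Lausch modules from functorial actions\<close>

text \<open>Structure maps and action of a Lausch module are values of one family:
  \<open>C e m\<close> goes from the component at \<open>e\<close> to the one at
  \<open>m^-1 e m\<close>, and restriction to \<open>f\<close> below \<open>e\<close> is
  \<open>C e f\<close>. The module axioms thus reduce to functoriality, which is easier to check for
  the three modules than the axioms on the disjoint union.\<close>

locale lausch_action = inverse_monoid M
  for M :: "('m, 'k) monoid_scheme" (structure) and A :: "('m, 'a) lmodule" +
  fixes C :: "'m \<Rightarrow> 'm \<Rightarrow> 'a \<Rightarrow> 'a"
  assumes comp_comm: "e \<in> idems M \<Longrightarrow> comm_group (lcomp A e)"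
    and C_hom: "\<lbrakk>e \<in> idems M; m \<in> carrier M\<rbrakk>
      \<Longrightarrow> C e m \<in> hom (lcomp A e) (lcomp A (sinv M m \<otimes> e \<otimes> m))"
    and C_id: "\<lbrakk>e \<in> idems M; a \<in> carrier (lcomp A e)\<rbrakk> \<Longrightarrow> C e e a = a"
    and C_mult: "\<lbrakk>e \<in> idems M; m \<in> carrier M; n \<in> carrier M; a \<in> carrier (lcomp A e)\<rbrakk>
      \<Longrightarrow> C e (m \<otimes> n) a = C (sinv M m \<otimes> e \<otimes> m) n (C e m a)"
    and res_eq: "\<lbrakk>e \<in> idems M; f \<in> idems M; f \<otimes> e = f; a \<in> carrier (lcomp A e)\<rbrakk>
      \<Longrightarrow> lres A e f a = C e f a"
    and act_eq: "\<lbrakk>e \<in> idems M; a \<in> carrier (lcomp A e); m \<in> carrier M\<rbrakk>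
      \<Longrightarrow> lact A (e, a) m = (sinv M m \<otimes> e \<otimes> m, C e m a)"
begin

lemma conj_le: "\<lbrakk>e \<in> idems M; f \<in> idems M; f \<otimes> e = f\<rbrakk> \<Longrightarrow> sinv M f \<otimes> e \<otimes> f = f"
  using idem_comm by (simp add: sinv_idem idems_idem)

lemma C_closed: "\<lbrakk>e \<in> idems M; m \<in> carrier M; a \<in> carrier (lcomp A e)\<rbrakk>
    \<Longrightarrow> C e m a \<in> carrier (lcomp A (sinv M m \<otimes> e \<otimes> m))"
  using hom_in_carrier[OF C_hom] by blast

lemma C_group_hom: "\<lbrakk>e \<in> idems M; m \<in> carrier M\<rbrakk>
    \<Longrightarrow> group_hom (lcomp A e) (lcomp A (sinv M m \<otimes> e \<otimes> m)) (C e m)"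
  using C_hom comp_comm conj_idem by (simp add: group_hom_def group_hom_axioms_def comm_group_def)

lemma is_lausch_module: "lausch_module M A"
proof (intro lausch_module.intro lausch_module_axioms.intro inverse_monoid_axioms)
  fix e f a assume e: "e \<in> idems M" and f: "f \<in> idems M" and fe: "natural_le M f e"
  have fe': "f \<otimes> e = f" using e f fe by (simp add: natural_le_idem_iff)
  show "lres A e f \<in> hom (lcomp A e) (lcomp A f)"
  proof (rule group.hom_restrict[where h = "C e f"])
    show "group (lcomp A e)" using comp_comm[OF e] by (rule comm_group.axioms(2))
    show "C e f \<in> hom (lcomp A e) (lcomp A f)"
      using C_hom[OF e idems_closed[OF f]] conj_le[OF e f fe'] by simp
    show "C e f a = lres A e f a" if "a \<in> carrier (lcomp A e)" for a using that
      by (simp add: res_eq[OF e f fe'])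
  qed
next
  fix e assume e: "e \<in> idems M"
  show "comm_group (lcomp A e)" using e by (rule comp_comm)
  fix a assume "a \<in> carrier (lcomp A e)"
  then show "lres A e e a = a" using e by (simp add: res_eq C_id idems_idem)
next
  fix e f g a assume *: "e \<in> idems M" "f \<in> idems M" "g \<in> idems M" "natural_le M f e" "natural_le M g f"
    and a: "a \<in> carrier (lcomp A e)"
  have fe: "f \<otimes> e = f" and gf: "g \<otimes> f = g" using * by (simp_all add: natural_le_idem_iff)
  have ge: "g \<otimes> e = g" using fe gf * idems_closed m_assoc by metis
  have "C e f a \<in> carrier (lcomp A f)"
    using C_closed[OF *(1) idems_closed[OF *(2)] a] conj_le[OF *(1,2) fe] by simp
  then show "lres A f g (lres A e f a) = lres A e g a"
    using C_mult[OF *(1) idems_closed[OF *(2)] idems_closed[OF *(3)] a] conj_le[OF *(1,2) fe]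
      idem_comm[OF *(2,3)]
    by (simp add: res_eq fe gf ge * a)
next
  fix x y s assume x: "x \<in> ltotal M A" and y: "y \<in> ltotal M A" and s [simp]: "s \<in> carrier M"
  obtain e a where x': "x = (e, a)" and e: "e \<in> idems M" and a: "a \<in> carrier (lcomp A e)"
    using x by (auto simp: ltotal_def)
  obtain f b where y': "y = (f, b)" and f: "f \<in> idems M" and b: "b \<in> carrier (lcomp A f)"
    using y by (auto simp: ltotal_def)
  note [simp] = idems_closed[OF e] idems_closed[OF f]
  show "lact A x s \<in> ltotal M A"
    using e a conj_idem C_closed by (simp add: x' act_eq ltotal_def)
  let ?g = "e \<otimes> f" and ?h = "sinv M s \<otimes> (e \<otimes> f) \<otimes> s"
  have g: "?g \<in> idems M" using e f idem_mult_idem by blast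
  have hi: "?h \<in> idems M" using conj_idem[OF g] by simp
  have ge: "?g \<otimes> e = ?g" and gf: "?g \<otimes> f = ?g"
    using idem_comm[OF e f] e f by (simp_all add: m_assoc idem_left idems_idem)
  have h: "(sinv M s \<otimes> e \<otimes> s) \<otimes> (sinv M s \<otimes> f \<otimes> s) = ?h"
    using idem_mult_shift[OF f s] by (simp add: m_assoc)
  have sh: "s \<otimes> ?h = ?g \<otimes> s" using idem_mult_shift[OF g s] by (simp add: m_assoc)
  have le: "?h \<otimes> (sinv M s \<otimes> k \<otimes> s) = ?h"
    if k: "k \<in> idems M" and gk: "?g \<otimes> k = ?g" for k
  proof -
    note [simp] = idems_closed[OF k]
    have "?h \<otimes> (sinv M s \<otimes> k \<otimes> s) = sinv M s \<otimes> ?g \<otimes> (s \<otimes> (sinv M s \<otimes> k \<otimes> s))"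
      by (simp add: m_assoc)
    also have "\<dots> = sinv M s \<otimes> (?g \<otimes> k) \<otimes> s"
      unfolding idem_mult_shift[OF k s, symmetric] by (simp add: m_assoc)
    finally show ?thesis using gk by simp
  qed
  \<comment> \<open>Restricting after acting equals acting after restricting: both sides are the
    action of \<open>s ?h = ?g s\<close>. This is the core of additivity across different
    components.\<close>
  have move: "C (sinv M s \<otimes> k \<otimes> s) ?h (C k s c) = C ?g s (C k ?g c)"
    if k: "k \<in> idems M" and gk: "?g \<otimes> k = ?g" and c: "c \<in> carrier (lcomp A k)" for k c
    using C_mult[OF k s idems_closed[OF hi] c] C_mult[OF k idems_closed[OF g] s c] sh
      conj_le[OF k g gk] by simp
  have Cg: "C k ?g c \<in> carrier (lcomp A ?g)"
    if "k \<in> idems M" "?g \<otimes> k = ?g" "c \<in> carrier (lcomp A k)" for k c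
    using C_closed[of k ?g c] that conj_le[of k ?g] g by simp
  have hm: "C ?g s (c \<otimes>\<^bsub>lcomp A ?g\<^esub> d) = C ?g s c \<otimes>\<^bsub>lcomp A ?h\<^esub> C ?g s d"
    if "c \<in> carrier (lcomp A ?g)" "d \<in> carrier (lcomp A ?g)" for c d
    using hom_mult[OF C_hom[OF g s] that] .
  have mult_closed: "c \<otimes>\<^bsub>lcomp A ?g\<^esub> d \<in> carrier (lcomp A ?g)"
    if "c \<in> carrier (lcomp A ?g)" "d \<in> carrier (lcomp A ?g)" for c d
    using comp_comm[OF g] that by (simp add: comm_group_def comm_monoid_def monoid.m_closed)
  show "lact A (loplus M A x y) s = loplus M A (lact A x s) (lact A y s)"
    using e f a b g hi ge gf
    by (simp add: x' y' act_eq res_eq Cg mult_closed hm conj_idem C_closed h le move)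
next
  fix x s t assume "x \<in> ltotal M A" and s: "s \<in> carrier M" "t \<in> carrier M"
  then obtain e a where x': "x = (e, a)" and e: "e \<in> idems M" and a: "a \<in> carrier (lcomp A e)"
    by (auto simp: ltotal_def)
  have "sinv M (s \<otimes> t) \<otimes> e \<otimes> (s \<otimes> t)
      = sinv M t \<otimes> (sinv M s \<otimes> e \<otimes> s) \<otimes> t"
    using s idems_closed[OF e] by (simp add: sinv_mult m_assoc)
  then show "lact A x (s \<otimes> t) = lact A (lact A x s) t"
    using s e a by (simp add: x' act_eq C_closed conj_idem C_mult)
next
  fix x f assume "x \<in> ltotal M A" and f: "f \<in> idems M"
  then obtain e a where x': "x = (e, a)" and e: "e \<in> idems M" and a: "a \<in> carrier (lcomp A e)"
    by (auto simp: ltotal_def)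
  note [simp] = idems_closed[OF e] idems_closed[OF f]
  let ?g = "e \<otimes> f"
  have g: "?g \<in> idems M" using e f idem_mult_idem by blast
  have ge: "?g \<otimes> e = ?g" and gf: "?g \<otimes> f = ?g"
    using idem_comm[OF e f] e f by (simp_all add: m_assoc idem_left idems_idem)
  have fef: "sinv M f \<otimes> e \<otimes> f = ?g"
    using idem_comm[OF e f] e f by (simp add: sinv_idem m_assoc idem_left)
  \<comment> \<open>Acting by \<open>e\<close> first changes nothing in the component at
    \<open>e\<close>, so \<open>f\<close> acts there as the restriction to
    \<open>e f\<close>.\<close>
  have "C e ?g a = C e f a" using C_mult[OF e _ _ a, of e f] C_id[OF e a] e
    by (simp add: sinv_idem idems_idem)
  moreover have "C f ?g \<one>\<^bsub>lcomp A f\<^esub> = \<one>\<^bsub>lcomp A ?g\<^esub>"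
    using group_hom.hom_one[OF C_group_hom[OF f idems_closed[OF g]]] conj_le[OF f g gf] by simp
  moreover have "C e f a \<in> carrier (lcomp A ?g)" using C_closed[OF e _ a, of f] fef by simp
  moreover have "\<one>\<^bsub>lcomp A f\<^esub> \<in> carrier (lcomp A f)"
    using comp_comm[OF f] by (simp add: comm_group_def comm_monoid_def monoid.one_closed)
  moreover have "c \<otimes>\<^bsub>lcomp A ?g\<^esub> \<one>\<^bsub>lcomp A ?g\<^esub> = c" if "c \<in> carrier (lcomp A ?g)" for c
    using comp_comm[OF g] that by (simp add: comm_group_def comm_monoid_def monoid.r_one)
  ultimately show "lact A x f = loplus M A x (lzero A f)"
    using e f a g ge gf by (simp add: x' lzero_def act_eq res_eq fef)
next
  fix e s assume e: "e \<in> idems M" and s: "s \<in> carrier M"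
  have "\<one>\<^bsub>lcomp A e\<^esub> \<in> carrier (lcomp A e)"
    using comp_comm[OF e] by (simp add: comm_group_def comm_monoid_def monoid.one_closed)
  then show "lact A (lzero A e) s = lzero A (sinv M s \<otimes> e \<otimes> s)"
    using group_hom.hom_one[OF C_group_hom[OF e s]] e s by (simp add: lzero_def act_eq)
qed

end

text \<open>The one equation \<open>h_C\<close> contains both requirements: for \<open>m\<close> an
  idempotent below \<open>e\<close> it is compatibility with the structure maps, in general it is
  equivariance.\<close>

lemma lausch_homI:
  assumes "lausch_action M A C" "lausch_action M B D"
    and h: "\<And>e. e \<in> idems M \<Longrightarrow> h e \<in> hom (lcomp A e) (lcomp B e)"
    and h_C: "\<And>e m a. \<lbrakk>e \<in> idems M; m \<in> carrier M; a \<in> carrier (lcomp A e)\<rbrakk>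
      \<Longrightarrow> h (sinv M m \<otimes>\<^bsub>M\<^esub> e \<otimes>\<^bsub>M\<^esub> m) (C e m a) = D e m (h e a)"
  shows "lausch_hom M A B h"
proof -
  interpret A: lausch_action M A C by fact
  interpret B: lausch_action M B D by fact
  have hc: "h e a \<in> carrier (lcomp B e)" if "e \<in> idems M" "a \<in> carrier (lcomp A e)" for e a
    using hom_in_carrier[OF h] that by blast
  show ?thesis unfolding lausch_hom_def
  proof (intro conjI ballI impI)
    fix e f a assume e: "e \<in> idems M" and f: "f \<in> idems M" and "natural_le M f e"
      and a: "a \<in> carrier (lcomp A e)"
    then have fe: "f \<otimes>\<^bsub>M\<^esub> e = f" by (simp add: A.natural_le_idem_iff)
    show "h f (lres A e f a) = lres B e f (h e a)"
      using h_C[OF e A.idems_closed[OF f] a] e f a fe by (simp add: A.res_eq B.res_eq hc A.conj_le)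
  next
    fix x assume "x \<in> ltotal M A"
    then show "case x of (e, a) \<Rightarrow> \<forall>s\<in>carrier M.
        lact B (e, h e a) s = (case lact A (e, a) s of (f, b) \<Rightarrow> (f, h f b))"
      by (auto simp: ltotal_def A.act_eq B.act_eq hc h_C)
  qed (rule h)
qed

section \<open>The kernel of the idempotent separating map\<close>

context presentation
begin

text \<open>It suffices that \<open>f\<close> absorbs into the domain idempotent
  \<open>t^-1 t\<close>. That is an equation between idempotents, so it may be tested in
  \<open>M\<close>.\<close>

lemma mult_idem_right:
  assumes t: "t \<in> TC" and f: "f \<in> ET" and eq: "\<psi> t \<bullet> \<psi> f = \<psi> t"
  shows "t \<cdot> f = t"
proof -
  note [simp] = t T.idems_closed[OF f]
  have "t\<star> \<cdot> t \<cdot> f = t\<star> \<cdot> t"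
  proof (rule psi_idem_inj)
    show "t\<star> \<cdot> t \<cdot> f \<in> ET" using f by (rule T.idem_mult_idem[rotated]) simp
    show "\<psi> (t\<star> \<cdot> t \<cdot> f) = \<psi> (t\<star> \<cdot> t)" by (simp add: psi_mult psi_sinv M.m_assoc eq)
  qed simp
  then have "t \<cdot> (t\<star> \<cdot> t \<cdot> f) = t" by (simp add: T.inv_simps)
  then show ?thesis by (simp add: T.inv_simps)
qed

lemma mult_idem_left:
  assumes t: "t \<in> TC" and f: "f \<in> ET" and eq: "\<psi> f \<bullet> \<psi> t = \<psi> t"
  shows "f \<cdot> t = t"
proof -
  note [simp] = t T.idems_closed[OF f]
  have "f \<cdot> (t \<cdot> t\<star>) = t \<cdot> t\<star>"
  proof (rule psi_idem_inj)
    show "f \<cdot> (t \<cdot> t\<star>) \<in> ET" using f by (rule T.idem_mult_idem) simp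
    show "\<psi> (f \<cdot> (t \<cdot> t\<star>)) = \<psi> (t \<cdot> t\<star>)"
      using eq by (simp add: psi_mult psi_sinv M.m_assoc[symmetric])
  qed simp
  then show ?thesis by (rule T.range_le_imp_left_id[rotated 2]) simp_all
qed

lemma psi_eq_imp_range_eq:
  assumes "t \<in> TC" "u \<in> TC" "\<psi> t = \<psi> u"
  shows "t \<cdot> t\<star> = u \<cdot> u\<star>" "t\<star> \<cdot> t = u\<star> \<cdot> u"
  using assms by (rule_tac psi_idem_inj; simp add: psi_mult psi_sinv)+

context
  fixes k
  assumes k [simp]: "k \<in> TC" and psi_k: "\<psi> k \<in> EM"
begin

lemma kernel_range: "k \<cdot> k\<star> = lft (\<psi> k)"
  and kernel_domain: "k\<star> \<cdot> k = lft (\<psi> k)"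
  using psi_k by (auto intro!: lift_eqI[symmetric] simp: psi_mult psi_sinv M.sinv_idem M.idems_idem)

lemma kernel_left: "lft (\<psi> k) \<cdot> k = k"
  using T.mult_sinv_mult[OF k] by (simp only: kernel_range)

lemma kernel_right: "k \<cdot> lft (\<psi> k) = k"
  using T.mult_sinv_right[OF k] by (simp only: kernel_domain)

text \<open>The image of \<open>k\<close> is idempotent and commutes with that of \<open>f\<close>,
  so \<open>k^-1 f k\<close> and \<open>(k^-1 k) f\<close> are idempotents with the same image.
  Hence the kernel is a semilattice of groups, and conjugation by any \<open>t\<close> is
  multiplicative on each \<open>K_e\<close>: the inner factor \<open>t t^-1\<close> can be moved
  away.\<close>

lemma kernel_comm_idem:
  assumes f: "f \<in> ET"
  shows "k \<cdot> f = f \<cdot> k"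
proof -
  note [simp] = T.idems_closed[OF f]
  have e: "lft (\<psi> k) \<in> ET" using lift_idem psi_k by blast
  note [simp] = T.idems_closed[OF e]
  have "k\<star> \<cdot> f \<cdot> k = lft (\<psi> k) \<cdot> f"
  proof (rule psi_idem_inj)
    show "k\<star> \<cdot> f \<cdot> k \<in> ET" "lft (\<psi> k) \<cdot> f \<in> ET"
      using f e T.conj_idem T.idem_mult_idem by auto
    show "\<psi> (k\<star> \<cdot> f \<cdot> k) = \<psi> (lft (\<psi> k) \<cdot> f)"
      using psi_k psi_idem[OF f] lift_idem[OF psi_k] M.idem_comm[OF psi_k psi_idem[OF f]]
      by (simp add: psi_mult psi_sinv M.sinv_idem M.m_assoc M.idems_idem M.idem_left)
  qed
  then have "f \<cdot> k = k \<cdot> (lft (\<psi> k) \<cdot> f)" using T.idem_mult_shift[OF f k] by simp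
  then show ?thesis using kernel_right by (simp flip: T.m_assoc)
qed

end

lemma lift_closed [simp]: "e \<in> EM \<Longrightarrow> lft e \<in> TC"
  using lift_idem T.idems_closed by blast

lemma lift_ET [simp]: "e \<in> EM \<Longrightarrow> lft e \<in> ET"
  and psi_lift [simp]: "e \<in> EM \<Longrightarrow> \<psi> (lft e) = e"
  using lift_idem by blast+

lemma K_group_group:
  assumes e: "e \<in> EM"
  shows "group (K_group X R e)"
proof (rule groupI)
  show "\<exists>y\<in>carrier (K_group X R e). y \<otimes>\<^bsub>K_group X R e\<^esub> x = \<one>\<^bsub>K_group X R e\<^esub>"
    if "x \<in> carrier (K_group X R e)" for x
  proof -
    have x: "x \<in> TC" "\<psi> x = e" using that by (auto simp: K_group_def)
    then have "x\<star> \<cdot> x = lft e" using kernel_domain[of x] e by simp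
    then show ?thesis using x e by (intro bexI[of _ "x\<star>"]) (simp_all add: K_group_def psi_sinv M.sinv_idem)
  qed
  show "\<one>\<^bsub>K_group X R e\<^esub> \<otimes>\<^bsub>K_group X R e\<^esub> x = x" if "x \<in> carrier (K_group X R e)" for x
    using that e kernel_left[of x] by (auto simp: K_group_def)
qed (use e in \<open>auto simp: K_group_def psi_mult M.idems_idem T.m_assoc\<close>)

lemma K_carrier: "k \<in> carrier (K_group X R e) \<longleftrightarrow> k \<in> TC \<and> \<psi> k = e"
  and K_mult: "k \<otimes>\<^bsub>K_group X R e\<^esub> k' = k \<cdot> k'"
  and K_one: "\<one>\<^bsub>K_group X R e\<^esub> = lft e"
  by (auto simp: K_group_def)

lemma wT_Cons: "a # w \<in> words X \<Longrightarrow> w\<^sub>T (a # w) = w\<^sub>T [a] \<cdot> w\<^sub>T w"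
  using wT_append[of "[a]" w] by simp

lemma wT_Inr: "x \<in> X \<Longrightarrow> w\<^sub>T [Inr x] = (w\<^sub>T [Inl x])\<star>"
  using wT_word_inv[of "[Inl x]"] by (simp add: word_inv_Cons)

end


section \<open>Projectivity of the groups \<open>K_e\<close>\<close>

text \<open>
  Nielsen--Schreier in disguise.  The \<open>\<R>\<close>-class of \<open>e\<close> in \<open>M\<close> plays the role of a coset space
  with transversal \<open>tr\<close>, and \<open>s m x\<close> lifts the Schreier generator \<open>tr m \<cdot> x \<cdot> (tr (m x))\<star>\<close> to \<open>S\<close>.
  Words act on pairs of an element of \<open>S\<close> and a coset by partial bijections.  These form an inverse
  monoid, so the action factors through the free inverse monoid.
\<close>

locale schreier_lifting = presentation X R + S: group S
  for X :: "'x set" and R and S (structure) +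
  fixes e and r :: "'b \<Rightarrow> 'x word set set" and tr :: "'x word set set \<Rightarrow> 'x word set set"
    and s :: "'x word set set \<Rightarrow> 'x \<Rightarrow> 'b"
  assumes e: "e \<in> EM" and r_hom: "r \<in> hom S (K_group X R e)"
    and tr: "\<And>m. m \<in> MC \<Longrightarrow> tr m \<in> TC" "\<And>m. m \<in> MC \<Longrightarrow> \<psi> (tr m) = m" and tr_e: "tr e = lft e"
    and s_closed: "\<And>m x. \<lbrakk>m \<in> MC; x \<in> X\<rbrakk> \<Longrightarrow> s m x \<in> carrier S"
    and r_s: "\<And>m x. \<lbrakk>m \<in> MC; m \<bullet> m\<diamond> = e; x \<in> X; m' = m \<bullet> \<psi> (w\<^sub>T [Inl x]); m' \<bullet> m'\<diamond> = e\<rbrakk>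
      \<Longrightarrow> r (s m x) = tr m \<cdot> w\<^sub>T [Inl x] \<cdot> (tr m')\<star>"
begin

definition Re where "Re = {m \<in> MC. m \<bullet> m\<diamond> = e}"

abbreviation gx where "gx x \<equiv> \<psi> (w\<^sub>T [Inl x])"

text \<open>The edges labelled \<open>x\<close> of the Schreier graph on the R-class, lifted to a
  covering with fibre \<open>S\<close> by right multiplication with the label
  \<open>s m x\<close>.\<close>

definition step where
  "step x = {((g, m), (g \<otimes> s m x, m \<bullet> gx x)) | g m. g \<in> carrier S \<and> m \<in> Re \<and> m \<bullet> gx x \<in> Re}"

fun letter_rel where
  "letter_rel (Inl x) = step x"
| "letter_rel (Inr x) = (step x)\<inverse>"

fun word_rel where
  "word_rel [] = Id_on (carrier S \<times> Re)"
| "word_rel (a # w) = letter_rel a O word_rel w"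

lemma r_closed: "g \<in> carrier S \<Longrightarrow> r g \<in> TC" "g \<in> carrier S \<Longrightarrow> \<psi> (r g) = e"
  using hom_in_carrier[OF r_hom] by (auto simp: K_carrier)

lemma r_mult: "\<lbrakk>g \<in> carrier S; h \<in> carrier S\<rbrakk> \<Longrightarrow> r (g \<otimes> h) = r g \<cdot> r h"
  using hom_mult[OF r_hom] by (simp add: K_mult)

lemma Re_closed [simp]: "m \<in> Re \<Longrightarrow> m \<in> MC"
  by (simp add: Re_def)

lemma Re_range: "m \<in> Re \<Longrightarrow> m \<bullet> m\<diamond> = e"
  by (simp add: Re_def del: Re_closed)

lemma gx_closed [simp]: "x \<in> X \<Longrightarrow> gx x \<in> MC"
  by simp

text \<open>Range idempotents decrease under right multiplication. Those of \<open>m\<close> and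
  \<open>m a b\<close> are both \<open>e\<close>, so the one between them is \<open>e\<close> as
  well.\<close>

lemma Re_prefix:
  assumes m: "m \<in> Re" and a [simp]: "a \<in> MC" and b [simp]: "b \<in> MC" and mab: "m \<bullet> a \<bullet> b \<in> Re"
  shows "m \<bullet> a \<in> Re"
proof -
  note [simp] = Re_closed[OF m]
  let ?i = "(m \<bullet> a) \<bullet> (m \<bullet> a)\<diamond>"
  have "p \<bullet> p\<diamond> \<bullet> ((p \<bullet> b) \<bullet> (p \<bullet> b)\<diamond>) = (p \<bullet> b) \<bullet> (p \<bullet> b)\<diamond>" if "p \<in> MC" for p
    using that by (simp add: M.sinv_mult M.inv_simps)
  from this[of "m \<bullet> a"]
  have "?i \<bullet> ((m \<bullet> a \<bullet> b) \<bullet> (m \<bullet> a \<bullet> b)\<diamond>) = (m \<bullet> a \<bullet> b) \<bullet> (m \<bullet> a \<bullet> b)\<diamond>"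
    by simp
  then have 1: "e = ?i \<bullet> e" by (simp only: Re_range[OF mab])
  have "m \<bullet> m\<diamond> \<bullet> ?i = ?i" by (simp add: M.sinv_mult M.inv_simps)
  then have "e \<bullet> ?i = ?i" using Re_range[OF m] by simp
  then have "?i = e" using 1 M.idem_comm[OF e, of ?i] by simp
  then show ?thesis by (simp add: Re_def del: Re_closed)
qed

text \<open>An instance of Green's lemma: within an R-class, right multiplication by
  \<open>a\<close> is undone by \<open>a^-1\<close>. It makes the generators act
  injectively.\<close>

lemma Re_right_cancel:
  assumes m: "m \<in> Re" and a [simp]: "a \<in> MC" and ma: "m \<bullet> a \<in> Re"
  shows "m \<bullet> a \<bullet> a\<diamond> = m"
proof -
  note [simp] = Re_closed[OF m]
  have i: "a \<bullet> a\<diamond> \<in> EM" "m\<diamond> \<bullet> m \<in> EM" by simp_all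
  have "m \<bullet> a \<bullet> a\<diamond> = m \<bullet> ((m\<diamond> \<bullet> m) \<bullet> (a \<bullet> a\<diamond>))" by (simp add: M.inv_simps)
  also have "\<dots> = (m \<bullet> a) \<bullet> (m \<bullet> a)\<diamond> \<bullet> m"
    unfolding M.idem_comm[OF i(2,1)] by (simp add: M.sinv_mult M.m_assoc)
  also have "\<dots> = m \<bullet> m\<diamond> \<bullet> m" using Re_range[OF ma] Re_range[OF m] by simp
  finally show ?thesis by (simp add: M.inv_simps)
qed

section \<open>Words as partial bijections\<close>

lemma step_subset: "x \<in> X \<Longrightarrow> step x \<subseteq> (carrier S \<times> Re) \<times> (carrier S \<times> Re)"
  by (auto simp: step_def s_closed)

lemma letter_rel_subset: "a \<in> X <+> X \<Longrightarrow> letter_rel a \<subseteq> (carrier S \<times> Re) \<times> (carrier S \<times> Re)"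
  using step_subset by fastforce

lemma word_rel_subset: "w \<in> words X \<Longrightarrow> word_rel w \<subseteq> (carrier S \<times> Re) \<times> (carrier S \<times> Re)"
  by (induction w) (use letter_rel_subset in fastforce)+

lemma word_rel_append: "\<lbrakk>u \<in> words X; w \<in> words X\<rbrakk> \<Longrightarrow> word_rel (u @ w) = word_rel u O word_rel w"
  by (induction u) (use word_rel_subset in \<open>auto simp: O_assoc\<close>)

lemma letter_rel_inv: "letter_rel (case_sum Inr Inl a) = (letter_rel a)\<inverse>"
  by (cases a) auto

lemma word_rel_inv: "w \<in> words X \<Longrightarrow> word_rel (word_inv w) = (word_rel w)\<inverse>"
proof (induction w)
  case (Cons a w)
  have a: "case_sum Inr Inl a \<in> X <+> X" using Cons.prems by auto
  have "letter_rel (case_sum Inr Inl a) O Id_on (carrier S \<times> Re) = letter_rel (case_sum Inr Inl a)"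
    using letter_rel_subset[OF a] by auto
  then show ?case
    using Cons a by (simp add: word_inv_Cons word_rel_append letter_rel_inv converse_relcomp)
qed (simp add: word_inv_def)

lemma step_single_valued: "x \<in> X \<Longrightarrow> single_valued (step x)"
  by (auto simp: step_def single_valued_def)

lemma step_inv_single_valued:
  assumes x: "x \<in> X"
  shows "single_valued ((step x)\<inverse>)"
proof (rule single_valuedI)
  fix p q q' assume "(p, q) \<in> (step x)\<inverse>" "(p, q') \<in> (step x)\<inverse>"
  then obtain g m g' m' where q: "q = (g, m)" "g \<in> carrier S" "m \<in> Re" "m \<bullet> gx x \<in> Re"
      and q': "q' = (g', m')" "g' \<in> carrier S" "m' \<in> Re" "m' \<bullet> gx x \<in> Re"
      and eq: "g \<otimes> s m x = g' \<otimes> s m' x" "m \<bullet> gx x = m' \<bullet> gx x"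
    by (auto simp: step_def)
  have "m = m'" using Re_right_cancel[of m "gx x"] Re_right_cancel[of m' "gx x"] q q' eq(2) x
    by (metis gx_closed)
  then show "q = q'" using q q' eq x by (simp add: s_closed)
qed

lemma word_rel_single_valued: "w \<in> words X \<Longrightarrow> single_valued (word_rel w)"
proof (induction w)
  case (Cons a w)
  have "single_valued (letter_rel a)"
    using Cons.prems step_single_valued step_inv_single_valued by (cases a) auto
  then show ?case using Cons by (simp add: single_valued_relcomp)
qed (simp add: single_valued_Id_on)

text \<open>The converse of a word relation is again a word relation, hence single valued. So
  \<open>w\<close> acts injectively, and following it by its converse gives a partial identity.
  Commutation of partial identities is the second kind of Vagner pair.\<close>

lemma word_rel_range:
  assumes "w \<in> words X"
  shows "word_rel (w @ word_inv w) = Id_on (Domain (word_rel w))"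
proof -
  have "single_valued ((word_rel w)\<inverse>)"
    using word_rel_single_valued[of "word_inv w"] assms by (simp add: word_rel_inv)
  moreover have "P O P\<inverse> = Id_on (Domain P)" if "single_valued (P\<inverse>)" for P :: "('p \<times> 'q) set"
    using that by (auto simp: single_valued_def)
  ultimately show ?thesis using assms by (simp add: word_rel_append word_rel_inv)
qed

lemma word_rel_vagner:
  assumes "(u, w) \<in> vagner X"
  shows "word_rel u = word_rel w"
proof -
  let ?r = "{(u, w). u \<in> words X \<and> w \<in> words X \<and> word_rel u = word_rel w}"
  have "vagner X \<subseteq> ?r"
  proof (rule vagner_least)
    show "equiv (words X) ?r"
      by (rule equivI) (auto simp: refl_on_def sym_def trans_def)
    show "(c @ a, c @ b) \<in> ?r \<and> (a @ c, b @ c) \<in> ?r" if "(a, b) \<in> ?r" "c \<in> words X" for a b c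
      using that by (auto simp: word_rel_append)
    show "(w, w @ word_inv w @ w) \<in> ?r" if "w \<in> words X" for w
    proof -
      have "word_rel (w @ word_inv w @ w) = Id_on (Domain (word_rel w)) O word_rel w"
        using that word_rel_append[of "w @ word_inv w" w] word_rel_range[of w] by simp
      then show ?thesis using that by auto
    qed
    show "(u @ word_inv u @ w @ word_inv w, w @ word_inv w @ u @ word_inv u) \<in> ?r"
      if "u \<in> words X" "w \<in> words X" for u w
      using that word_rel_append[of "u @ word_inv u" "w @ word_inv w"]
        word_rel_append[of "w @ word_inv w" "u @ word_inv u"] by (auto simp: word_rel_range)
  qed
  then show ?thesis using assms by auto
qed

text \<open>A pair \<open>(g, m)\<close> stands for the element \<open>r g\<close> times
  \<open>tr m\<close> of \<open>T\<close>. The Schreier factors telescope along a word, so on these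
  elements the word acts as right multiplication.\<close>

lemma word_rel_coset:
  "\<lbrakk>w \<in> words X; ((g, m), (g', m')) \<in> word_rel w\<rbrakk> \<Longrightarrow>
    m' = m \<bullet> \<psi> (w\<^sub>T w) \<and> r g' \<cdot> tr m' = r g \<cdot> tr m \<cdot> w\<^sub>T w"
proof (induction w arbitrary: g m)
  case Nil
  then show ?case by (auto simp: wT_Nil psi_one r_closed tr)
next
  case (Cons a w)
  then obtain h n where hn: "((g, m), (h, n)) \<in> letter_rel a" and w: "((h, n), (g', m')) \<in> word_rel w"
    by auto
  have a: "a \<in> X <+> X" and ww: "w \<in> words X" using Cons.prems by auto
  have IH: "m' = n \<bullet> \<psi> (w\<^sub>T w)" "r g' \<cdot> tr m' = r h \<cdot> tr n \<cdot> w\<^sub>T w"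
    using Cons.IH[OF ww w] by auto
  \<comment> \<open>The last conjunct is the step read backwards; it covers the letters that are
    formal inverses.\<close>
  have step: "n = m \<bullet> gx x \<and> r h \<cdot> tr n = r g \<cdot> tr m \<cdot> w\<^sub>T [Inl x] \<and> r h \<cdot> tr n \<cdot> w\<^sub>T [Inr x] = r g \<cdot> tr m"
    if st: "((g, m), (h, n)) \<in> step x" and x: "x \<in> X" for g m h n x
  proof -
    have [simp]: "w\<^sub>T [Inl x] \<in> TC" using x by simp
    have *: "g \<in> carrier S" "m \<in> Re" "n = m \<bullet> gx x" "n \<in> Re" "h = g \<otimes> s m x"
      using st by (auto simp: step_def)
    note [simp] = tr[OF Re_closed[OF *(2)]] tr[OF Re_closed[OF *(4)]] r_closed[OF *(1)]
    have rs: "r (s m x) = tr m \<cdot> w\<^sub>T [Inl x] \<cdot> (tr n)\<star>"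
      using * x by (intro r_s) (auto simp: Re_range)
    \<comment> \<open>The product \<open>tr m\<close> times \<open>x\<close> lies over
      \<open>n\<close>, as does \<open>tr n\<close>, so the domain idempotent of \<open>tr n\<close>
      is absorbed.\<close>
    have 1: "tr m \<cdot> w\<^sub>T [Inl x] \<cdot> ((tr n)\<star> \<cdot> tr n) = tr m \<cdot> w\<^sub>T [Inl x]"
    proof (rule mult_idem_right)
      have "\<psi> (tr m \<cdot> w\<^sub>T [Inl x]) = n" using *(3) by (simp add: psi_mult)
      then show "\<psi> (tr m \<cdot> w\<^sub>T [Inl x]) \<bullet> \<psi> ((tr n)\<star> \<cdot> tr n) = \<psi> (tr m \<cdot> w\<^sub>T [Inl x])"
        using M.mult_sinv_right[OF Re_closed[OF *(4)]] by (simp add: psi_mult psi_sinv)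
    qed simp_all
    have 2: "tr m \<cdot> (w\<^sub>T [Inl x] \<cdot> (w\<^sub>T [Inl x])\<star>) = tr m"
      by (rule mult_idem_right)
        (use * x Re_right_cancel[of m "gx x"] in \<open>simp_all add: psi_mult psi_sinv M.m_assoc\<close>)
    have A: "r h \<cdot> tr n = r g \<cdot> (tr m \<cdot> w\<^sub>T [Inl x] \<cdot> ((tr n)\<star> \<cdot> tr n))"
      using *(1,2,5) x by (simp add: r_mult s_closed rs T.m_assoc)
    have "r h \<cdot> tr n \<cdot> w\<^sub>T [Inr x] = r g \<cdot> (tr m \<cdot> (w\<^sub>T [Inl x] \<cdot> (w\<^sub>T [Inl x])\<star>))"
      unfolding A 1 using x by (simp add: wT_Inr T.m_assoc)
    then show ?thesis using A *(3) unfolding 1 2 by (simp add: T.m_assoc)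
  qed
  have cl: "g \<in> carrier S" "m \<in> Re" "h \<in> carrier S" "n \<in> Re"
    using hn letter_rel_subset[OF a] by auto
  have aw: "w\<^sub>T [a] \<in> TC" using a by simp
  have letter: "n = m \<bullet> \<psi> (w\<^sub>T [a]) \<and> r h \<cdot> tr n = r g \<cdot> tr m \<cdot> w\<^sub>T [a]"
  proof (cases a)
    case (Inl x)
    then show ?thesis using step[of g m h n x] hn a by auto
  next
    case (Inr x)
    have x: "x \<in> X" and st: "((h, n), (g, m)) \<in> step x" using Inr hn a by auto
    have "m = n \<bullet> gx x" "r g \<cdot> tr m \<cdot> w\<^sub>T [Inr x] = r h \<cdot> tr n" using step[OF st x] by auto
    moreover have "n \<bullet> gx x \<bullet> (gx x)\<diamond> = n"
      using Re_right_cancel[of n "gx x"] cl x calculation by simp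
    ultimately show ?thesis using Inr x by (simp add: wT_Inr psi_sinv)
  qed
  show ?case
  proof
    show "m' = m \<bullet> \<psi> (w\<^sub>T (a # w))"
      using IH(1) letter Re_closed[OF cl(2)] aw ww
      by (simp add: wT_Cons[OF Cons.prems(1)] psi_mult M.m_assoc)
    have "r g' \<cdot> tr m' = (r g \<cdot> tr m \<cdot> w\<^sub>T [a]) \<cdot> w\<^sub>T w" using IH(2) conjunct2[OF letter] by simp
    then show "r g' \<cdot> tr m' = r g \<cdot> tr m \<cdot> w\<^sub>T (a # w)"
      using r_closed[OF cl(1)] tr[OF Re_closed[OF cl(2)]] aw ww
      by (simp add: wT_Cons[OF Cons.prems(1)] T.m_assoc)
  qed
qed

text \<open>Only the two end cosets have to lie in the R-class: by \<open>Re_prefix\<close> the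
  intermediate ones do as well, and over the R-class every letter can be lifted from any
  \<open>g\<close>.\<close>

lemma word_rel_total:
  "\<lbrakk>w \<in> words X; g \<in> carrier S; m \<in> Re; m \<bullet> \<psi> (w\<^sub>T w) \<in> Re\<rbrakk>
    \<Longrightarrow> \<exists>g'. ((g, m), (g', m \<bullet> \<psi> (w\<^sub>T w))) \<in> word_rel w"
proof (induction w arbitrary: g m)
  case Nil
  then show ?case by (auto simp: wT_Nil psi_one)
next
  case (Cons a w)
  have a: "a \<in> X <+> X" "w\<^sub>T [a] \<in> TC" and w: "w \<in> words X" "w\<^sub>T w \<in> TC" using Cons.prems by auto
  have eq: "m \<bullet> \<psi> (w\<^sub>T (a # w)) = m \<bullet> \<psi> (w\<^sub>T [a]) \<bullet> \<psi> (w\<^sub>T w)"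
    using Re_closed[OF Cons.prems(3)] a w by (simp add: wT_Cons[OF Cons.prems(1)] psi_mult M.m_assoc)
  have ma: "m \<bullet> \<psi> (w\<^sub>T [a]) \<in> Re"
    using Re_prefix[of m "\<psi> (w\<^sub>T [a])" "\<psi> (w\<^sub>T w)"] Cons.prems(3,4) a w by (simp add: eq)
  have "\<exists>h\<in>carrier S. ((g, m), (h, m \<bullet> \<psi> (w\<^sub>T [a]))) \<in> letter_rel a"
  proof (cases a)
    case (Inl x)
    then show ?thesis using Cons.prems ma by (auto simp: step_def s_closed)
  next
    case (Inr x)
    let ?n = "m \<bullet> \<psi> (w\<^sub>T [a])"
    have x: "x \<in> X" using Inr a by auto
    have n: "?n \<bullet> gx x = m"
      using Re_right_cancel[of m "(gx x)\<diamond>"] Cons.prems(3) ma x by (simp add: Inr wT_Inr psi_sinv)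
    \<comment> \<open>For a formal inverse the preimage in the fibre is found by dividing by the
      label of the edge that is traversed backwards.\<close>
    have "((g \<otimes> inv s ?n x, ?n), (g \<otimes> inv s ?n x \<otimes> s ?n x, ?n \<bullet> gx x)) \<in> step x"
      unfolding step_def using ma n Cons.prems x s_closed by fastforce
    moreover have "g \<otimes> inv s ?n x \<otimes> s ?n x = g"
      using Cons.prems x ma by (simp add: S.m_assoc s_closed)
    ultimately show ?thesis
      using Inr n Cons.prems x ma by (auto simp: s_closed intro!: bexI[of _ "g \<otimes> inv s ?n x"])
  qed
  then obtain h where h: "h \<in> carrier S" "((g, m), (h, m \<bullet> \<psi> (w\<^sub>T [a]))) \<in> letter_rel a" by blast
  show ?case
    using Cons.IH[OF w(1) h(1) ma] Cons.prems(4) h(2) unfolding eq by auto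
qed

text \<open>Letters multiply the first coordinate on the right, so left translations commute with
  the action. This is the source of multiplicativity of the section.\<close>

lemma word_rel_equivariant:
  "\<lbrakk>w \<in> words X; ((g, m), (g', m')) \<in> word_rel w; k \<in> carrier S\<rbrakk>
    \<Longrightarrow> ((k \<otimes> g, m), (k \<otimes> g', m')) \<in> word_rel w"
proof (induction w arbitrary: g m)
  case (Cons a w)
  then obtain h n where hn: "((g, m), (h, n)) \<in> letter_rel a" and w: "((h, n), (g', m')) \<in> word_rel w"
    by auto
  have a: "a \<in> X <+> X" using Cons.prems by simp
  have "((k \<otimes> g, m), (k \<otimes> h, n)) \<in> letter_rel a"
    using hn a Cons.prems(3) by (cases a) (fastforce simp: step_def s_closed S.m_assoc)+
  then show ?case using Cons.IH[OF _ w Cons.prems(3)] Cons.prems(1) by auto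
qed auto

lemma e_Re: "e \<in> Re"
  using e M.idems_closed[OF e] by (simp add: Re_def M.sinv_idem M.idems_idem del: Re_closed)

text \<open>Words equal in \<open>T\<close> need not be Vagner equivalent; they become so after
  appending a word \<open>z\<close> for the witnessing idempotent. That word acts as a partial
  identity, and it is defined at \<open>(g, e)\<close> because its image in \<open>M\<close> is
  \<open>e\<close>. So it can be appended to \<open>w\<close> and then removed from
  \<open>w'\<close>.\<close>

lemma word_rel_tau:
  assumes w: "w \<in> words X" "w' \<in> words X" "w\<^sub>T w = w\<^sub>T w'" "\<psi> (w\<^sub>T w) = e"
    and g: "((\<one>, e), (g, e)) \<in> word_rel w"
  shows "((\<one>, e), (g, e)) \<in> word_rel w'"
proof -
  have "(rho X w, rho X w') \<in> \<theta>\<^sub>m"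
    using w by (simp add: wT_def tau_eq_iff rho_closed)
  then obtain f where f: "f \<in> EF" "rho X w \<odot> f = rho X w' \<odot> f"
      "\<theta> (F_sinv (rho X w) \<odot> rho X w) = \<theta> f"
    by (auto simp: theta_min_def)
  obtain z where z: "z \<in> words X" "f = rho X z" using rho_surj F.idems_closed[OF f(1)] by blast
  have "f = rho X (z @ word_inv z)"
    using f(1) z by (simp add: rho_append F.sinv_idem F.idems_idem flip: sinv_rho)
  then have "word_rel z = word_rel (z @ word_inv z)"
    using z by (intro word_rel_vagner) (simp flip: rho_eq_iff)
  moreover have "Id_on A \<subseteq> Id" for A :: "('b \<times> 'x word set set) set" by blast
  ultimately have id: "word_rel z \<subseteq> Id" using word_rel_range[OF z(1)] by metis
  have "\<theta> f = e"
    using w(1,4) by (simp add: theta_mult theta_sinv rho_closed psi_wT e M.sinv_idem M.idems_idem flip: f(3))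
  then have "\<psi> (w\<^sub>T z) = e" using z by (simp add: psi_wT)
  moreover have "e \<bullet> e = e" using e by (rule M.idems_idem)
  moreover have "g \<in> carrier S" using g word_rel_subset[OF w(1)] by auto
  ultimately obtain g' where "((g, e), (g', e)) \<in> word_rel z"
    using word_rel_total[OF z(1), of g e] e_Re by auto
  then have "((g, e), (g, e)) \<in> word_rel z" using id by auto
  then have "((\<one>, e), (g, e)) \<in> word_rel (w @ z)" using g w z by (auto simp: word_rel_append)
  also have "word_rel (w @ z) = word_rel (w' @ z)"
    using f(2) w z by (intro word_rel_vagner) (simp add: rho_append flip: rho_eq_iff)
  finally show ?thesis using w z id by (auto simp: word_rel_append)
qed

lemma section_exists:
  "\<exists>\<sigma>\<in>hom (K_group X R e) S. \<forall>k\<in>carrier (K_group X R e). r (\<sigma> k) = k"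
proof -
  let ?K = "K_group X R e"
  have ee: "e \<bullet> e = e" using e by (rule M.idems_idem)
  \<comment> \<open>The section sends \<open>k\<close> to the first coordinate of the point reached
    from the base point \<open>(1, e)\<close> by a word for \<open>k\<close>;
    \<open>word_rel_tau\<close> makes the choice of the word irrelevant.\<close>
  have ex: "\<exists>g\<in>carrier S. \<forall>w\<in>words X. w\<^sub>T w = k \<longrightarrow> ((\<one>, e), (g, e)) \<in> word_rel w"
    if k: "k \<in> carrier ?K" for k
  proof -
    have k': "k \<in> TC" "\<psi> k = e" using k by (auto simp: K_carrier)
    obtain w where w: "w \<in> words X" "w\<^sub>T w = k" using wT_surj[OF k'(1)] .
    obtain g where g: "((\<one>, e), (g, e)) \<in> word_rel w"
      using word_rel_total[OF w(1), of \<one> e] w k' e_Re ee by auto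
    then have "g \<in> carrier S" using word_rel_subset[OF w(1)] by auto
    moreover have "((\<one>, e), (g, e)) \<in> word_rel w'" if "w' \<in> words X" "w\<^sub>T w' = k" for w'
      using word_rel_tau[OF w(1) that(1) _ _ g] w(2) that(2) k'(2) by simp
    ultimately show ?thesis by blast
  qed
  then obtain \<sigma> where \<sigma>: "\<And>k. k \<in> carrier ?K \<Longrightarrow> \<sigma> k \<in> carrier S"
    "\<And>k w. \<lbrakk>k \<in> carrier ?K; w \<in> words X; w\<^sub>T w = k\<rbrakk> \<Longrightarrow> ((\<one>, e), (\<sigma> k, e)) \<in> word_rel w"
    by metis
  show ?thesis
  proof (intro bexI[of _ \<sigma>] ballI homI)
    fix k assume k: "k \<in> carrier ?K"
    obtain w where w: "w \<in> words X" "w\<^sub>T w = k" using wT_surj k by (auto simp: K_carrier)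
    have "r (\<sigma> k) \<cdot> lft e = r \<one> \<cdot> lft e \<cdot> k"
      using word_rel_coset[OF w(1) \<sigma>(2)[OF k w]] w tr_e by simp
    moreover have "r (\<sigma> k) \<cdot> lft e = r (\<sigma> k)" using kernel_right[of "r (\<sigma> k)"] r_closed \<sigma>(1)[OF k] e by simp
    moreover have "r \<one> = lft e"
      using group_hom.hom_one[of S ?K r] r_hom K_group_group[OF e]
      by (simp add: group_hom_def group_hom_axioms_def K_one)
    moreover have "lft e \<cdot> k = k" using kernel_left[of k] k e by (auto simp: K_carrier)
    ultimately show "r (\<sigma> k) = k" using e by (simp add: T.idems_idem)
    fix k' assume k': "k' \<in> carrier ?K"
    obtain w' where w': "w' \<in> words X" "w\<^sub>T w' = k'" using wT_surj k' by (auto simp: K_carrier)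
    have kk: "k \<cdot> k' \<in> carrier ?K" using k k' ee by (simp add: K_carrier psi_mult)
    have "((\<one>, e), (\<sigma> (k \<cdot> k'), e)) \<in> word_rel (w @ w')"
      using \<sigma>(2)[OF kk] w w' by (simp add: wT_append)
    moreover have "((\<one>, e), (\<sigma> k \<otimes> \<sigma> k', e)) \<in> word_rel (w @ w')"
      using \<sigma>(2)[OF k w] word_rel_equivariant[OF w'(1) \<sigma>(2)[OF k' w'] \<sigma>(1)[OF k]] \<sigma>(1)[OF k] w w'
      by (auto simp: word_rel_append)
    ultimately show "\<sigma> (k \<otimes>\<^bsub>?K\<^esub> k') = \<sigma> k \<otimes> \<sigma> k'"
      using word_rel_single_valued[of "w @ w'"] w w' by (auto simp: K_mult single_valued_def)
  qed (rule \<sigma>)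
qed

end

lemma (in presentation) K_group_projective:
  assumes e: "e \<in> EM" and S: "group S" and r: "r \<in> hom S (K_group X R e)"
    and surj: "r ` carrier S = carrier (K_group X R e)"
  obtains \<sigma> where "\<sigma> \<in> hom (K_group X R e) S" "\<And>k. k \<in> carrier (K_group X R e) \<Longrightarrow> r (\<sigma> k) = k"
proof -
  interpret S: group S by (rule S)
  have "\<forall>m\<in>MC. \<exists>t\<in>TC. \<psi> t = m" using psi_surj by metis
  then obtain tr0 where tr0: "\<And>m. m \<in> MC \<Longrightarrow> tr0 m \<in> TC \<and> \<psi> (tr0 m) = m" by metis
  \<comment> \<open>The base coset must be represented by the idempotent itself, so that in
    \<open>word_rel_coset\<close> the representatives at both ends of a closed word
    disappear.\<close>
  define tr where "tr = tr0(e := lft e)"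
  have tr: "tr m \<in> TC" "\<psi> (tr m) = m" if "m \<in> MC" for m
    using tr0[OF that] e by (auto simp: tr_def)
  \<comment> \<open>The condition is imposed only on edges inside the R-class, where the Schreier
    generator lies in \<open>K_e\<close> and has a preimage. Elsewhere any element of
    \<open>S\<close> may be chosen, to keep \<open>s\<close> total.\<close>
  have "\<exists>g\<in>carrier S. m \<bullet> m\<diamond> = e \<and> (m \<bullet> \<psi> (w\<^sub>T [Inl x])) \<bullet> (m \<bullet> \<psi> (w\<^sub>T [Inl x]))\<diamond> = e \<longrightarrow>
      r g = tr m \<cdot> w\<^sub>T [Inl x] \<cdot> (tr (m \<bullet> \<psi> (w\<^sub>T [Inl x])))\<star>" if m: "m \<in> MC" and x: "x \<in> X" for m x
  proof (cases "m \<bullet> m\<diamond> = e \<and> (m \<bullet> \<psi> (w\<^sub>T [Inl x])) \<bullet> (m \<bullet> \<psi> (w\<^sub>T [Inl x]))\<diamond> = e")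
    case True
    have "tr m \<cdot> w\<^sub>T [Inl x] \<cdot> (tr (m \<bullet> \<psi> (w\<^sub>T [Inl x])))\<star> \<in> carrier (K_group X R e)"
      using m x True tr by (simp add: K_carrier psi_mult psi_sinv)
    then have "tr m \<cdot> w\<^sub>T [Inl x] \<cdot> (tr (m \<bullet> \<psi> (w\<^sub>T [Inl x])))\<star> \<in> r ` carrier S" by (simp add: surj)
    then show ?thesis by auto
  qed auto
  then obtain s where s: "\<And>m x. \<lbrakk>m \<in> MC; x \<in> X\<rbrakk> \<Longrightarrow> s m x \<in> carrier S \<and>
      (m \<bullet> m\<diamond> = e \<and> (m \<bullet> \<psi> (w\<^sub>T [Inl x])) \<bullet> (m \<bullet> \<psi> (w\<^sub>T [Inl x]))\<diamond> = e \<longrightarrow>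
      r (s m x) = tr m \<cdot> w\<^sub>T [Inl x] \<cdot> (tr (m \<bullet> \<psi> (w\<^sub>T [Inl x])))\<star>)"
    by metis
  interpret schreier_lifting X R S e r tr s
    by unfold_locales (use e r tr s in \<open>auto simp: tr_def\<close>)
  show ?thesis using section_exists that by blast
qed

section \<open>Edge paths up to homotopy\<close>

lemma edge_path_vertices: "edge_path Q v xs w \<Longrightarrow> v \<in> vertices Q \<and> w \<in> vertices Q"
  by (induction xs arbitrary: v) auto

lemma edge_path_append:
  "edge_path Q v (xs @ ys) w \<longleftrightarrow> (\<exists>u. edge_path Q v xs u \<and> edge_path Q u ys w)"
  by (induction xs arbitrary: v) (auto dest: edge_path_vertices)

lemma edge_path_appendI:
  "\<lbrakk>edge_path Q v xs u; edge_path Q u ys w\<rbrakk> \<Longrightarrow> edge_path Q v (xs @ ys) w"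
  using edge_path_append by metis

lemma edge_path_unique: "\<lbrakk>edge_path Q v xs w; edge_path Q v xs w'\<rbrakk> \<Longrightarrow> w = w'"
  by (induction xs arbitrary: v) auto

section \<open>Reversal of paths\<close>

definition path_inv :: "('e \<times> bool) list \<Rightarrow> ('e \<times> bool) list" where
  "path_inv xs = rev (map dinv xs)"

lemma dinv_simps [simp]: "dsrc Q (dinv d) = dtgt Q d" "dtgt Q (dinv d) = dsrc Q d"
  "fst (dinv d) = fst d" "dinv (dinv d) = d"
  by (cases d; simp)+

lemma path_inv_simps [simp]: "path_inv [] = []" "path_inv (d # xs) = path_inv xs @ [dinv d]"
  "path_inv (xs @ ys) = path_inv ys @ path_inv xs" "path_inv (path_inv xs) = xs"
  by (simp_all add: path_inv_def rev_map comp_def)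

lemma edge_path_inv: "edge_path Q v xs w \<Longrightarrow> edge_path Q w (path_inv xs) v"
proof (induction xs arbitrary: v)
  case (Cons d xs)
  then have "edge_path Q w (path_inv xs) (dtgt Q d)" by simp
  moreover have "edge_path Q (dtgt Q d) [dinv d] v"
    using Cons.prems edge_path_vertices[of Q "dtgt Q d" xs w] by auto
  ultimately show ?case by (auto simp: edge_path_append)
qed auto

lemma homotopic_edge_path:
  "homotopic Q v w xs ys \<Longrightarrow> edge_path Q v xs w \<and> edge_path Q v ys w"
  by (induction rule: homotopic.induct) auto

lemma homotopic_append_left:
  assumes "edge_path Q v zs u" "homotopic Q u w xs ys"
  shows "homotopic Q v w (zs @ xs) (zs @ ys)"
  using assms(2)
proof (induction rule: homotopic.induct)
  case (cancel xs d ys)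
  then show ?case
    using homotopic.cancel[of Q v "zs @ xs" d ys w] assms(1) by (auto simp: edge_path_append)
next
  case (cell us vs xs ys)
  then show ?case
    using homotopic.cell[of us vs Q v "zs @ xs" ys w] assms(1) by (auto simp: edge_path_append)
qed (use assms(1) in \<open>auto intro: edge_path_appendI homotopic.intros\<close>)

lemma homotopic_append_right:
  assumes "homotopic Q v u xs ys" "edge_path Q u zs w"
  shows "homotopic Q v w (xs @ zs) (ys @ zs)"
  using assms(1)
proof (induction rule: homotopic.induct)
  case (cancel xs d ys)
  then have "edge_path Q v (xs @ [d, dinv d] @ (ys @ zs)) w" "edge_path Q v (xs @ (ys @ zs)) w"
    using edge_path_appendI[OF cancel(1) assms(2)] edge_path_appendI[OF cancel(2) assms(2)] by simp_all
  then show ?case using homotopic.cancel[of Q v xs d "ys @ zs" w] by simp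
next
  case (cell us vs xs ys)
  then have "edge_path Q v (xs @ us @ (ys @ zs)) w" "edge_path Q v (xs @ vs @ (ys @ zs)) w"
    using edge_path_appendI[OF cell(2) assms(2)] edge_path_appendI[OF cell(3) assms(2)] by simp_all
  then show ?case using homotopic.cell[of us vs Q v xs "ys @ zs" w] cell by simp
next
  case (refl xs)
  then show ?case using assms(2) by (intro homotopic.refl) (metis edge_path_append)
qed (auto intro: homotopic.intros)

lemma homotopic_append:
  assumes "homotopic Q v u xs xs'" "homotopic Q u w ys ys'"
  shows "homotopic Q v w (xs @ ys) (xs' @ ys')"
proof -
  have "homotopic Q v w (xs @ ys) (xs' @ ys)"
    using homotopic_append_right assms homotopic_edge_path by metis
  moreover have "homotopic Q v w (xs' @ ys) (xs' @ ys')"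
    using homotopic_append_left assms homotopic_edge_path by metis
  ultimately show ?thesis by (rule homotopic.trans)
qed

lemma homotopic_inv_right: "edge_path Q v xs w \<Longrightarrow> homotopic Q v v (xs @ path_inv xs) []"
proof (induction xs arbitrary: v)
  case (Cons d xs)
  let ?u = "dtgt Q d"
  have d: "edge_path Q v [d] ?u" "edge_path Q ?u [dinv d] v" and xs: "edge_path Q ?u xs w"
    and v: "edge_path Q v [] v"
    using Cons.prems edge_path_vertices[of Q "dtgt Q d" xs w] by auto
  have "homotopic Q v v ([d] @ (xs @ path_inv xs) @ [dinv d]) ([d] @ [] @ [dinv d])"
    by (intro homotopic_append_left[OF d(1)] homotopic_append_right[OF _ d(2)] Cons.IH xs)
  moreover have "homotopic Q v v ([] @ [d, dinv d] @ []) ([] @ [])"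
    by (rule homotopic.cancel) (use d v in auto)
  ultimately show ?case by (auto intro: homotopic.trans)
qed (auto intro: homotopic.refl)

lemma homotopic_inv_left: "edge_path Q v xs w \<Longrightarrow> homotopic Q w w (path_inv xs @ xs) []"
  using homotopic_inv_right[OF edge_path_inv] by fastforce

text \<open>Cancelling \<open>A\<close> on the left and \<open>D\<close> on the right turns a
  commuting square on its side. This carries the interchange law over to edges traversed
  backwards.\<close>

lemma homotopic_square:
  assumes sq: "homotopic Q a d (A @ B) (C @ D)"
    and A: "edge_path Q a A b" and B: "edge_path Q b B d" and C: "edge_path Q a C c" and D: "edge_path Q c D d"
  shows "homotopic Q b c (path_inv A @ C) (B @ path_inv D)"
proof -
  note iA = edge_path_inv[OF A] and iD = edge_path_inv[OF D]
  have "homotopic Q b c ((path_inv A @ C) @ (D @ path_inv D)) ((path_inv A @ C) @ [])"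
    using iA C by (intro homotopic_append_left[OF _ homotopic_inv_right[OF D]]) (auto simp: edge_path_append)
  then have 1: "homotopic Q b c (path_inv A @ C) (path_inv A @ (C @ D) @ path_inv D)"
    by (auto intro: homotopic.sym)
  have 2: "homotopic Q b c (path_inv A @ (C @ D) @ path_inv D) (path_inv A @ (A @ B) @ path_inv D)"
    by (intro homotopic_append_left[OF iA] homotopic_append_right[OF _ iD] homotopic.sym[OF sq])
  have 3: "homotopic Q b c ((path_inv A @ A) @ (B @ path_inv D)) ([] @ (B @ path_inv D))"
    using B iD by (intro homotopic_append_right[OF homotopic_inv_left[OF A]]) (auto simp: edge_path_append)
  show ?thesis using homotopic.trans[OF homotopic.trans[OF 1 2]] 3 by simp
qed

section \<open>Homotopy classes as arrows\<close>

lemma hclass_memI: "homotopic Q v w xs ys \<Longrightarrow> (v, ys, w) \<in> hclass Q v xs w"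
  by (simp add: hclass_def)

lemma hclass_self: "edge_path Q v xs w \<Longrightarrow> (v, xs, w) \<in> hclass Q v xs w"
  by (intro hclass_memI homotopic.refl)

lemma hclass_eqI: "homotopic Q v w xs ys \<Longrightarrow> hclass Q v xs w = hclass Q v ys w"
  by (auto simp: hclass_def intro: homotopic.intros)

lemma gdom_hclass: "edge_path Q v xs w \<Longrightarrow> gdom (hclass Q v xs w) = v"
  unfolding gdom_def
  by (rule the_elem_const) (use hclass_self[of Q v xs w] in \<open>auto simp: hclass_def\<close>)

lemma gran_hclass: "edge_path Q v xs w \<Longrightarrow> gran (hclass Q v xs w) = w"
  unfolding gran_def
  by (rule the_elem_const) (use hclass_self[of Q v xs w] in \<open>auto simp: hclass_def\<close>)

lemma gcomp_hclass:
  assumes "edge_path Q v xs u" "edge_path Q u ys w"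
  shows "gcomp Q (hclass Q v xs u) (hclass Q u ys w) = hclass Q v (xs @ ys) w"
  unfolding gcomp_def
proof (rule the_elem_const)
  show "hclass Q v xs u \<times> hclass Q u ys w \<noteq> {}"
    using hclass_self[OF assms(1)] hclass_self[OF assms(2)] by auto
  fix p assume "p \<in> hclass Q v xs u \<times> hclass Q u ys w"
  then obtain xs' ys' where "p = ((v, xs', u), (u, ys', w))" "homotopic Q v u xs xs'" "homotopic Q u w ys ys'"
    by (auto simp: hclass_def)
  then show "(case p of (p, q) \<Rightarrow> (case p of (v, xs, w) \<Rightarrow> \<lambda>(v', ys, w'). hclass Q v (xs @ ys) w') q)
      = hclass Q v (xs @ ys) w"
    by (auto intro!: hclass_eqI homotopic.sym[OF homotopic_append])
qed

text \<open>A morphism of 2-complexes induces a map on homotopy classes; the cases of interest are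
  the translations of the Squier complex.\<close>

lemma homotopic_map:
  assumes v: "\<And>v. v \<in> vertices Q \<Longrightarrow> fv v \<in> vertices Q'"
    and e: "\<And>x. x \<in> edges Q \<Longrightarrow> fe x \<in> edges Q' \<and> src Q' (fe x) = fv (src Q x) \<and> tgt Q' (fe x) = fv (tgt Q x)"
    and c: "\<And>us vs. (us, vs) \<in> cells Q \<Longrightarrow> (map (apfst fe) us, map (apfst fe) vs) \<in> cells Q'"
  shows edge_path_map: "edge_path Q a xs b \<Longrightarrow> edge_path Q' (fv a) (map (apfst fe) xs) (fv b)"
    and "homotopic Q a b xs ys \<Longrightarrow> homotopic Q' (fv a) (fv b) (map (apfst fe) xs) (map (apfst fe) ys)"
proof -
  have path: "edge_path Q' (fv a) (map (apfst fe) xs) (fv b)" if "edge_path Q a xs b" for a xs b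
    using that
  proof (induction xs arbitrary: a)
    case (Cons d xs)
    then have "edge_path Q' (fv (dtgt Q d)) (map (apfst fe) xs) (fv b)" by simp
    then show ?case using Cons.prems v e by (cases d) auto
  qed (simp add: v)
  show "edge_path Q a xs b \<Longrightarrow> edge_path Q' (fv a) (map (apfst fe) xs) (fv b)" by (rule path)
  have dinv: "apfst fe (dinv d) = dinv (apfst fe d)" for d by (cases d) simp
  show "homotopic Q' (fv a) (fv b) (map (apfst fe) xs) (map (apfst fe) ys)"
    if "homotopic Q a b xs ys" using that
  proof (induction rule: homotopic.induct)
    case (cancel xs d ys)
    then show ?case
      using homotopic.cancel[of Q' "fv a" "map (apfst fe) xs" "apfst fe d" "map (apfst fe) ys" "fv b"]
        path[OF cancel(1)] path[OF cancel(2)] by (simp add: dinv)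
  next
    case (cell us vs xs ys)
    then show ?case
      using homotopic.cell[OF c, of us vs "fv a" "map (apfst fe) xs" "map (apfst fe) ys" "fv b"]
        path[OF cell(2)] path[OF cell(3)] by simp
  qed (auto intro: homotopic.intros path)
qed


section \<open>The Squier complex\<close>

context presentation
begin

abbreviation Sq where "Sq \<equiv> squier X R"

text \<open>The two actions at the level of representing paths, where they can be computed before
  passing to classes.\<close>

definition lmap :: "'x word set set \<Rightarrow> ('x squier_edge \<times> bool) list \<Rightarrow> ('x squier_edge \<times> bool) list" where
  "lmap t = map (\<lambda>((p, l, r, q), b). ((t \<cdot> p, l, r, q), b))"

definition rmap :: "'x word set set \<Rightarrow> ('x squier_edge \<times> bool) list \<Rightarrow> ('x squier_edge \<times> bool) list" where
  "rmap t = map (\<lambda>((p, l, r, q), b). ((p, l, r, q \<cdot> t), b))"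

lemma lmap_apfst: "lmap t = map (apfst (\<lambda>(p, l, r, q). (t \<cdot> p, l, r, q)))"
  and rmap_apfst: "rmap t = map (apfst (\<lambda>(p, l, r, q). (p, l, r, q \<cdot> t)))"
  by (auto simp: lmap_def rmap_def fun_eq_iff)

lemma lmap_simps [simp]: "lmap t [] = []" "lmap t (xs @ ys) = lmap t xs @ lmap t ys"
    "lmap t (((p, l, r, q), b) # xs) = ((t \<cdot> p, l, r, q), b) # lmap t xs"
    "path_inv (lmap t xs) = lmap t (path_inv xs)"
  and rmap_simps [simp]: "rmap t [] = []" "rmap t (xs @ ys) = rmap t xs @ rmap t ys"
    "rmap t (((p, l, r, q), b) # xs) = ((p, l, r, q \<cdot> t), b) # rmap t xs"
    "path_inv (rmap t xs) = rmap t (path_inv xs)"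
  by (auto simp: lmap_def rmap_def path_inv_def rev_map)

lemma squier_simps: "vertices Sq = TC"
  "(p, l, r, q) \<in> edges Sq \<longleftrightarrow> p \<in> TC \<and> (l, r) \<in> R \<and> q \<in> TC"
  "src Sq (p, l, r, q) = p \<cdot> w\<^sub>T l \<cdot> q" "tgt Sq (p, l, r, q) = p \<cdot> w\<^sub>T r \<cdot> q"
  by (auto simp: squier_def)

lemma squier_cell:
  "\<lbrakk>p \<in> TC; q \<in> TC; p' \<in> TC; q' \<in> TC; (l, r) \<in> R; (l', r') \<in> R\<rbrakk> \<Longrightarrow>
    ([((p, l, r, q \<cdot> p' \<cdot> w\<^sub>T l' \<cdot> q'), True), ((p \<cdot> w\<^sub>T r \<cdot> q \<cdot> p', l', r', q'), True)],
     [((p \<cdot> w\<^sub>T l \<cdot> q \<cdot> p', l', r', q'), True), ((p, l, r, q \<cdot> p' \<cdot> w\<^sub>T r' \<cdot> q'), True)]) \<in> cells Sq"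
  by (auto simp: squier_def)

lemma squier_cellE:
  assumes "(us, vs) \<in> cells Sq"
  obtains p q p' q' l r l' r' where "p \<in> TC" "q \<in> TC" "p' \<in> TC" "q' \<in> TC" "(l, r) \<in> R" "(l', r') \<in> R"
    "us = [((p, l, r, q \<cdot> p' \<cdot> w\<^sub>T l' \<cdot> q'), True), ((p \<cdot> w\<^sub>T r \<cdot> q \<cdot> p', l', r', q'), True)]"
    "vs = [((p \<cdot> w\<^sub>T l \<cdot> q \<cdot> p', l', r', q'), True), ((p, l, r, q \<cdot> p' \<cdot> w\<^sub>T r' \<cdot> q'), True)]"
  using assms by (auto simp: squier_def)

lemma squier_path_closed: "edge_path Sq v xs w \<Longrightarrow> v \<in> TC \<and> w \<in> TC"
  using edge_path_vertices by (metis squier_simps(1))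

lemma squier_path_edges:
  "edge_path Sq v xs w \<Longrightarrow> ((p, l, r, q), b) \<in> set xs \<Longrightarrow> p \<in> TC \<and> q \<in> TC \<and> (l, r) \<in> R"
  by (induction xs arbitrary: v) (auto simp: squier_simps)

lemma
  assumes t [simp]: "t \<in> TC"
  shows lmap_path: "edge_path Sq v xs w \<Longrightarrow> edge_path Sq (t \<cdot> v) (lmap t xs) (t \<cdot> w)"
    and lmap_homotopic: "homotopic Sq v w xs ys \<Longrightarrow> homotopic Sq (t \<cdot> v) (t \<cdot> w) (lmap t xs) (lmap t ys)"
    and rmap_path: "edge_path Sq v xs w \<Longrightarrow> edge_path Sq (v \<cdot> t) (rmap t xs) (w \<cdot> t)"
    and rmap_homotopic: "homotopic Sq v w xs ys \<Longrightarrow> homotopic Sq (v \<cdot> t) (w \<cdot> t) (rmap t xs) (rmap t ys)"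
proof -
  note [simp] = R_wordsD
  have l: "(map (apfst (\<lambda>(p, l, r, q). (t \<cdot> p, l, r, q))) us, map (apfst (\<lambda>(p, l, r, q). (t \<cdot> p, l, r, q))) vs)
      \<in> cells Sq" if "(us, vs) \<in> cells Sq" for us vs
    using that
  proof (cases rule: squier_cellE)
    case (1 p q p' q' l r l' r')
    then show ?thesis using squier_cell[of "t \<cdot> p" q p' q' l r l' r'] by (simp add: T.m_assoc)
  qed
  have r: "(map (apfst (\<lambda>(p, l, r, q). (p, l, r, q \<cdot> t))) us, map (apfst (\<lambda>(p, l, r, q). (p, l, r, q \<cdot> t))) vs)
      \<in> cells Sq" if "(us, vs) \<in> cells Sq" for us vs
    using that
  proof (cases rule: squier_cellE)
    case (1 p q p' q' l r l' r')
    then show ?thesis using squier_cell[of p q p' "q' \<cdot> t" l r l' r'] by (simp add: T.m_assoc)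
  qed
  show "edge_path Sq v xs w \<Longrightarrow> edge_path Sq (t \<cdot> v) (lmap t xs) (t \<cdot> w)"
    unfolding lmap_apfst
    by (rule edge_path_map[where Q = Sq and fv = "\<lambda>v. t \<cdot> v" and fe = "\<lambda>(p, l, r, q). (t \<cdot> p, l, r, q)"];
        (rule l; assumption)?; auto simp: squier_simps T.m_assoc)
  show "homotopic Sq v w xs ys \<Longrightarrow> homotopic Sq (t \<cdot> v) (t \<cdot> w) (lmap t xs) (lmap t ys)"
    unfolding lmap_apfst
    by (rule homotopic_map[where Q = Sq and fv = "\<lambda>v. t \<cdot> v" and fe = "\<lambda>(p, l, r, q). (t \<cdot> p, l, r, q)"];
        (rule l; assumption)?; auto simp: squier_simps T.m_assoc)
  show "edge_path Sq v xs w \<Longrightarrow> edge_path Sq (v \<cdot> t) (rmap t xs) (w \<cdot> t)"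
    unfolding rmap_apfst
    by (rule edge_path_map[where Q = Sq and fv = "\<lambda>v. v \<cdot> t" and fe = "\<lambda>(p, l, r, q). (p, l, r, q \<cdot> t)"];
        (rule r; assumption)?; auto simp: squier_simps T.m_assoc)
  show "homotopic Sq v w xs ys \<Longrightarrow> homotopic Sq (v \<cdot> t) (w \<cdot> t) (rmap t xs) (rmap t ys)"
    unfolding rmap_apfst
    by (rule homotopic_map[where Q = Sq and fv = "\<lambda>v. v \<cdot> t" and fe = "\<lambda>(p, l, r, q). (p, l, r, q \<cdot> t)"];
        (rule r; assumption)?; auto simp: squier_simps T.m_assoc)
qed

lemma left_act_hclass:
  assumes t: "t \<in> TC" and xs: "edge_path Sq v xs w"
  shows "left_act X R t (hclass Sq v xs w) = hclass Sq (t \<cdot> v) (lmap t xs) (t \<cdot> w)"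
  unfolding left_act_def
proof (rule the_elem_const)
  show "hclass Sq v xs w \<noteq> {}" using hclass_self[OF xs] by blast
  fix z assume "z \<in> hclass Sq v xs w"
  show "(case z of (v, xs, w) \<Rightarrow> hclass Sq (t \<cdot> v)
      (map (\<lambda>((p, l, r, q), b). ((t \<cdot> p, l, r, q), b)) xs) (t \<cdot> w)) = hclass Sq (t \<cdot> v) (lmap t xs) (t \<cdot> w)"
  proof -
    obtain ys where ys: "z = (v, ys, w)" "homotopic Sq v w xs ys"
      using \<open>z \<in> hclass Sq v xs w\<close> by (auto simp: hclass_def)
    show ?thesis using hclass_eqI[OF lmap_homotopic[OF t ys(2)]] by (simp add: ys(1) lmap_def)
  qed
qed

lemma right_act_hclass:
  assumes t: "t \<in> TC" and xs: "edge_path Sq v xs w"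
  shows "right_act X R (hclass Sq v xs w) t = hclass Sq (v \<cdot> t) (rmap t xs) (w \<cdot> t)"
  unfolding right_act_def
proof (rule the_elem_const)
  show "hclass Sq v xs w \<noteq> {}" using hclass_self[OF xs] by blast
  fix z assume "z \<in> hclass Sq v xs w"
  show "(case z of (v, xs, w) \<Rightarrow> hclass Sq (v \<cdot> t)
      (map (\<lambda>((p, l, r, q), b). ((p, l, r, q \<cdot> t), b)) xs) (w \<cdot> t)) = hclass Sq (v \<cdot> t) (rmap t xs) (w \<cdot> t)"
  proof -
    obtain ys where ys: "z = (v, ys, w)" "homotopic Sq v w xs ys"
      using \<open>z \<in> hclass Sq v xs w\<close> by (auto simp: hclass_def)
    show ?thesis using hclass_eqI[OF rmap_homotopic[OF t ys(2)]] by (simp add: ys(1) rmap_def)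
  qed
qed

section \<open>Connected components of the Squier complex\<close>

lemma squier_path_psi: "edge_path Sq v xs w \<Longrightarrow> \<psi> v = \<psi> w"
proof (induction xs arbitrary: v)
  case (Cons d xs)
  obtain p l r q b where d: "d = ((p, l, r, q), b)" by (metis surj_pair)
  have "\<psi> (p \<cdot> w\<^sub>T l \<cdot> q) = \<psi> (p \<cdot> w\<^sub>T r \<cdot> q)" if "p \<in> TC" "(l, r) \<in> R" "q \<in> TC"
    using that R_wordsD[OF that(2)] psi_wT_rel[OF that(2)] by (simp add: psi_mult)
  then show ?case using Cons by (auto simp: d squier_simps split: if_splits)
qed auto

text \<open>Reachability by edge paths is a two-sided congruence, since paths can be translated, and
  it contains the relations. So it contains the kernel of \<open>psi\<close>. This is the source of
  surjectivity of the range map.\<close>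

lemma squier_connected:
  assumes "t \<in> TC" "u \<in> TC" "\<psi> t = \<psi> u"
  obtains xs where "edge_path Sq t xs u"
proof -
  let ?r = "{(t, u). \<exists>xs. edge_path Sq t xs u}"
  have "congruence_on (Tmon X R) ?r"
    unfolding congruence_on_def
  proof (intro conjI ballI)
    show "equiv TC ?r"
    proof (rule equivI)
      show "?r \<subseteq> TC \<times> TC" using squier_path_closed by auto
      show "refl_on TC ?r" by (auto simp: refl_on_def squier_simps intro!: exI[of _ "[]"])
      show "sym ?r" by (auto simp: sym_def dest: edge_path_inv)
      show "trans ?r" unfolding trans_def by (auto intro: edge_path_appendI)
    qed
    fix z assume "z \<in> ?r"
    then obtain a b xs where z: "z = (a, b)" "edge_path Sq a xs b" by auto
    have "(c \<cdot> a, c \<cdot> b) \<in> ?r \<and> (a \<cdot> c, b \<cdot> c) \<in> ?r" if c: "c \<in> TC" for c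
      using lmap_path[OF c z(2)] rmap_path[OF c z(2)] by auto
    then show "case z of (a, b) \<Rightarrow> \<forall>c\<in>TC. (c \<cdot> a, c \<cdot> b) \<in> ?r \<and> (a \<cdot> c, b \<cdot> c) \<in> ?r"
      using z(1) by simp
  qed
  moreover have "(w\<^sub>T l, w\<^sub>T r) \<in> ?r" if "(l, r) \<in> R" for l r
  proof -
    have "edge_path Sq (w\<^sub>T l) [((\<one>\<^bsub>Tmon X R\<^esub>, l, r, \<one>\<^bsub>Tmon X R\<^esub>), True)] (w\<^sub>T r)"
      using that R_wordsD[OF that] by (simp add: squier_simps)
    then show ?thesis by blast
  qed
  ultimately have "(t, u) \<in> ?r" using assms by (rule psi_eq_imp_congruent)
  then show ?thesis using that by blast
qed

text \<open>The 2-cells are the interchange law for positive edges.\<close>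

lemma interchange_edges:
  assumes "edge_path Sq v [d] w" "edge_path Sq v' [d'] w'"
  shows "homotopic Sq (v \<cdot> v') (w \<cdot> w') (rmap v' [d] @ lmap w [d']) (lmap v [d'] @ rmap w' [d])"
proof -
  have pos: "homotopic Sq (v \<cdot> v') (w \<cdot> w') (rmap v' [(x, True)] @ lmap w [(x', True)])
      (lmap v [(x', True)] @ rmap w' [(x, True)])"
    if P: "edge_path Sq v [(x, True)] w" "edge_path Sq v' [(x', True)] w'" for v w v' w' x x'
  proof -
    obtain p l r q where x: "x = (p, l, r, q)" by (metis surj_pair)
    obtain p' l' r' q' where x': "x' = (p', l', r', q')" by (metis surj_pair)
    have v: "p \<in> TC" "q \<in> TC" "(l, r) \<in> R" "v = p \<cdot> w\<^sub>T l \<cdot> q" "w = p \<cdot> w\<^sub>T r \<cdot> q"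
      and v': "p' \<in> TC" "q' \<in> TC" "(l', r') \<in> R" "v' = p' \<cdot> w\<^sub>T l' \<cdot> q'" "w' = p' \<cdot> w\<^sub>T r' \<cdot> q'"
      using P by (auto simp: squier_simps x x')
    note [simp] = R_wordsD[OF v(3)] R_wordsD[OF v'(3)]
    have vc: "v \<in> TC" "w \<in> TC" "v' \<in> TC" "w' \<in> TC" using v v' by auto
    have c: "(rmap v' [(x, True)] @ lmap w [(x', True)], lmap v [(x', True)] @ rmap w' [(x, True)]) \<in> cells Sq"
      using squier_cell[of p q p' q' l r l' r'] v v' by (simp add: x x' T.m_assoc)
    have "edge_path Sq (v \<cdot> v') (rmap v' [(x, True)] @ lmap w [(x', True)]) (w \<cdot> w')"
      "edge_path Sq (v \<cdot> v') (lmap v [(x', True)] @ rmap w' [(x, True)]) (w \<cdot> w')"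
      unfolding edge_path_append using rmap_path lmap_path P vc by blast+
    then show ?thesis using homotopic.cell[OF c, of "v \<cdot> v'" "[]" "[]" "w \<cdot> w'"] by simp
  qed
  have right: "homotopic Sq (v \<cdot> v') (w \<cdot> w') (rmap v' [(x, True)] @ lmap w [d']) (lmap v [d'] @ rmap w' [(x, True)])"
    if P: "edge_path Sq v [(x, True)] w" "edge_path Sq v' [d'] w'" for v w v' w' x d'
  proof (cases d')
    case (Pair x' b)
    show ?thesis
    proof (cases b)
      case True
      show ?thesis using P unfolding Pair eqTrueI[OF True] by (rule pos)
    next
      case False
      \<comment> \<open>The reversed edge is positive. The square for it is turned on its side to
        give the square for \<open>d'\<close>; the first edge is treated in the same way
        below.\<close>
      have P': "edge_path Sq w' [(x', True)] v'" using edge_path_inv[OF P(2)] Pair False by simp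
      have vc: "v \<in> TC" "w \<in> TC" "v' \<in> TC" "w' \<in> TC" using P squier_path_closed by blast+
      have inv: "path_inv (rmap w' [(x, True)]) = rmap w' (path_inv [(x, True)])"
        "path_inv (lmap v [(x', True)]) = lmap v [d']" "path_inv (lmap w [(x', True)]) = lmap w [d']"
        using Pair False by (simp_all del: lmap_simps(3) rmap_simps(3))
      have sq: "homotopic Sq (v \<cdot> w') (w \<cdot> v') (lmap v [(x', True)] @ rmap v' [(x, True)])
          (rmap w' [(x, True)] @ lmap w [(x', True)])"
        using pos[OF P(1) P'] by (rule homotopic.sym)
      show ?thesis
        using homotopic.sym[OF homotopic_square[OF sq lmap_path[OF vc(1) P'] rmap_path[OF vc(3) P(1)]
              rmap_path[OF vc(4) P(1)] lmap_path[OF vc(2) P']]]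
        unfolding inv .
    qed
  qed
  show ?thesis
  proof (cases d)
    case (Pair x b)
    show ?thesis
    proof (cases b)
      case True
      show ?thesis using assms unfolding Pair eqTrueI[OF True] by (rule right)
    next
      case False
      have P': "edge_path Sq w [(x, True)] v" using edge_path_inv[OF assms(1)] Pair False by simp
      have vc: "v \<in> TC" "w \<in> TC" "v' \<in> TC" "w' \<in> TC" using assms squier_path_closed by blast+
      have inv: "path_inv (rmap v' [(x, True)]) = rmap v' [d]" "path_inv (rmap w' [(x, True)]) = rmap w' [d]"
        using Pair False by (simp_all del: lmap_simps(3) rmap_simps(3))
      show ?thesis
        using homotopic_square[OF right[OF P' assms(2)] rmap_path[OF vc(3) P'] lmap_path[OF vc(1) assms(2)]
            lmap_path[OF vc(2) assms(2)] rmap_path[OF vc(4) P']]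
        unfolding inv .
    qed
  qed
qed

lemma Cons_append: "d # xs = [d] @ xs"
  by simp

text \<open>The rectangle spanned by the two paths is tiled by the squares of
  \<open>interchange_edges\<close>: one row for a single first edge, then row by row. It says that
  the two possible readings of the product of two arrows agree.\<close>

lemma interchange:
  assumes "edge_path Sq v xs w" "edge_path Sq v' ys w'"
  shows "homotopic Sq (v \<cdot> v') (w \<cdot> w') (rmap v' xs @ lmap w ys) (lmap v ys @ rmap w' xs)"
proof -
  have edge: "homotopic Sq (v \<cdot> v') (w \<cdot> w') (rmap v' [d] @ lmap w ys) (lmap v ys @ rmap w' [d])"
    if d: "edge_path Sq v [d] w" and "edge_path Sq v' ys w'" for v d w v' ys w'
    using that(2)
  proof (induction ys arbitrary: v')
    case Nil
    then have "w' = v'" "v' \<in> TC" by (auto simp: squier_simps)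
    then show ?case using rmap_path[OF _ d] by (auto intro: homotopic.refl)
  next
    case (Cons d' ys)
    let ?u = "dtgt Sq d'"
    have d': "edge_path Sq v' [d'] ?u" and ys: "edge_path Sq ?u ys w'"
      using Cons.prems edge_path_vertices[of Sq ?u ys w'] by auto
    have c: "v \<in> TC" "w \<in> TC" using d squier_path_closed by blast+
    have "homotopic Sq (v \<cdot> v') (w \<cdot> w') ((rmap v' [d] @ lmap w [d']) @ lmap w ys)
        ((lmap v [d'] @ rmap ?u [d]) @ lmap w ys)"
      by (rule homotopic_append_right[OF interchange_edges[OF d d'] lmap_path[OF c(2) ys]])
    moreover have "homotopic Sq (v \<cdot> v') (w \<cdot> w') (lmap v [d'] @ (rmap ?u [d] @ lmap w ys))
        (lmap v [d'] @ (lmap v ys @ rmap w' [d]))"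
      by (rule homotopic_append_left[OF lmap_path[OF c(1) d'] Cons.IH[OF ys]])
    ultimately show ?case
      unfolding Cons_append[of d' ys] lmap_simps(2) append_assoc by (rule homotopic.trans)
  qed
  show ?thesis using assms(1)
  proof (induction xs arbitrary: v)
    case Nil
    then have "w = v" "v \<in> TC" by (auto simp: squier_simps)
    then show ?case using lmap_path[OF _ assms(2)] by (auto intro: homotopic.refl)
  next
    case (Cons d xs)
    let ?u = "dtgt Sq d"
    have d: "edge_path Sq v [d] ?u" and xs: "edge_path Sq ?u xs w"
      using Cons.prems edge_path_vertices[of Sq ?u xs w] by auto
    have c: "v' \<in> TC" "w' \<in> TC" using assms(2) squier_path_closed by blast+
    have "homotopic Sq (v \<cdot> v') (w \<cdot> w') (rmap v' [d] @ (rmap v' xs @ lmap w ys))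
        (rmap v' [d] @ (lmap ?u ys @ rmap w' xs))"
      by (rule homotopic_append_left[OF rmap_path[OF c(1) d] Cons.IH[OF xs]])
    moreover have "homotopic Sq (v \<cdot> v') (w \<cdot> w') ((rmap v' [d] @ lmap ?u ys) @ rmap w' xs)
        ((lmap v ys @ rmap w' [d]) @ rmap w' xs)"
      by (rule homotopic_append_right[OF edge[OF d assms(2)] rmap_path[OF c(2) xs]])
    ultimately show ?case
      unfolding Cons_append[of d xs] rmap_simps(2) append_assoc by (rule homotopic.trans)
  qed
qed

end

section \<open>The star groups\<close>

context presentation
begin

abbreviation St where "St \<equiv> star_group X R"

text \<open>Turns membership in the star group into a condition on the edges of a path: first
  entries lie in \<open>e T\<close> and last entries in \<open>T e\<close>. On such paths
  translation by \<open>e\<close> is the identity.\<close>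

definition nf where
  "nf e xs \<longleftrightarrow> (\<forall>((p, l, r, q), b) \<in> set xs. e \<cdot> p = p \<and> q \<cdot> e = q)"

definition npath where
  "npath e xs g \<longleftrightarrow> edge_path Sq e xs g \<and> nf e xs"

definition act where
  "act t \<alpha> = right_act X R (left_act X R (t\<star>) \<alpha>) t"

definition cmap where
  "cmap t xs = rmap t (lmap (t\<star>) xs)"

lemma nf_simps [simp]: "nf e []" "nf e (xs @ ys) \<longleftrightarrow> nf e xs \<and> nf e ys"
    "nf e (((p, l, r, q), b) # xs) \<longleftrightarrow> e \<cdot> p = p \<and> q \<cdot> e = q \<and> nf e xs"
  by (simp_all add: nf_def ball_Un)

lemma nfD: "\<lbrakk>nf e xs; ((p, l, r, q), b) \<in> set xs\<rbrakk> \<Longrightarrow> e \<cdot> p = p \<and> q \<cdot> e = q"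
  by (auto simp: nf_def)

lemma nf_path_inv [simp]: "nf e (path_inv xs) \<longleftrightarrow> nf e xs"
  by (induction xs) auto

lemma nf_rmap_lmap: "nf f (rmap t (lmap u xs)) \<longleftrightarrow>
    (\<forall>((p, l, r, q), b) \<in> set xs. f \<cdot> (u \<cdot> p) = u \<cdot> p \<and> (q \<cdot> t) \<cdot> f = q \<cdot> t)"
  by (induction xs) auto

lemma npath_path: "npath e xs g \<Longrightarrow> edge_path Sq e xs g"
  by (simp add: npath_def)

lemma path_map_cong:
  assumes "edge_path Sq v xs w" and "\<And>p l r q b. \<lbrakk>((p, l, r, q), b) \<in> set xs; p \<in> TC; q \<in> TC\<rbrakk>
      \<Longrightarrow> f ((p, l, r, q), b) = g ((p, l, r, q), b)"
  shows "map f xs = map g xs"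
  using assms squier_path_edges by auto

lemma lmap_lmap: "\<lbrakk>edge_path Sq v xs w; t \<in> TC; u \<in> TC\<rbrakk> \<Longrightarrow> lmap t (lmap u xs) = lmap (t \<cdot> u) xs"
  unfolding lmap_def map_map by (rule path_map_cong) (auto simp: T.m_assoc)

lemma rmap_rmap: "\<lbrakk>edge_path Sq v xs w; t \<in> TC; u \<in> TC\<rbrakk> \<Longrightarrow> rmap t (rmap u xs) = rmap (u \<cdot> t) xs"
  unfolding rmap_def map_map by (rule path_map_cong) (auto simp: T.m_assoc)

lemma lmap_rmap: "lmap t (rmap u xs) = rmap u (lmap t xs)"
  by (auto simp: lmap_def rmap_def)

lemma lmap_npath: "npath e xs g \<Longrightarrow> lmap e xs = xs"
  and rmap_npath: "npath e xs g \<Longrightarrow> rmap e xs = xs"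
  by (auto simp: npath_def nf_def lmap_def rmap_def intro!: map_idI)

lemma nf_lmap_rmap:
  assumes "edge_path Sq v xs w" "e \<in> ET"
  shows "nf e (rmap e (lmap e xs))"
  unfolding nf_rmap_lmap
  using assms squier_path_edges[OF assms(1)] T.idems_closed[OF assms(2)]
  by (auto simp: T.m_assoc T.idem_left T.idems_idem)

context
  fixes e g
  assumes e: "e \<in> ET" and g [simp]: "g \<in> TC" and psi_g: "\<psi> g = \<psi> e"
begin

lemma ker_left: "e \<cdot> g = g" and ker_right: "g \<cdot> e = g"
  and ker_range: "g \<cdot> g\<star> = e" and ker_domain: "g\<star> \<cdot> g = e"
  using kernel_left[of g] kernel_right[of g] kernel_range[of g] kernel_domain[of g] psi_idem[OF e]
  by (simp_all add: psi_g lift_psi[OF e])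

lemma ker_psi_sinv: "\<psi> (g\<star>) = \<psi> e"
  using psi_idem[OF e] by (simp add: psi_sinv psi_g M.sinv_idem)

end

lemma npath_end:
  assumes "npath e xs g"
  shows "e \<in> TC" "g \<in> TC" "\<psi> g = \<psi> e"
  using squier_path_closed[OF npath_path[OF assms]] squier_path_psi[OF npath_path[OF assms]] by auto

section \<open>The star groups in terms of normal paths\<close>

lemma star_carrierI: assumes e: "e \<in> ET" and xs: "npath e xs g"
  shows "hclass Sq e xs g \<in> carrier (St e)"
proof -
  note p = npath_path[OF xs] and ec = T.idems_closed[OF e]
  have "right_act X R (left_act X R e (hclass Sq e xs g)) e = hclass Sq e xs g"
    using left_act_hclass[OF ec p] right_act_hclass[OF ec lmap_path[OF ec p]]
      lmap_npath[OF xs] rmap_npath[OF xs] T.idems_idem[OF e]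
      ker_left[OF e npath_end(2,3)[OF xs]] ker_right[OF e npath_end(2,3)[OF xs]] by simp
  moreover have "hclass Sq e xs g \<in> fund_groupoid Sq" using p by (auto simp: fund_groupoid_def)
  ultimately show ?thesis using gdom_hclass[OF p] by (force simp: star_group_def)
qed

text \<open>Cutting down a representing path by \<open>e\<close> on both sides makes it normal. Its
  end point is unaffected, because an element over the same idempotent absorbs
  \<open>e\<close>.\<close>

lemma star_carrierE:
  assumes e: "e \<in> ET" and \<alpha>: "\<alpha> \<in> carrier (St e)"
  obtains xs g where "npath e xs g" "\<alpha> = hclass Sq e xs g"
proof -
  note ec = T.idems_closed[OF e]
  obtain \<beta> where \<beta>: "\<alpha> = right_act X R (left_act X R e \<beta>) e" "\<beta> \<in> fund_groupoid Sq" "gdom \<beta> = e"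
    using \<alpha> by (auto simp: star_group_def)
  obtain v xs w where "\<beta> = hclass Sq v xs w" and "edge_path Sq v xs w"
    using \<beta>(2) by (auto simp: fund_groupoid_def)
  with \<beta>(3) have \<beta>': "\<beta> = hclass Sq e xs w" and p: "edge_path Sq e xs w"
    using gdom_hclass by metis+
  note w = squier_path_closed[OF p] squier_path_psi[OF p]
  have "\<alpha> = hclass Sq (e \<cdot> e \<cdot> e) (rmap e (lmap e xs)) (e \<cdot> w \<cdot> e)"
    using left_act_hclass[OF ec p] right_act_hclass[OF ec lmap_path[OF ec p]] \<beta>(1) \<beta>' by simp
  moreover have "edge_path Sq (e \<cdot> e \<cdot> e) (rmap e (lmap e xs)) (e \<cdot> w \<cdot> e)"
    by (rule rmap_path[OF ec lmap_path[OF ec p]])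
  moreover have "e \<cdot> e \<cdot> e = e" "e \<cdot> w \<cdot> e = w"
    using T.idems_idem[OF e] ker_left[OF e, of w] ker_right[OF e, of w] w by auto
  ultimately show ?thesis using that nf_lmap_rmap[OF p e] by (simp add: npath_def)
qed

lemma star_mult_eq: "\<alpha> \<otimes>\<^bsub>St e\<^esub> \<beta> = star_mult X R \<alpha> \<beta>"
  and star_one: "\<one>\<^bsub>St e\<^esub> = hclass Sq e [] e"
  by (simp_all add: star_group_def)

lemma npath_mult:
  assumes e: "e \<in> ET" and xs: "npath e xs g" and ys: "npath e ys h"
  shows "npath e (xs @ lmap g ys) (g \<cdot> h)"
proof -
  have ge: "g \<cdot> e = g" "e \<cdot> g = g" and gc: "g \<in> TC"
    using ker_right[OF e npath_end(2,3)[OF xs]] ker_left[OF e npath_end(2,3)[OF xs]] npath_end[OF xs] by auto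
  have "edge_path Sq g (lmap g ys) (g \<cdot> h)"
    using lmap_path[OF gc npath_path[OF ys]] ge by simp
  moreover have "nf e (lmap g ys)"
    using ys ge gc squier_path_edges[OF npath_path[OF ys]] T.idems_closed[OF e]
    by (fastforce simp: npath_def nf_def lmap_def simp flip: T.m_assoc)
  ultimately show ?thesis using xs by (auto simp: npath_def intro: edge_path_appendI)
qed

text \<open>The right translation in the product is by the start \<open>e\<close> of the second
  arrow, which leaves normal paths alone. So the product is a concatenation in which only the second
  path is moved, to begin at \<open>g\<close>.\<close>

lemma star_mult_hclass:
  assumes e: "e \<in> ET" and xs: "npath e xs g" and ys: "npath e ys h"
  shows "hclass Sq e xs g \<otimes>\<^bsub>St e\<^esub> hclass Sq e ys h = hclass Sq e (xs @ lmap g ys) (g \<cdot> h)"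
proof -
  note p = npath_path[OF xs] npath_path[OF ys] and ec = T.idems_closed[OF e]
  have ge: "g \<cdot> e = g" and gc: "g \<in> TC"
    using ker_right[OF e npath_end(2,3)[OF xs]] npath_end[OF xs] by auto
  have "edge_path Sq g (lmap g ys) (g \<cdot> h)" using lmap_path[OF gc p(2)] ge by simp
  then show ?thesis
    using right_act_hclass[OF ec p(1)] left_act_hclass[OF gc p(2)] T.idems_idem[OF e] rmap_npath[OF xs]
      gcomp_hclass[OF p(1)] ge
    by (simp add: star_mult_eq star_mult_def gdom_hclass[OF p(2)] gran_hclass[OF p(1)])
qed

lemma npath_Nil: "e \<in> ET \<Longrightarrow> npath e [] e"
  using T.idems_closed by (simp add: npath_def squier_simps)

text \<open>The reversed path runs from \<open>g\<close> to \<open>e\<close>; translated by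
  \<open>g^-1\<close> it starts at \<open>e\<close>, as an element of the star has to.\<close>

lemma npath_inverse:
  assumes e: "e \<in> ET" and xs: "npath e xs g"
  shows "npath e (lmap (g\<star>) (path_inv xs)) (g\<star>)"
proof -
  note g = npath_end(2,3)[OF xs]
  note k = ker_domain[OF e g] ker_left[OF e _ ker_psi_sinv[OF e g]] ker_right[OF e _ ker_psi_sinv[OF e g]]
  have gc: "g\<star> \<in> TC" using g by simp
  have "edge_path Sq e (lmap (g\<star>) (path_inv xs)) (g\<star>)"
    using lmap_path[OF gc edge_path_inv[OF npath_path[OF xs]]] k gc by simp
  moreover have "nf e (lmap (g\<star>) (path_inv xs))"
  proof -
    have "nf e (path_inv xs)" using xs by (simp add: npath_def)
    then show ?thesis
      using k gc squier_path_edges[OF edge_path_inv[OF npath_path[OF xs]]] T.idems_closed[OF e]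
      by (fastforce simp: nf_def lmap_def simp flip: T.m_assoc)
  qed
  ultimately show ?thesis by (simp add: npath_def)
qed

lemma star_inverse:
  assumes e: "e \<in> ET" and xs: "npath e xs g"
  shows "hclass Sq e (lmap (g\<star>) (path_inv xs)) (g\<star>) \<otimes>\<^bsub>St e\<^esub> hclass Sq e xs g = \<one>\<^bsub>St e\<^esub>"
proof -
  note g = npath_end(2,3)[OF xs]
  have gc: "g\<star> \<in> TC" using g by simp
  have "homotopic Sq g g (path_inv xs @ xs) []"
    by (rule homotopic_inv_left[OF npath_path[OF xs]])
  then have "homotopic Sq (g\<star> \<cdot> g) (g\<star> \<cdot> g) (lmap (g\<star>) (path_inv xs @ xs)) (lmap (g\<star>) [])"
    by (rule lmap_homotopic[OF gc])
  then have "homotopic Sq e e (lmap (g\<star>) (path_inv xs) @ lmap (g\<star>) xs) []"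
    by (simp add: ker_domain[OF e g])
  then show ?thesis
    by (simp add: star_mult_hclass[OF e npath_inverse[OF e xs] xs] star_one ker_domain[OF e g] hclass_eqI)
qed

lemma star_group_group:
  assumes e: "e \<in> ET"
  shows "group (St e)"
proof (rule groupI)
  show "\<one>\<^bsub>St e\<^esub> \<in> carrier (St e)"
    unfolding star_one by (rule star_carrierI[OF e npath_Nil[OF e]])
  fix \<alpha> assume "\<alpha> \<in> carrier (St e)"
  then obtain xs g where xs: "npath e xs g" "\<alpha> = hclass Sq e xs g" using star_carrierE[OF e] by metis
  show "\<one>\<^bsub>St e\<^esub> \<otimes>\<^bsub>St e\<^esub> \<alpha> = \<alpha>"
    using star_mult_hclass[OF e npath_Nil[OF e] xs(1)] lmap_npath[OF xs(1)] ker_left[OF e npath_end(2,3)[OF xs(1)]]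
    by (simp add: star_one xs(2))
  show "\<exists>\<beta>\<in>carrier (St e). \<beta> \<otimes>\<^bsub>St e\<^esub> \<alpha> = \<one>\<^bsub>St e\<^esub>"
    using star_inverse[OF e xs(1)] star_carrierI[OF e npath_inverse[OF e xs(1)]] xs(2) by blast
  fix \<beta> assume "\<beta> \<in> carrier (St e)"
  then obtain ys h where ys: "npath e ys h" "\<beta> = hclass Sq e ys h" using star_carrierE[OF e] by metis
  show "\<alpha> \<otimes>\<^bsub>St e\<^esub> \<beta> \<in> carrier (St e)"
    using star_carrierI[OF e npath_mult[OF e xs(1) ys(1)]]
    by (simp add: xs(2) ys(2) star_mult_hclass[OF e xs(1) ys(1)])
  fix \<gamma> assume "\<gamma> \<in> carrier (St e)"
  then obtain zs k where zs: "npath e zs k" "\<gamma> = hclass Sq e zs k" using star_carrierE[OF e] by metis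
  have c: "g \<in> TC" "h \<in> TC" "k \<in> TC" using npath_end xs(1) ys(1) zs(1) by blast+
  show "\<alpha> \<otimes>\<^bsub>St e\<^esub> \<beta> \<otimes>\<^bsub>St e\<^esub> \<gamma> = \<alpha> \<otimes>\<^bsub>St e\<^esub> (\<beta> \<otimes>\<^bsub>St e\<^esub> \<gamma>)"
    using c by (simp add: xs(2) ys(2) zs(2) star_mult_hclass[OF e] npath_mult[OF e] xs(1) ys(1) zs(1)
        lmap_lmap[OF npath_path[OF zs(1)]] T.m_assoc)
qed

lemma gran_npath: "npath e xs g \<Longrightarrow> gran (hclass Sq e xs g) = g"
  by (rule gran_hclass[OF npath_path])

lemma gran_star:
  assumes e: "e \<in> ET" and \<alpha>: "\<alpha> \<in> carrier (St e)"
  shows "gran \<alpha> \<in> TC" "\<psi> (gran \<alpha>) = \<psi> e"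
proof -
  obtain xs g where "npath e xs g" "\<alpha> = hclass Sq e xs g" using star_carrierE[OF e \<alpha>] .
  then show "gran \<alpha> \<in> TC" "\<psi> (gran \<alpha>) = \<psi> e" by (simp_all add: gran_npath npath_end)
qed

lemma gran_mult:
  assumes e: "e \<in> ET" and \<alpha>: "\<alpha> \<in> carrier (St e)" and \<beta>: "\<beta> \<in> carrier (St e)"
  shows "gran (\<alpha> \<otimes>\<^bsub>St e\<^esub> \<beta>) = gran \<alpha> \<cdot> gran \<beta>"
proof -
  obtain xs g where xs: "npath e xs g" "\<alpha> = hclass Sq e xs g" using star_carrierE[OF e \<alpha>] .
  obtain ys h where ys: "npath e ys h" "\<beta> = hclass Sq e ys h" using star_carrierE[OF e \<beta>] .
  show ?thesis
    by (simp add: xs ys star_mult_hclass[OF e xs(1) ys(1)] gran_npath gran_npath[OF npath_mult[OF e xs(1) ys(1)]])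
qed

text \<open>A path from \<open>e\<close> to \<open>k\<close> exists by connectivity and is then made
  normal.\<close>

lemma gran_surj:
  assumes e: "e \<in> ET" and k: "k \<in> TC" "\<psi> k = \<psi> e"
  obtains \<alpha> where "\<alpha> \<in> carrier (St e)" "gran \<alpha> = k"
proof -
  note ec = T.idems_closed[OF e]
  obtain xs where p: "edge_path Sq e xs k" using squier_connected[OF ec k(1)] k(2) by metis
  have "edge_path Sq (e \<cdot> e \<cdot> e) (rmap e (lmap e xs)) (e \<cdot> k \<cdot> e)"
    by (rule rmap_path[OF ec lmap_path[OF ec p]])
  then have "npath e (rmap e (lmap e xs)) k"
    using nf_lmap_rmap[OF p e] T.idems_idem[OF e] ker_left[OF e k] ker_right[OF e k] by (simp add: npath_def)
  then show ?thesis using that star_carrierI[OF e] gran_hclass[OF npath_path] by metis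
qed

section \<open>Conjugation by elements of \<open>T\<close>\<close>

lemma npath_cmap:
  assumes e: "e \<in> ET" and t [simp]: "t \<in> TC" and xs: "npath e xs g"
  shows "npath (t\<star> \<cdot> e \<cdot> t) (cmap t xs) (t\<star> \<cdot> g \<cdot> t)"
proof -
  note [simp] = T.idems_closed[OF e]
  have "edge_path Sq (t\<star> \<cdot> e \<cdot> t) (cmap t xs) (t\<star> \<cdot> g \<cdot> t)"
    unfolding cmap_def by (intro rmap_path lmap_path npath_path[OF xs]) simp_all
  moreover have "(t\<star> \<cdot> e \<cdot> t) \<cdot> (t\<star> \<cdot> p) = t\<star> \<cdot> p \<and> (q \<cdot> t) \<cdot> (t\<star> \<cdot> e \<cdot> t) = q \<cdot> t"
    if "p \<in> TC" "q \<in> TC" "e \<cdot> p = p" "q \<cdot> e = q" for p q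
  proof
    have "(t\<star> \<cdot> e \<cdot> t) \<cdot> (t\<star> \<cdot> p) = t\<star> \<cdot> (e \<cdot> ((t \<cdot> t\<star>) \<cdot> p))" using that by (simp add: T.m_assoc)
    also have "\<dots> = t\<star> \<cdot> ((t \<cdot> t\<star>) \<cdot> (e \<cdot> p))" using that e T.idem_left_comm[of e "t \<cdot> t\<star>" p] by simp
    finally show "(t\<star> \<cdot> e \<cdot> t) \<cdot> (t\<star> \<cdot> p) = t\<star> \<cdot> p" using that by (simp add: T.inv_simps)
    have "(q \<cdot> t) \<cdot> (t\<star> \<cdot> e \<cdot> t) = q \<cdot> (e \<cdot> t)"
      unfolding T.idem_mult_shift[OF e t] using that by (simp add: T.m_assoc)
    then show "(q \<cdot> t) \<cdot> (t\<star> \<cdot> e \<cdot> t) = q \<cdot> t" using that by (simp flip: T.m_assoc)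
  qed
  note fixed = this
  have "nf (t\<star> \<cdot> e \<cdot> t) (cmap t xs)"
    unfolding cmap_def nf_rmap_lmap
  proof (rule ballI)
    fix x assume x: "x \<in> set xs"
    obtain p l r q b where d: "x = ((p, l, r, q), b)" by (metis surj_pair)
    show "(\<lambda>((p, l, r, q), b). (t\<star> \<cdot> e \<cdot> t) \<cdot> (t\<star> \<cdot> p) = t\<star> \<cdot> p
        \<and> (q \<cdot> t) \<cdot> (t\<star> \<cdot> e \<cdot> t) = q \<cdot> t) x"
      using fixed[of p q] squier_path_edges[OF npath_path[OF xs]] nfD[of e xs] x xs
      unfolding d npath_def by auto
  qed
  ultimately show ?thesis by (simp add: npath_def)
qed

lemma act_hclass:
  assumes t: "t \<in> TC" and xs: "npath e xs g"
  shows "act t (hclass Sq e xs g) = hclass Sq (t\<star> \<cdot> e \<cdot> t) (cmap t xs) (t\<star> \<cdot> g \<cdot> t)"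
  using left_act_hclass[OF _ npath_path[OF xs], of "t\<star>"] right_act_hclass[OF t lmap_path[OF _ npath_path[OF xs], of "t\<star>"]] t
  by (simp add: act_def cmap_def)

lemma
  assumes e: "e \<in> ET" and t: "t \<in> TC" and \<alpha>: "\<alpha> \<in> carrier (St e)"
  shows act_closed: "act t \<alpha> \<in> carrier (St (t\<star> \<cdot> e \<cdot> t))"
    and gran_act: "gran (act t \<alpha>) = t\<star> \<cdot> gran \<alpha> \<cdot> t"
proof -
  obtain xs g where xs: "npath e xs g" "\<alpha> = hclass Sq e xs g" using star_carrierE[OF e \<alpha>] .
  note n = npath_cmap[OF e t xs(1)]
  show "act t \<alpha> \<in> carrier (St (t\<star> \<cdot> e \<cdot> t))"
    using star_carrierI[OF T.conj_idem[OF e t] n] by (simp add: xs act_hclass[OF t])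
  show "gran (act t \<alpha>) = t\<star> \<cdot> gran \<alpha> \<cdot> t"
    by (simp add: xs act_hclass[OF t] gran_npath gran_npath[OF n])
qed

lemma act_mult:
  assumes e: "e \<in> ET" and t: "t \<in> TC" and u: "u \<in> TC" and \<alpha>: "\<alpha> \<in> carrier (St e)"
  shows "act (t \<cdot> u) \<alpha> = act u (act t \<alpha>)"
proof -
  obtain xs g where xs: "npath e xs g" "\<alpha> = hclass Sq e xs g" using star_carrierE[OF e \<alpha>] .
  note p = npath_path[OF xs(1)] and c = t u npath_end[OF xs(1)]
  have "cmap u (cmap t xs) = rmap u (rmap t (lmap (u\<star>) (lmap (t\<star>) xs)))"
    by (simp add: cmap_def lmap_rmap)
  also have "\<dots> = rmap (t \<cdot> u) (lmap ((t \<cdot> u)\<star>) xs)"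
    using c by (simp add: lmap_lmap[OF p] T.sinv_mult rmap_rmap[OF lmap_path[OF _ p]])
  finally have 1: "cmap u (cmap t xs) = cmap (t \<cdot> u) xs" by (simp add: cmap_def)
  have 2: "u\<star> \<cdot> (t\<star> \<cdot> x \<cdot> t) \<cdot> u = (t \<cdot> u)\<star> \<cdot> x \<cdot> (t \<cdot> u)" if "x \<in> TC" for x
    using that t u by (simp add: T.sinv_mult T.m_assoc)
  show ?thesis
    unfolding xs(2) act_hclass[OF t xs(1)] act_hclass[OF T.m_closed[OF t u] xs(1)]
      act_hclass[OF u npath_cmap[OF e t xs(1)]] 1 2[OF npath_end(1)[OF xs(1)]] 2[OF npath_end(2)[OF xs(1)]] ..
qed

lemma act_self:
  assumes e: "e \<in> ET" and \<alpha>: "\<alpha> \<in> carrier (St e)"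
  shows "act e \<alpha> = \<alpha>"
proof -
  obtain xs g where xs: "npath e xs g" "\<alpha> = hclass Sq e xs g" using star_carrierE[OF e \<alpha>] .
  note g = npath_end(2,3)[OF xs(1)]
  show ?thesis
    using act_hclass[OF T.idems_closed[OF e] xs(1)] ker_left[OF e g] ker_right[OF e g] T.sinv_idem[OF e]
      T.idems_idem[OF e] lmap_npath[OF xs(1)] rmap_npath[OF xs(1)]
    by (simp add: xs(2) cmap_def)
qed

lemma act_hom:
  assumes e: "e \<in> ET" and t: "t \<in> TC"
  shows "act t \<in> hom (St e) (St (t\<star> \<cdot> e \<cdot> t))"
proof (rule homI)
  fix \<alpha> \<beta> assume \<alpha>: "\<alpha> \<in> carrier (St e)" and \<beta>: "\<beta> \<in> carrier (St e)"
  show "act t \<alpha> \<in> carrier (St (t\<star> \<cdot> e \<cdot> t))" by (rule act_closed[OF e t \<alpha>])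
  obtain xs g where xs: "npath e xs g" "\<alpha> = hclass Sq e xs g" using star_carrierE[OF e \<alpha>] .
  obtain ys h where ys: "npath e ys h" "\<beta> = hclass Sq e ys h" using star_carrierE[OF e \<beta>] .
  note [simp] = t npath_end[OF xs(1)] npath_end[OF ys(1)]
  have f: "t\<star> \<cdot> e \<cdot> t \<in> ET" by (rule T.conj_idem[OF e t])
  \<comment> \<open>A product of conjugates has \<open>t t^-1\<close> in its middle. Since
    \<open>g\<close> lies in the kernel it commutes with this idempotent, which is then absorbed by
    \<open>t^-1\<close>.\<close>
  have gtt: "g \<cdot> (t \<cdot> t\<star>) = (t \<cdot> t\<star>) \<cdot> g"
    using psi_idem[OF e] by (intro kernel_comm_idem) auto
  have tg: "t\<star> \<cdot> g \<cdot> t \<cdot> t\<star> = t\<star> \<cdot> g"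
  proof -
    have "t\<star> \<cdot> g \<cdot> t \<cdot> t\<star> = t\<star> \<cdot> (g \<cdot> (t \<cdot> t\<star>))" by (simp add: T.m_assoc)
    then show ?thesis unfolding gtt by (simp add: T.inv_simps)
  qed
  have "lmap (t\<star> \<cdot> g \<cdot> t) (cmap t ys) = rmap t (lmap (t\<star> \<cdot> g \<cdot> t) (lmap (t\<star>) ys))"
    by (simp add: cmap_def lmap_rmap)
  also have "\<dots> = rmap t (lmap (t\<star> \<cdot> g) ys)" by (simp add: lmap_lmap[OF npath_path[OF ys(1)]] tg)
  also have "\<dots> = cmap t (lmap g ys)" by (simp add: cmap_def lmap_lmap[OF npath_path[OF ys(1)]])
  finally have eq: "cmap t xs @ lmap (t\<star> \<cdot> g \<cdot> t) (cmap t ys) = cmap t (xs @ lmap g ys)"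
    by (simp add: cmap_def)
  have "(t\<star> \<cdot> g \<cdot> t) \<cdot> (t\<star> \<cdot> h \<cdot> t) = (t\<star> \<cdot> g \<cdot> t \<cdot> t\<star>) \<cdot> (h \<cdot> t)" by (simp add: T.m_assoc)
  also have "\<dots> = t\<star> \<cdot> (g \<cdot> h) \<cdot> t" unfolding tg by (simp add: T.m_assoc)
  finally have gh: "(t\<star> \<cdot> g \<cdot> t) \<cdot> (t\<star> \<cdot> h \<cdot> t) = t\<star> \<cdot> (g \<cdot> h) \<cdot> t" .
  show "act t (\<alpha> \<otimes>\<^bsub>St e\<^esub> \<beta>) = act t \<alpha> \<otimes>\<^bsub>St (t\<star> \<cdot> e \<cdot> t)\<^esub> act t \<beta>"
    unfolding xs(2) ys(2) star_mult_hclass[OF e xs(1) ys(1)] act_hclass[OF t xs(1)] act_hclass[OF t ys(1)]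
      act_hclass[OF t npath_mult[OF e xs(1) ys(1)]]
      star_mult_hclass[OF f npath_cmap[OF e t xs(1)] npath_cmap[OF e t ys(1)]] eq gh ..
qed

text \<open>By interchange the product is also represented by \<open>ys\<close> followed by
  \<open>xs\<close> translated on the right by \<open>h\<close>. That translate equals the left
  translate by \<open>h\<close> of \<open>xs\<close> conjugated by \<open>h\<close>, so the same
  path is a product in the opposite order.\<close>

lemma star_peiffer:
  assumes e: "e \<in> ET" and \<alpha>: "\<alpha> \<in> carrier (St e)" and \<beta>: "\<beta> \<in> carrier (St e)"
  shows "\<alpha> \<otimes>\<^bsub>St e\<^esub> \<beta> = \<beta> \<otimes>\<^bsub>St e\<^esub> act (gran \<beta>) \<alpha>"
proof -
  obtain xs g where xs: "npath e xs g" "\<alpha> = hclass Sq e xs g" using star_carrierE[OF e \<alpha>] .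
  obtain ys h where ys: "npath e ys h" "\<beta> = hclass Sq e ys h" using star_carrierE[OF e \<beta>] .
  note px = npath_path[OF xs(1)] and py = npath_path[OF ys(1)]
  note [simp] = npath_end(1,2)[OF xs(1)] npath_end(2)[OF ys(1)]
  note g = npath_end(2,3)[OF xs(1)] and h = npath_end(2,3)[OF ys(1)]
  have he: "h\<star> \<cdot> e \<cdot> h = e" using ker_left[OF e h] ker_domain[OF e h] by (simp add: T.m_assoc)
  have gr: "gran \<beta> = h" using gran_hclass[OF py] ys(2) by simp
  have "homotopic Sq (e \<cdot> e) (g \<cdot> h) (rmap e xs @ lmap g ys) (lmap e ys @ rmap h xs)"
    by (rule interchange[OF px py])
  then have 1: "homotopic Sq e (g \<cdot> h) (xs @ lmap g ys) (ys @ rmap h xs)"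
    using T.idems_idem[OF e] lmap_npath[OF ys(1)] rmap_npath[OF xs(1)] by simp
  have "lmap h (cmap h xs) = rmap h (lmap h (lmap (h\<star>) xs))" by (simp add: cmap_def lmap_rmap)
  also have "\<dots> = rmap h xs" using ker_range[OF e h] lmap_npath[OF xs(1)] by (simp add: lmap_lmap[OF px])
  finally have 2: "lmap h (cmap h xs) = rmap h xs" .
  have "h \<cdot> (h\<star> \<cdot> g \<cdot> h) = (h \<cdot> h\<star>) \<cdot> g \<cdot> h" by (simp add: T.m_assoc)
  then have 3: "h \<cdot> (h\<star> \<cdot> g \<cdot> h) = g \<cdot> h" using ker_range[OF e h] ker_left[OF e g] by simp
  have n: "npath e (cmap h xs) (h\<star> \<cdot> g \<cdot> h)" using npath_cmap[OF e h(1) xs(1)] he by simp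
  have a: "act h \<alpha> = hclass Sq e (cmap h xs) (h\<star> \<cdot> g \<cdot> h)"
    using act_hclass[OF h(1) xs(1)] he xs(2) by simp
  show ?thesis
    unfolding gr a unfolding xs(2) ys(2) star_mult_hclass[OF e xs(1) ys(1)] star_mult_hclass[OF e ys(1) n] 2 3
    by (rule hclass_eqI[OF 1])
qed

text \<open>The quotient of \<open>t\<close> and \<open>u\<close> inside \<open>T\<close> is an
  element of the kernel. It is the range of some \<open>\<beta>\<close>, and the Peiffer identity
  converts the action of that range into conjugation by \<open>\<beta>\<close>.\<close>

lemma act_inner:
  assumes e: "e \<in> ET" and t: "t \<in> TC" and u: "u \<in> TC" and tu: "\<psi> t = \<psi> u" and \<alpha>: "\<alpha> \<in> carrier (St e)"
  shows "\<exists>\<beta>\<in>carrier (St (t\<star> \<cdot> e \<cdot> t)). act t \<alpha> \<otimes>\<^bsub>St (t\<star> \<cdot> e \<cdot> t)\<^esub> \<beta> = \<beta> \<otimes>\<^bsub>St (t\<star> \<cdot> e \<cdot> t)\<^esub> act u \<alpha>"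
proof -
  note ec = T.idems_closed[OF e]
  have f: "t\<star> \<cdot> e \<cdot> t \<in> ET" by (rule T.conj_idem[OF e t])
  \<comment> \<open>The correcting element is chosen so that \<open>t\<close> times it is
    \<open>e u\<close>, and \<open>e u\<close> acts on the star at \<open>e\<close> as
    \<open>u\<close> does.\<close>
  have k: "t\<star> \<cdot> e \<cdot> u \<in> TC" "\<psi> (t\<star> \<cdot> e \<cdot> u) = \<psi> (t\<star> \<cdot> e \<cdot> t)"
    using t u ec tu by (simp_all add: psi_mult)
  obtain \<beta> where \<beta>: "\<beta> \<in> carrier (St (t\<star> \<cdot> e \<cdot> t))" "gran \<beta> = t\<star> \<cdot> e \<cdot> u" using gran_surj[OF f k] .
  have "t \<cdot> (t\<star> \<cdot> e \<cdot> u) = (t \<cdot> t\<star>) \<cdot> (e \<cdot> u)" using t u ec by (simp add: T.m_assoc)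
  also have "\<dots> = e \<cdot> ((t \<cdot> t\<star>) \<cdot> u)" by (rule T.idem_left_comm[OF T.range_idem[OF t] e u])
  also have "\<dots> = e \<cdot> ((u \<cdot> u\<star>) \<cdot> u)" unfolding psi_eq_imp_range_eq(1)[OF t u tu] ..
  finally have tk: "t \<cdot> (t\<star> \<cdot> e \<cdot> u) = e \<cdot> u" using u by (simp add: T.inv_simps)
  have "act u \<alpha> = act (e \<cdot> u) \<alpha>" using act_mult[OF e ec u \<alpha>] act_self[OF e \<alpha>] by simp
  also have "\<dots> = act (t\<star> \<cdot> e \<cdot> u) (act t \<alpha>)" using act_mult[OF e t k(1) \<alpha>] tk by simp
  finally show ?thesis using star_peiffer[OF f act_closed[OF e t \<alpha>] \<beta>(1)] \<beta> by auto
qed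

end


section \<open>Abelianising a crossed system\<close>

text \<open>What the groups \<open>K_e\<close> and the star groups have in common: \<open>T\<close>
  acts by homomorphisms, and the action depends on the image in \<open>M\<close> up to conjugation.
  This is enough for their abelianisations to form a module over \<open>M\<close>.\<close>

locale crossed_system = presentation X R
  for X :: "'x set" and R +
  fixes G :: "'x word set set \<Rightarrow> 'g monoid" and c :: "'x word set set \<Rightarrow> 'g \<Rightarrow> 'g"
  assumes G_group: "e \<in> EM \<Longrightarrow> group (G e)"
    and c_hom: "\<lbrakk>e \<in> EM; t \<in> TC\<rbrakk> \<Longrightarrow> c t \<in> hom (G e) (G ((\<psi> t)\<diamond> \<bullet> e \<bullet> \<psi> t))"
    and c_mult: "\<lbrakk>e \<in> EM; t \<in> TC; u \<in> TC; a \<in> carrier (G e)\<rbrakk> \<Longrightarrow> c (t \<cdot> u) a = c u (c t a)"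
    and c_lift: "\<lbrakk>e \<in> EM; a \<in> carrier (G e)\<rbrakk> \<Longrightarrow> c (lft e) a = a"
    and c_inner: "\<lbrakk>e \<in> EM; t \<in> TC; u \<in> TC; \<psi> t = \<psi> u; a \<in> carrier (G e)\<rbrakk>
      \<Longrightarrow> \<exists>b\<in>carrier (G ((\<psi> t)\<diamond> \<bullet> e \<bullet> \<psi> t)).
            c t a \<otimes>\<^bsub>G ((\<psi> t)\<diamond> \<bullet> e \<bullet> \<psi> t)\<^esub> b = b \<otimes>\<^bsub>G ((\<psi> t)\<diamond> \<bullet> e \<bullet> \<psi> t)\<^esub> c u a"
begin

definition ab_act where
  "ab_act e m k = the_elem ((\<lambda>(t, a). ab_class (G (m\<diamond> \<bullet> e \<bullet> m)) (c t a)) ` ({t \<in> TC. \<psi> t = m} \<times> k))"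

lemma c_group_hom: "\<lbrakk>e \<in> EM; t \<in> TC\<rbrakk> \<Longrightarrow> group_hom (G e) (G ((\<psi> t)\<diamond> \<bullet> e \<bullet> \<psi> t)) (c t)"
  using G_group c_hom M.conj_idem by (simp add: group_hom_def group_hom_axioms_def)

lemma c_closed: "\<lbrakk>e \<in> EM; t \<in> TC; a \<in> carrier (G e)\<rbrakk> \<Longrightarrow> c t a \<in> carrier (G ((\<psi> t)\<diamond> \<bullet> e \<bullet> \<psi> t))"
  using hom_in_carrier[OF c_hom] by blast

text \<open>Two choices enter the value. Another preimage changes it by a conjugation, by
  \<open>c_inner\<close>; another representative of the class changes it within the derived
  subgroup, since \<open>c t\<close> is a homomorphism.\<close>

lemma ab_act_class:
  assumes e: "e \<in> EM" and t: "t \<in> TC" and a: "a \<in> carrier (G e)"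
  shows "ab_act e (\<psi> t) (ab_class (G e) a) = ab_class (G ((\<psi> t)\<diamond> \<bullet> e \<bullet> \<psi> t)) (c t a)"
  unfolding ab_act_def
proof (rule the_elem_const)
  let ?G = "G ((\<psi> t)\<diamond> \<bullet> e \<bullet> \<psi> t)"
  interpret e: group "G e" by (rule G_group[OF e])
  show "{u \<in> TC. \<psi> u = \<psi> t} \<times> ab_class (G e) a \<noteq> {}" using t e.ab_class_self[OF a] by auto
  fix z assume "z \<in> {u \<in> TC. \<psi> u = \<psi> t} \<times> ab_class (G e) a"
  then obtain u b where z: "z = (u, b)" "u \<in> TC" "\<psi> u = \<psi> t" "b \<in> ab_class (G e) a" by auto
  have b: "b \<in> carrier (G e)" "ab_class (G e) b = ab_class (G e) a" using e.ab_class_eqI[OF z(4) a] .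
  have f: "(\<psi> t)\<diamond> \<bullet> e \<bullet> \<psi> t \<in> EM" using e t M.conj_idem by simp
  obtain k where k: "k \<in> carrier ?G" "c t b \<otimes>\<^bsub>?G\<^esub> k = k \<otimes>\<^bsub>?G\<^esub> c u b"
    using c_inner[OF e t z(2) z(3)[symmetric] b(1)] by blast
  have "c u b \<in> carrier ?G" using c_closed[OF e z(2) b(1)] unfolding z(3) .
  then have "ab_class ?G (c u b) = ab_class ?G (c t b)"
    by (rule group.ab_class_conj[OF G_group[OF f] c_closed[OF e t b(1)] k(1) _ k(2)])
  also have "\<dots> = ab_class ?G (c t a)"
    by (rule group_hom.ab_class_cong[OF c_group_hom[OF e t] b(1) a b(2)])
  finally show "(case z of (t', a) \<Rightarrow> ab_class ?G (c t' a)) = ab_class ?G (c t a)" by (simp add: z(1))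
qed

lemma ab_lausch_action:
  assumes lcomp: "\<And>e. e \<in> EM \<Longrightarrow> lcomp A e = abelianisation (G e)"
    and lres: "\<And>e f k. \<lbrakk>e \<in> EM; f \<in> EM\<rbrakk> \<Longrightarrow> lres A e f k = the_elem ((\<lambda>a. ab_class (G f) (c (lft f) a)) ` k)"
    and lact: "\<And>e m k. \<lbrakk>e \<in> EM; m \<in> MC\<rbrakk> \<Longrightarrow> lact A (e, k) m = (m\<diamond> \<bullet> e \<bullet> m, ab_act e m k)"
  shows "lausch_action (Mon X R) A ab_act"
proof -
  have abE: "\<exists>a. a \<in> carrier (G e) \<and> k = ab_class (G e) a" if "e \<in> EM" "k \<in> carrier (lcomp A e)" for e k
    using that(2) unfolding lcomp[OF that(1)]
    by (rule group.ab_carrierE[OF G_group[OF that(1)]]) blast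
  show ?thesis
  proof (intro lausch_action.intro lausch_action_axioms.intro M.inverse_monoid_axioms)
    fix e assume e: "e \<in> EM"
    interpret e: group "G e" by (rule G_group[OF e])
    show "comm_group (lcomp A e)" using e e.ab_comm_group by (simp add: lcomp)
    show "ab_act e e k = k" if k: "k \<in> carrier (lcomp A e)" for k
    proof -
      obtain a where a: "a \<in> carrier (G e)" "k = ab_class (G e) a"
        using abE[OF e k] by blast
      then show ?thesis
        using ab_act_class[OF e lift_closed[OF e] a(1)] e c_lift
        by (simp add: M.sinv_idem M.idems_idem)
    qed
    fix m assume m: "m \<in> MC"
    obtain t where t: "t \<in> TC" "\<psi> t = m" using psi_surj[OF m] .
    have f: "m\<diamond> \<bullet> e \<bullet> m \<in> EM" by (rule M.conj_idem[OF e m])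
    interpret f: group "G (m\<diamond> \<bullet> e \<bullet> m)" by (rule G_group[OF f])
    have cl: "ab_act e m (ab_class (G e) a) = ab_class (G (m\<diamond> \<bullet> e \<bullet> m)) (c t a)" if "a \<in> carrier (G e)" for a
      using ab_act_class[OF e t(1) that] t(2) by simp
    have cc: "c t a \<in> carrier (G (m\<diamond> \<bullet> e \<bullet> m))" if "a \<in> carrier (G e)" for a
      using c_closed[OF e t(1) that] t(2) by simp
    have cm: "c t (a \<otimes>\<^bsub>G e\<^esub> b) = c t a \<otimes>\<^bsub>G (m\<diamond> \<bullet> e \<bullet> m)\<^esub> c t b"
      if "a \<in> carrier (G e)" "b \<in> carrier (G e)" for a b
      using hom_mult[OF c_hom[OF e t(1)] that] t(2) by simp
    show "ab_act e m \<in> hom (lcomp A e) (lcomp A (m\<diamond> \<bullet> e \<bullet> m))"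
    proof (rule homI)
      fix k assume "k \<in> carrier (lcomp A e)"
      then obtain a where a: "a \<in> carrier (G e)" "k = ab_class (G e) a" using abE[OF e] by blast
      then show "ab_act e m k \<in> carrier (lcomp A (m\<diamond> \<bullet> e \<bullet> m))"
        using f.ab_class_closed[OF cc[OF a(1)]] by (simp add: cl lcomp f)
      fix k' assume "k' \<in> carrier (lcomp A e)"
      then obtain b where b: "b \<in> carrier (G e)" "k' = ab_class (G e) b" using abE[OF e] by blast
      show "ab_act e m (k \<otimes>\<^bsub>lcomp A e\<^esub> k') = ab_act e m k \<otimes>\<^bsub>lcomp A (m\<diamond> \<bullet> e \<bullet> m)\<^esub> ab_act e m k'"
        using a b by (simp add: lcomp e f cl cc cm flip: e.ab_class_mult f.ab_class_mult)
    qed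
    show "ab_act e (m \<bullet> n) k = ab_act (m\<diamond> \<bullet> e \<bullet> m) n (ab_act e m k)"
      if n: "n \<in> MC" and k: "k \<in> carrier (lcomp A e)" for n k
    proof -
      obtain a where a: "a \<in> carrier (G e)" "k = ab_class (G e) a" using abE[OF e k] by blast
      obtain u where u: "u \<in> TC" "\<psi> u = n" using psi_surj[OF n] .
      have idem: "(m \<bullet> n)\<diamond> \<bullet> e \<bullet> (m \<bullet> n) = n\<diamond> \<bullet> (m\<diamond> \<bullet> e \<bullet> m) \<bullet> n"
        using m n M.idems_closed[OF e] by (simp add: M.sinv_mult M.m_assoc)
      have "ab_act e (m \<bullet> n) k = ab_class (G ((m \<bullet> n)\<diamond> \<bullet> e \<bullet> (m \<bullet> n))) (c (t \<cdot> u) a)"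
        using ab_act_class[OF e, of "t \<cdot> u" a] t u a by (simp add: psi_mult)
      also have "\<dots> = ab_act (m\<diamond> \<bullet> e \<bullet> m) n (ab_act e m k)"
        using ab_act_class[OF f u(1) cc[OF a(1)]] c_mult[OF e t(1) u(1) a(1)] u(2) a
        by (simp only: idem cl)
      finally show ?thesis .
    qed
    show "lact A (e, k) m = (m\<diamond> \<bullet> e \<bullet> m, ab_act e m k)" for k using e m by (rule lact)
  next
    fix e f k assume e: "e \<in> EM" and f: "f \<in> EM" and fe: "f \<bullet> e = f" and "k \<in> carrier (lcomp A e)"
    interpret e: group "G e" by (rule G_group[OF e])
    obtain a where a: "a \<in> carrier (G e)" "k = ab_class (G e) a"
      using abE[OF e \<open>k \<in> carrier (lcomp A e)\<close>] by blast
    have fef: "f\<diamond> \<bullet> e \<bullet> f = f" using M.idem_comm[OF e f] fe f by (simp add: M.sinv_idem M.idems_idem)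
    have h: "group_hom (G e) (G f) (c (lft f))"
      using c_group_hom[OF e lift_closed[OF f]] by (simp only: psi_lift[OF f] fef)
    have "lres A e f k = ab_class (G f) (c (lft f) a)"
      unfolding lres[OF e f] a(2)
    proof (rule the_elem_const)
      show "ab_class (G e) a \<noteq> {}" using e.ab_class_self[OF a(1)] by auto
      fix b assume "b \<in> ab_class (G e) a"
      then show "ab_class (G f) (c (lft f) b) = ab_class (G f) (c (lft f) a)"
        using group_hom.ab_class_cong[OF h _ a(1)] e.ab_class_eqI[OF _ a(1)] by metis
    qed
    also have "\<dots> = ab_act e f k" using ab_act_class[OF e lift_closed[OF f] a(1)] fef f a(2) by simp
    finally show "lres A e f k = ab_act e f k" .
  qed
qed

end

section \<open>The exact sequence\<close>

context presentation
begin

lemma lift_conj: "\<lbrakk>e \<in> EM; t \<in> TC\<rbrakk> \<Longrightarrow> lft ((\<psi> t)\<diamond> \<bullet> e \<bullet> \<psi> t) = t\<star> \<cdot> lft e \<cdot> t"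
  by (rule lift_eqI) (auto intro!: T.conj_idem simp: psi_mult psi_sinv)

lemma K_crossed: "crossed_system X R (K_group X R) (\<lambda>t k. t\<star> \<cdot> k \<cdot> t)"
proof (intro crossed_system.intro crossed_system_axioms.intro presentation_axioms)
  fix e assume e: "e \<in> EM"
  show "group (K_group X R e)" by (rule K_group_group[OF e])
  fix t assume t [simp]: "t \<in> TC"
  have comm: "k \<cdot> (t \<cdot> t\<star>) = (t \<cdot> t\<star>) \<cdot> k" if "k \<in> carrier (K_group X R e)" for k
    using that e by (intro kernel_comm_idem) (auto simp: K_carrier)
  show "(\<lambda>k. t\<star> \<cdot> k \<cdot> t) \<in> hom (K_group X R e) (K_group X R ((\<psi> t)\<diamond> \<bullet> e \<bullet> \<psi> t))"
  proof (rule homI)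
    fix k k' assume k: "k \<in> carrier (K_group X R e)" and k': "k' \<in> carrier (K_group X R e)"
    then have c: "k \<in> TC" "k' \<in> TC" by (auto simp: K_carrier)
    have "(t\<star> \<cdot> k \<cdot> t) \<cdot> (t\<star> \<cdot> k' \<cdot> t) = t\<star> \<cdot> (k \<cdot> (t \<cdot> t\<star>)) \<cdot> k' \<cdot> t"
      using c by (simp add: T.m_assoc)
    also have "\<dots> = t\<star> \<cdot> (k \<cdot> k') \<cdot> t" unfolding comm[OF k] using c by (simp add: T.inv_simps)
    finally show "t\<star> \<cdot> (k \<otimes>\<^bsub>K_group X R e\<^esub> k') \<cdot> t
        = (t\<star> \<cdot> k \<cdot> t) \<otimes>\<^bsub>K_group X R ((\<psi> t)\<diamond> \<bullet> e \<bullet> \<psi> t)\<^esub> (t\<star> \<cdot> k' \<cdot> t)"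
      by (simp add: K_mult)
  qed (auto simp: K_carrier psi_mult psi_sinv)
  fix u k assume u [simp]: "u \<in> TC" and k: "k \<in> carrier (K_group X R e)"
  have [simp]: "k \<in> TC" and psi_k: "\<psi> k = e" using k by (auto simp: K_carrier)
  show "(t \<cdot> u)\<star> \<cdot> k \<cdot> (t \<cdot> u) = u\<star> \<cdot> (t\<star> \<cdot> k \<cdot> t) \<cdot> u" by (simp add: T.sinv_mult T.m_assoc)
  assume tu: "\<psi> t = \<psi> u"
  note lc = lift_closed[OF e]
  have lk: "lft e \<cdot> k = k" "k \<cdot> lft e = k" using kernel_left[of k] kernel_right[of k] psi_k e by auto
  \<comment> \<open>The conjugating element is \<open>t^-1 e u\<close>, as for the star groups. Both
    products with it reduce to \<open>t^-1 k u\<close>.\<close>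
  have "(t\<star> \<cdot> k \<cdot> t) \<cdot> (t\<star> \<cdot> lft e \<cdot> u) = t\<star> \<cdot> (k \<cdot> (t \<cdot> t\<star>)) \<cdot> lft e \<cdot> u"
    using lc by (simp add: T.m_assoc)
  also have "\<dots> = t\<star> \<cdot> (k \<cdot> lft e) \<cdot> u" unfolding comm[OF k] using lc by (simp add: T.inv_simps)
  finally have 1: "(t\<star> \<cdot> k \<cdot> t) \<cdot> (t\<star> \<cdot> lft e \<cdot> u) = t\<star> \<cdot> k \<cdot> u" by (simp add: lk)
  have "(t\<star> \<cdot> lft e \<cdot> u) \<cdot> (u\<star> \<cdot> k \<cdot> u) = t\<star> \<cdot> lft e \<cdot> ((u \<cdot> u\<star>) \<cdot> k) \<cdot> u"
    using lc by (simp add: T.m_assoc)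
  also have "(u \<cdot> u\<star>) \<cdot> k = k \<cdot> (u \<cdot> u\<star>)"
    using comm[OF k] psi_eq_imp_range_eq(1)[OF t u tu] by simp
  also have "t\<star> \<cdot> lft e \<cdot> (k \<cdot> (u \<cdot> u\<star>)) \<cdot> u = t\<star> \<cdot> (lft e \<cdot> k) \<cdot> u" using lc by (simp add: T.inv_simps)
  finally have 2: "(t\<star> \<cdot> lft e \<cdot> u) \<cdot> (u\<star> \<cdot> k \<cdot> u) = t\<star> \<cdot> k \<cdot> u" by (simp add: lk)
  show "\<exists>b\<in>carrier (K_group X R ((\<psi> t)\<diamond> \<bullet> e \<bullet> \<psi> t)).
      (t\<star> \<cdot> k \<cdot> t) \<otimes>\<^bsub>K_group X R ((\<psi> t)\<diamond> \<bullet> e \<bullet> \<psi> t)\<^esub> b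
        = b \<otimes>\<^bsub>K_group X R ((\<psi> t)\<diamond> \<bullet> e \<bullet> \<psi> t)\<^esub> (u\<star> \<cdot> k \<cdot> u)"
    using lc e tu 1 2
    by (intro bexI[of _ "t\<star> \<cdot> lft e \<cdot> u"]) (simp_all add: K_mult K_carrier psi_mult psi_sinv)
next
  fix e k assume e: "e \<in> EM" and k: "k \<in> carrier (K_group X R e)"
  then show "(lft e)\<star> \<cdot> k \<cdot> lft e = k"
    using kernel_left[of k] kernel_right[of k] by (auto simp: K_carrier T.sinv_idem)
qed

lemma star_crossed: "crossed_system X R (\<lambda>e. St (lft e)) act"
proof (intro crossed_system.intro crossed_system_axioms.intro presentation_axioms)
  fix e t u a assume e: "e \<in> EM" and t: "t \<in> TC" and u: "u \<in> TC" and tu: "\<psi> t = \<psi> u"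
    and a: "a \<in> carrier (St (lft e))"
  show "\<exists>b\<in>carrier (St (lft ((\<psi> t)\<diamond> \<bullet> e \<bullet> \<psi> t))).
      act t a \<otimes>\<^bsub>St (lft ((\<psi> t)\<diamond> \<bullet> e \<bullet> \<psi> t))\<^esub> b = b \<otimes>\<^bsub>St (lft ((\<psi> t)\<diamond> \<bullet> e \<bullet> \<psi> t))\<^esub> act u a"
    unfolding lift_conj[OF e t] by (rule act_inner[OF lift_ET[OF e] t u tu a])
qed (use act_mult[OF lift_ET] in \<open>simp_all add: lift_conj star_group_group act_hom act_self\<close>)

section \<open>The module structures on the three terms\<close>

interpretation K: crossed_system X R "K_group X R" "\<lambda>t k. t\<star> \<cdot> k \<cdot> t"
  by (rule K_crossed)

interpretation S: crossed_system X R "\<lambda>e. St (lft e)" act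
  by (rule star_crossed)

lemma relation_action: "lausch_action (Mon X R) (relation_module X R) K.ab_act"
  by (rule K.ab_lausch_action)
    (simp_all add: relation_module_def K.ab_act_def Let_def T.sinv_idem)

lemma star_ab_action: "lausch_action (Mon X R) (star_ab_module X R) S.ab_act"
  by (rule S.ab_lausch_action)
    (simp_all add: star_ab_module_def S.ab_act_def Let_def act_def T.sinv_idem)

lemma gran_hom: "e \<in> EM \<Longrightarrow> gran \<in> hom (St (lft e)) (K_group X R e)"
  using gran_star[OF lift_ET] gran_mult[OF lift_ET] by (intro homI) (simp_all add: K_carrier K_mult)

lemma gran_group_hom: "e \<in> EM \<Longrightarrow> group_hom (St (lft e)) (K_group X R e) gran"
  by (simp add: group_hom_def group_hom_axioms_def gran_hom star_group_group K_group_group)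

lemma gran_image: "e \<in> EM \<Longrightarrow> gran ` carrier (St (lft e)) = carrier (K_group X R e)"
proof (intro equalityI subsetI)
  fix k assume e: "e \<in> EM" and "k \<in> carrier (K_group X R e)"
  then have "k \<in> TC" "\<psi> k = \<psi> (lft e)" by (auto simp: K_carrier)
  then obtain \<alpha> where "\<alpha> \<in> carrier (St (lft e))" "gran \<alpha> = k" using gran_surj[OF lift_ET[OF e]] by blast
  then show "k \<in> gran ` carrier (St (lft e))" by blast
qed (use gran_star[OF lift_ET] in \<open>auto simp: K_carrier\<close>)

lemma pi_group_eq:
  "e \<in> EM \<Longrightarrow> pi_group X R (lft e)
    = (St (lft e))\<lparr>carrier := kernel (St (lft e)) (K_group X R e) gran\<rparr>"
  by (simp add: pi_group_def kernel_def K_one)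

lemma pi_carrier:
  "\<alpha> \<in> carrier (pi_group X R e) \<longleftrightarrow> \<alpha> \<in> carrier (St e) \<and> gran \<alpha> = e"
  by (simp add: pi_group_def)

lemma pi_mult: "\<alpha> \<otimes>\<^bsub>pi_group X R e\<^esub> \<beta> = \<alpha> \<otimes>\<^bsub>St e\<^esub> \<beta>"
  by (simp add: pi_group_def)

text \<open>In the Peiffer identity the second factor acts through its range, which here is
  \<open>e\<close> and acts trivially.\<close>

lemma pi_central:
  assumes e: "e \<in> ET" and \<alpha>: "\<alpha> \<in> carrier (pi_group X R e)" and \<beta>: "\<beta> \<in> carrier (St e)"
  shows "\<alpha> \<otimes>\<^bsub>St e\<^esub> \<beta> = \<beta> \<otimes>\<^bsub>St e\<^esub> \<alpha>"
  using star_peiffer[OF e \<beta>, of \<alpha>] \<alpha> act_self[OF e \<beta>] by (simp add: pi_carrier)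

lemma pi_comm_group: assumes e: "e \<in> EM" shows "comm_group (pi_group X R (lft e))"
proof -
  interpret g: group_hom "St (lft e)" "K_group X R e" gran by (rule gran_group_hom[OF e])
  have grp: "group (pi_group X R (lft e))"
    unfolding pi_group_eq[OF e] by (rule g.G.subgroup_imp_group[OF g.subgroup_kernel])
  show ?thesis
    by (rule group.group_comm_groupI[OF grp])
      (use pi_central[OF lift_ET[OF e]] in \<open>simp add: pi_carrier pi_mult\<close>)
qed

definition pi_act where
  "pi_act (e :: 'x word set set) m \<alpha> = the_elem ((\<lambda>t. act t \<alpha>) ` {t \<in> TC. \<psi> t = m})"

lemma pi_act_closed:
  assumes e: "e \<in> ET" and t: "t \<in> TC" and \<alpha>: "\<alpha> \<in> carrier (pi_group X R e)"
  shows "act t \<alpha> \<in> carrier (pi_group X R (t\<star> \<cdot> e \<cdot> t))"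
  using act_closed[OF e t] gran_act[OF e t] \<alpha> by (simp add: pi_carrier)

text \<open>Two preimages of the same element act by maps that differ by a conjugation, and this is
  trivial on central elements. So no abelianisation is required for \<open>M\<close> to act on these
  groups.\<close>

lemma pi_act_eq:
  assumes e: "e \<in> ET" and t: "t \<in> TC" and \<alpha>: "\<alpha> \<in> carrier (pi_group X R e)"
  shows "pi_act e' (\<psi> t) \<alpha> = act t \<alpha>"
  unfolding pi_act_def
proof (rule the_elem_const)
  show "{u \<in> TC. \<psi> u = \<psi> t} \<noteq> {}" using t by auto
  fix u assume "u \<in> {u \<in> TC. \<psi> u = \<psi> t}"
  then have u: "u \<in> TC" "\<psi> u = \<psi> t" by auto
  let ?S = "St (t\<star> \<cdot> e \<cdot> t)"
  have \<alpha>': "\<alpha> \<in> carrier (St e)" using \<alpha> by (simp add: pi_carrier)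
  have f: "t\<star> \<cdot> e \<cdot> t \<in> ET" by (rule T.conj_idem[OF e t])
  interpret S: group ?S by (rule star_group_group[OF f])
  obtain \<beta> where \<beta>: "\<beta> \<in> carrier ?S" "act t \<alpha> \<otimes>\<^bsub>?S\<^esub> \<beta> = \<beta> \<otimes>\<^bsub>?S\<^esub> act u \<alpha>"
    using act_inner[OF e t u(1) u(2)[symmetric] \<alpha>'] by blast
  have "\<beta> \<otimes>\<^bsub>?S\<^esub> act t \<alpha> = \<beta> \<otimes>\<^bsub>?S\<^esub> act u \<alpha>"
    using pi_central[OF f pi_act_closed[OF e t \<alpha>] \<beta>(1)] \<beta>(2) by simp
  moreover have "u\<star> \<cdot> e \<cdot> u = t\<star> \<cdot> e \<cdot> t"
    using lift_conj[OF psi_idem[OF e] t] lift_conj[OF psi_idem[OF e] u(1)] u(2) lift_psi[OF e] by simp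
  then have "act u \<alpha> \<in> carrier ?S" using act_closed[OF e u(1) \<alpha>'] by simp
  ultimately show "act u \<alpha> = act t \<alpha>" using \<beta>(1) act_closed[OF e t \<alpha>'] by simp
qed

lemma pi_lausch_action: "lausch_action (Mon X R) (pi_module X R) pi_act"
proof (intro lausch_action.intro lausch_action_axioms.intro M.inverse_monoid_axioms)
  have lcomp: "lcomp (pi_module X R) e = pi_group X R (lft e)" for e by (simp add: pi_module_def)
  fix e assume e: "e \<in> EM"
  note le = lift_ET[OF e]
  show "comm_group (lcomp (pi_module X R) e)" unfolding lcomp by (rule pi_comm_group[OF e])
  show "lact (pi_module X R) (e, \<alpha>) m = (m\<diamond> \<bullet> e \<bullet> m, pi_act e m \<alpha>)" for \<alpha> m
    by (simp add: pi_module_def pi_act_def act_def)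
  show "pi_act e e \<alpha> = \<alpha>" if "\<alpha> \<in> carrier (lcomp (pi_module X R) e)" for \<alpha>
    using pi_act_eq[OF le lift_closed[OF e], of \<alpha> e] act_self[OF le] that e
    by (simp add: lcomp pi_carrier)
  fix m assume m: "m \<in> MC"
  obtain t where t: "t \<in> TC" "\<psi> t = m" using psi_surj[OF m] .
  have f: "m\<diamond> \<bullet> e \<bullet> m \<in> EM" by (rule M.conj_idem[OF e m])
  have lf: "lft (m\<diamond> \<bullet> e \<bullet> m) = t\<star> \<cdot> lft e \<cdot> t" using lift_conj[OF e t(1)] t(2) by simp
  have eq: "pi_act e' m \<alpha> = act t \<alpha>" if "\<alpha> \<in> carrier (pi_group X R (lft e))" for \<alpha> e'
    using pi_act_eq[OF le t(1) that] t(2) by simp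
  interpret P: comm_group "pi_group X R (lft e)" by (rule pi_comm_group[OF e])
  show "pi_act e m \<in> hom (lcomp (pi_module X R) e) (lcomp (pi_module X R) (m\<diamond> \<bullet> e \<bullet> m))"
    unfolding lcomp lf
  proof (rule homI)
    fix \<alpha> \<beta> assume \<alpha>: "\<alpha> \<in> carrier (pi_group X R (lft e))" and \<beta>: "\<beta> \<in> carrier (pi_group X R (lft e))"
    show "pi_act e m \<alpha> \<in> carrier (pi_group X R (t\<star> \<cdot> lft e \<cdot> t))"
      using pi_act_closed[OF le t(1) \<alpha>] by (simp add: eq[OF \<alpha>])
    show "pi_act e m (\<alpha> \<otimes>\<^bsub>pi_group X R (lft e)\<^esub> \<beta>)
        = pi_act e m \<alpha> \<otimes>\<^bsub>pi_group X R (t\<star> \<cdot> lft e \<cdot> t)\<^esub> pi_act e m \<beta>"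
      unfolding eq[OF P.m_closed[OF \<alpha> \<beta>]] unfolding eq[OF \<alpha>] eq[OF \<beta>] pi_mult
      using hom_mult[OF act_hom[OF le t(1)]] \<alpha> \<beta> by (simp add: pi_carrier)
  qed
  show "pi_act e (m \<bullet> n) \<alpha> = pi_act (m\<diamond> \<bullet> e \<bullet> m) n (pi_act e m \<alpha>)"
    if n: "n \<in> MC" and "\<alpha> \<in> carrier (lcomp (pi_module X R) e)" for n \<alpha>
  proof -
    have \<alpha>: "\<alpha> \<in> carrier (pi_group X R (lft e))" using that by (simp add: lcomp)
    obtain u where u: "u \<in> TC" "\<psi> u = n" using psi_surj[OF n] .
    have "pi_act e (m \<bullet> n) \<alpha> = act (t \<cdot> u) \<alpha>"
      using pi_act_eq[OF le _ \<alpha>, of "t \<cdot> u"] t u by (simp add: psi_mult)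
    moreover have "pi_act (m\<diamond> \<bullet> e \<bullet> m) n (act t \<alpha>) = act u (act t \<alpha>)"
      using pi_act_eq[OF T.conj_idem[OF le t(1)] u(1) pi_act_closed[OF le t(1) \<alpha>]] u(2) by simp
    ultimately show ?thesis using act_mult[OF le t(1) u(1)] \<alpha> by (simp add: eq pi_carrier)
  qed
next
  fix e f \<alpha> assume e: "e \<in> EM" and f: "f \<in> EM" and "\<alpha> \<in> carrier (lcomp (pi_module X R) e)"
  then show "lres (pi_module X R) e f \<alpha> = pi_act e f \<alpha>"
    using pi_act_eq[OF lift_ET[OF e] lift_closed[OF f], of \<alpha> e]
    by (simp add: pi_module_def act_def T.sinv_idem)
qed

section \<open>The two maps of the sequence and exactness\<close>

definition pi_incl where
  "pi_incl e \<alpha> = ab_class (St (lft e)) \<alpha>"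

definition rbar where
  "rbar e k = the_elem ((\<lambda>\<alpha>. ab_class (K_group X R e) (gran \<alpha>)) ` k)"

lemma rbar_class:
  assumes e: "e \<in> EM" and \<alpha>: "\<alpha> \<in> carrier (St (lft e))"
  shows "rbar e (ab_class (St (lft e)) \<alpha>) = ab_class (K_group X R e) (gran \<alpha>)"
  unfolding rbar_def
proof (rule the_elem_const)
  interpret g: group_hom "St (lft e)" "K_group X R e" gran by (rule gran_group_hom[OF e])
  show "ab_class (St (lft e)) \<alpha> \<noteq> {}" using g.G.ab_class_self[OF \<alpha>] by auto
  fix \<beta> assume "\<beta> \<in> ab_class (St (lft e)) \<alpha>"
  then show "ab_class (K_group X R e) (gran \<beta>) = ab_class (K_group X R e) (gran \<alpha>)"
    using g.G.ab_class_eqI[OF _ \<alpha>] g.ab_class_cong[OF _ \<alpha>] by blast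
qed

lemma iota_hom: "lausch_hom (Mon X R) (pi_module X R) (star_ab_module X R) pi_incl"
proof (rule lausch_homI[OF pi_lausch_action star_ab_action])
  fix e assume e: "e \<in> EM"
  interpret S: group "St (lft e)" by (simp add: star_group_group e)
  show "pi_incl e \<in> hom (lcomp (pi_module X R) e) (lcomp (star_ab_module X R) e)"
    by (rule homI)
      (simp_all add: pi_incl_def pi_module_def star_ab_module_def pi_carrier pi_mult S.ab_class_closed S.ab_class_mult)
  fix m \<alpha> assume m: "m \<in> MC" and "\<alpha> \<in> carrier (lcomp (pi_module X R) e)"
  then have \<alpha>: "\<alpha> \<in> carrier (pi_group X R (lft e))" by (simp add: pi_module_def)
  obtain t where t: "t \<in> TC" "\<psi> t = m" using psi_surj[OF m] .
  show "pi_incl (m\<diamond> \<bullet> e \<bullet> m) (pi_act e m \<alpha>) = S.ab_act e m (pi_incl e \<alpha>)"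
  proof -
    have "\<alpha> \<in> carrier (St (lft e))" using \<alpha> by (simp add: pi_carrier)
    then show ?thesis
      using S.ab_act_class[OF e t(1)] pi_act_eq[OF lift_ET[OF e] t(1) \<alpha>, of e]
      unfolding pi_incl_def t(2)[symmetric] by metis
  qed
qed

lemma rbar_hom: "lausch_hom (Mon X R) (star_ab_module X R) (relation_module X R) rbar"
proof (rule lausch_homI[OF star_ab_action relation_action])
  fix e assume e: "e \<in> EM"
  have lcomp: "lcomp (star_ab_module X R) e = abelianisation (St (lft e))"
    "lcomp (relation_module X R) e = abelianisation (K_group X R e)"
    by (simp_all add: star_ab_module_def relation_module_def)
  interpret g: group_hom "St (lft e)" "K_group X R e" gran by (rule gran_group_hom[OF e])
  show "rbar e \<in> hom (lcomp (star_ab_module X R) e) (lcomp (relation_module X R) e)"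
    unfolding lcomp
  proof (rule homI)
    fix k k' assume "k \<in> carrier (abelianisation (St (lft e)))" "k' \<in> carrier (abelianisation (St (lft e)))"
    then obtain \<alpha> \<beta> where \<alpha>: "\<alpha> \<in> carrier (St (lft e))" "k = ab_class (St (lft e)) \<alpha>"
      and \<beta>: "\<beta> \<in> carrier (St (lft e))" "k' = ab_class (St (lft e)) \<beta>"
      by (elim g.G.ab_carrierE)
    show "rbar e k \<in> carrier (abelianisation (K_group X R e))"
      using \<alpha> by (simp add: rbar_class[OF e] g.H.ab_class_closed)
    show "rbar e (k \<otimes>\<^bsub>abelianisation (St (lft e))\<^esub> k')
        = rbar e k \<otimes>\<^bsub>abelianisation (K_group X R e)\<^esub> rbar e k'"
      unfolding \<alpha>(2) \<beta>(2) g.G.ab_class_mult[OF \<alpha>(1) \<beta>(1), symmetric]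
      using \<alpha>(1) \<beta>(1) by (simp add: rbar_class[OF e] g.H.ab_class_mult)
  qed
  fix m k assume m: "m \<in> MC" and k: "k \<in> carrier (lcomp (star_ab_module X R) e)"
  obtain \<alpha> where \<alpha>: "\<alpha> \<in> carrier (St (lft e))" "k = ab_class (St (lft e)) \<alpha>"
    using k unfolding lcomp by (elim g.G.ab_carrierE)
  obtain t where t: "t \<in> TC" "\<psi> t = m" using psi_surj[OF m] .
  have f: "m\<diamond> \<bullet> e \<bullet> m \<in> EM" by (rule M.conj_idem[OF e m])
  have ga: "gran \<alpha> \<in> carrier (K_group X R e)" using \<alpha>(1) by simp
  have "rbar (m\<diamond> \<bullet> e \<bullet> m) (S.ab_act e m k) = ab_class (K_group X R (m\<diamond> \<bullet> e \<bullet> m)) (gran (act t \<alpha>))"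
    using S.ab_act_class[OF e t(1) \<alpha>(1)] rbar_class[OF f] S.c_closed[OF e t(1) \<alpha>(1)] \<alpha>(2) t(2) by simp
  also have "\<dots> = K.ab_act e m (rbar e k)"
    using K.ab_act_class[OF e t(1) ga] gran_act[OF lift_ET[OF e] t(1) \<alpha>(1)] rbar_class[OF e \<alpha>(1)] \<alpha>(2) t(2)
    by simp
  finally show "rbar (m\<diamond> \<bullet> e \<bullet> m) (S.ab_act e m k) = K.ab_act e m (rbar e k)" .
qed

text \<open>
  The range map splits because \<open>K_e\<close> is projective, and its kernel is central.  So the kernel meets
  the derived subgroup trivially.
\<close>

lemma pi_derived_trivial:
  assumes e: "e \<in> EM" and \<alpha>: "\<alpha> \<in> carrier (pi_group X R (lft e))"
    and d: "\<alpha> \<in> derived (St (lft e)) (carrier (St (lft e)))"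
  shows "\<alpha> = \<one>\<^bsub>St (lft e)\<^esub>"
proof -
  interpret g: group_hom "St (lft e)" "K_group X R e" gran by (rule gran_group_hom[OF e])
  obtain \<sigma> where \<sigma>: "\<sigma> \<in> hom (K_group X R e) (St (lft e))"
    "\<And>k. k \<in> carrier (K_group X R e) \<Longrightarrow> gran (\<sigma> k) = k"
    by (rule K_group_projective[OF e g.G.group_axioms gran_hom[OF e] gran_image[OF e]]) blast
  have ker: "kernel (St (lft e)) (K_group X R e) gran = carrier (pi_group X R (lft e))"
    by (simp add: pi_group_eq[OF e])
  show ?thesis
    by (rule g.kernel_derived_trivial[OF \<sigma>]) (use pi_central[OF lift_ET[OF e]] \<alpha> d ker in auto)
qed

lemma star_short_exact:
  "lausch_short_exact (Mon X R) (pi_module X R) pi_incl (star_ab_module X R) rbar (relation_module X R)"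
  unfolding lausch_short_exact_def
proof (intro conjI ballI iota_hom rbar_hom)
  show "lausch_module (Mon X R) (pi_module X R)"
    by (rule lausch_action.is_lausch_module[OF pi_lausch_action])
  show "lausch_module (Mon X R) (star_ab_module X R)"
    by (rule lausch_action.is_lausch_module[OF star_ab_action])
  show "lausch_module (Mon X R) (relation_module X R)"
    by (rule lausch_action.is_lausch_module[OF relation_action])
  fix e assume e: "e \<in> EM"
  have lcomp: "lcomp (pi_module X R) e = pi_group X R (lft e)"
    "lcomp (star_ab_module X R) e = abelianisation (St (lft e))"
    "lcomp (relation_module X R) e = abelianisation (K_group X R e)"
    by (simp_all add: pi_module_def star_ab_module_def relation_module_def)
  let ?S = "St (lft e)" and ?K = "K_group X R e"
  interpret g: group_hom ?S ?K gran by (rule gran_group_hom[OF e])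
  interpret A: comm_group "abelianisation ?S" by (rule g.G.ab_comm_group)
  have ker: "kernel ?S ?K gran = carrier (pi_group X R (lft e))"
    by (simp add: pi_group_eq[OF e])
  have sub: "subgroup (carrier (pi_group X R (lft e))) ?S" using g.subgroup_kernel by (simp add: ker)
  note piS = subgroup.mem_carrier[OF sub]
  show "inj_on (pi_incl e) (carrier (lcomp (pi_module X R) e))"
    unfolding lcomp
  proof (rule inj_onI)
    fix \<alpha> \<beta> assume \<alpha>: "\<alpha> \<in> carrier (pi_group X R (lft e))" and \<beta>: "\<beta> \<in> carrier (pi_group X R (lft e))"
      and eq: "pi_incl e \<alpha> = pi_incl e \<beta>"
    have "ab_class ?S (\<alpha> \<otimes>\<^bsub>?S\<^esub> inv\<^bsub>?S\<^esub> \<beta>) = \<one>\<^bsub>abelianisation ?S\<^esub>"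
      using eq piS[OF \<alpha>] piS[OF \<beta>]
      by (simp add: pi_incl_def g.G.ab_class_mult g.G.ab_class_inv g.G.ab_class_closed)
    then have d: "\<alpha> \<otimes>\<^bsub>?S\<^esub> inv\<^bsub>?S\<^esub> \<beta> \<in> derived ?S (carrier ?S)"
      using piS[OF \<alpha>] piS[OF \<beta>] by (simp add: g.G.ab_class_eq_one_iff)
    have "\<alpha> \<otimes>\<^bsub>?S\<^esub> inv\<^bsub>?S\<^esub> \<beta> \<in> carrier (pi_group X R (lft e))"
      using sub \<alpha> \<beta> by (simp add: subgroup.m_closed subgroup.m_inv_closed)
    then have "\<alpha> \<otimes>\<^bsub>?S\<^esub> inv\<^bsub>?S\<^esub> \<beta> = \<one>\<^bsub>?S\<^esub>" using d by (rule pi_derived_trivial[OF e])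
    then show "\<alpha> = \<beta>" using g.G.inv_equality[of \<alpha> "inv\<^bsub>?S\<^esub> \<beta>"] piS[OF \<alpha>] piS[OF \<beta>] by simp
  qed
  show "pi_incl e ` carrier (lcomp (pi_module X R) e)
      = kernel (lcomp (star_ab_module X R) e) (lcomp (relation_module X R) e) (rbar e)"
    unfolding lcomp
  proof (intro equalityI subsetI)
    fix k assume "k \<in> pi_incl e ` carrier (pi_group X R (lft e))"
    then obtain \<alpha> where \<alpha>: "\<alpha> \<in> carrier (pi_group X R (lft e))" "k = ab_class ?S \<alpha>" by (auto simp: pi_incl_def)
    have "gran \<alpha> = \<one>\<^bsub>?K\<^esub>" using \<alpha>(1) by (simp add: pi_carrier K_one)
    then show "k \<in> kernel (abelianisation ?S) (abelianisation ?K) (rbar e)"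
      using piS[OF \<alpha>(1)] by (simp add: \<alpha>(2) kernel_def g.G.ab_class_closed rbar_class[OF e] g.H.ab_class_one)
  next
    fix k assume k: "k \<in> kernel (abelianisation ?S) (abelianisation ?K) (rbar e)"
    then have "k \<in> carrier (abelianisation ?S)" by (simp add: kernel_def)
    then obtain \<beta> where \<beta>: "\<beta> \<in> carrier ?S" "k = ab_class ?S \<beta>" by (elim g.G.ab_carrierE)
    \<comment> \<open>A class in the kernel has a representative whose range lies in the derived
      subgroup of \<open>K_e\<close>. As the range map is onto, some \<open>\<delta>\<close> in the
      derived subgroup of the star has the same range; dividing by it moves \<open>\<beta>\<close>
      into \<open>pi_e\<close> and keeps its class.\<close>
    have "gran \<beta> \<in> derived ?K (carrier ?K)"
      using k \<beta>(1) by (simp add: \<beta>(2) kernel_def rbar_class[OF e] g.H.ab_class_eq_one_iff)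
    then have "gran \<beta> \<in> gran ` derived ?S (carrier ?S)"
      using g.derived_img[of "carrier ?S"] by (simp add: gran_image[OF e])
    then obtain \<delta> where \<delta>: "\<delta> \<in> derived ?S (carrier ?S)" "gran \<delta> = gran \<beta>" by auto
    have \<delta>c: "\<delta> \<in> carrier ?S" using \<delta>(1) g.G.derived_in_carrier[of "carrier ?S"] by auto
    have "\<beta> \<otimes>\<^bsub>?S\<^esub> inv\<^bsub>?S\<^esub> \<delta> \<in> kernel ?S ?K gran"
      using \<beta>(1) \<delta>c \<delta>(2) by (simp add: kernel_def)
    moreover have "ab_class ?S (\<beta> \<otimes>\<^bsub>?S\<^esub> inv\<^bsub>?S\<^esub> \<delta>) = k"
      using \<beta> \<delta>c \<delta>(1) by (simp add: g.G.ab_class_mult g.G.ab_class_inv g.G.ab_class_closed flip: g.G.ab_class_eq_one_iff)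
    ultimately show "k \<in> pi_incl e ` carrier (pi_group X R (lft e))" unfolding ker pi_incl_def by blast
  qed
  show "rbar e ` carrier (lcomp (star_ab_module X R) e) = carrier (lcomp (relation_module X R) e)"
    unfolding lcomp
  proof (intro equalityI subsetI)
    fix k assume "k \<in> rbar e ` carrier (abelianisation ?S)"
    then obtain c where "c \<in> carrier (abelianisation ?S)" "k = rbar e c" by auto
    then obtain \<alpha> where "\<alpha> \<in> carrier ?S" "k = rbar e (ab_class ?S \<alpha>)" by (metis g.G.ab_carrierE)
    then show "k \<in> carrier (abelianisation ?K)" by (simp add: rbar_class[OF e] g.H.ab_class_closed)
  next
    fix k assume "k \<in> carrier (abelianisation ?K)"
    then obtain a where a: "a \<in> carrier ?K" "k = ab_class ?K a" by (elim g.H.ab_carrierE)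
    then obtain \<alpha> where "\<alpha> \<in> carrier ?S" "a = gran \<alpha>" using gran_image[OF e] by auto
    then show "k \<in> rbar e ` carrier (abelianisation ?S)"
      using a(2) rbar_class[OF e] g.G.ab_class_closed by (metis imageI)
  qed
qed

end

section \<open>Freeness\<close>

lemma frag_extend_hom:
  assumes "\<And>x. x \<in> S \<Longrightarrow> F x \<in> carrier (free_Abelian_group S')"
  shows "frag_extend F \<in> hom (free_Abelian_group S) (free_Abelian_group S')"
proof (rule homI)
  fix x assume "x \<in> carrier (free_Abelian_group S)"
  then have x: "Poly_Mapping.keys x \<subseteq> S" by simp
  show "frag_extend F x \<in> carrier (free_Abelian_group S')"
    using x
  proof (induction x rule: free_Abelian_group_induct[consumes 1])
    case (2 x y)
    then show ?case using keys_diff[of "frag_extend F x" "frag_extend F y"] by (auto simp: frag_extend_diff)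
  qed (use assms in auto)
qed (simp add: frag_extend_add)

lemma free_Abelian_group_hom_eq:
  assumes "group G" "\<phi> \<in> hom (free_Abelian_group S) G" "\<chi> \<in> hom (free_Abelian_group S) G"
    and eq: "\<And>a. a \<in> S \<Longrightarrow> \<phi> (frag_of a) = \<chi> (frag_of a)"
    and x: "x \<in> carrier (free_Abelian_group S)"
  shows "\<phi> x = \<chi> x"
proof -
  interpret p: group_hom "free_Abelian_group S" G \<phi>
    using assms by (simp add: group_hom_def group_hom_axioms_def)
  interpret c: group_hom "free_Abelian_group S" G \<chi>
    using assms by (simp add: group_hom_def group_hom_axioms_def)
  have "Poly_Mapping.keys x \<subseteq> S" using x by simp
  then show ?thesis
  proof (induction x rule: free_Abelian_group_induct[consumes 1])
    case 1
    then show ?case using p.hom_one c.hom_one by simp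
  next
    case (2 x y)
    have diff: "x - y = x \<otimes>\<^bsub>free_Abelian_group S\<^esub> inv\<^bsub>free_Abelian_group S\<^esub> y"
      using 2(2) by simp
    have xy: "x \<in> carrier (free_Abelian_group S)" "y \<in> carrier (free_Abelian_group S)"
      using 2(1,2) by simp_all
    show ?case
      unfolding diff p.hom_mult[OF xy(1) p.G.inv_closed[OF xy(2)]] c.hom_mult[OF xy(1) p.G.inv_closed[OF xy(2)]]
        p.hom_inv[OF xy(2)] c.hom_inv[OF xy(2)] 2(3,4) ..
  qed (rule eq)
qed

context presentation
begin

text \<open>
  The signed count of edges \<open>(p, l, r, q)\<close>, each labelled by its relation and \<open>(p\<psi>)\<^sup>-\<^sup>1\<close>.  It
  is a homotopy invariant, since both sides of a 2-cell have the same labels, and it detects freeness.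
\<close>

definition weight :: "'x squier_edge \<times> bool \<Rightarrow> (('x word \<times> 'x word) \<times> 'x word set set) \<Rightarrow>\<^sub>0 int" where
  "weight = (\<lambda>((p, l, r, q), b).
     if b then frag_of ((l, r), (\<psi> p)\<diamond>) else - frag_of ((l, r), (\<psi> p)\<diamond>))"

definition path_weight where
  "path_weight xs = sum_list (map weight xs)"

definition arrow_weight where
  "arrow_weight \<alpha> = the_elem ((\<lambda>(v, xs, w). path_weight xs) ` \<alpha>)"

text \<open>One target with all possible labels serves every \<open>e\<close> and spares side
  conditions on the labels that occur.\<close>

abbreviation FA where "FA \<equiv> free_Abelian_group (UNIV :: (('x word \<times> 'x word) \<times> 'x word set set) set)"

lemma path_weight_simps [simp]: "path_weight [] = 0" "path_weight (x # xs) = weight x + path_weight xs"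
    "path_weight (xs @ ys) = path_weight xs + path_weight ys"
  by (simp_all add: path_weight_def)

lemma path_weight_homotopic: "homotopic Sq v w xs ys \<Longrightarrow> path_weight xs = path_weight ys"
proof (induction rule: homotopic.induct)
  case (cancel xs d ys)
  obtain p l r q b where "d = ((p, l, r, q), b)" by (metis surj_pair)
  then show ?case by (simp add: weight_def)
next
  case (cell us vs xs ys)
  from cell(1) show ?case
  proof (cases rule: squier_cellE)
    case (1 p q p' q' l r l' r')
    note [simp] = R_wordsD[OF 1(5)]
    have "\<psi> (p \<cdot> w\<^sub>T r \<cdot> q \<cdot> p') = \<psi> (p \<cdot> w\<^sub>T l \<cdot> q \<cdot> p')"
      using 1 psi_wT_rel[OF 1(5)] by (simp add: psi_mult)
    then have "weight ((p \<cdot> w\<^sub>T r \<cdot> q \<cdot> p', l', r', q'), True) = weight ((p \<cdot> w\<^sub>T l \<cdot> q \<cdot> p', l', r', q'), True)"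
      by (simp add: weight_def)
    moreover have "weight ((p, l, r, q1), True) = weight ((p, l, r, q2), True)" for q1 q2
      by (simp add: weight_def)
    ultimately show ?thesis unfolding 1(7,8) by (simp add: add.commute)
  qed
qed auto

lemma arrow_weight_hclass: "edge_path Sq v xs w \<Longrightarrow> arrow_weight (hclass Sq v xs w) = path_weight xs"
  unfolding arrow_weight_def
proof (rule the_elem_const)
  assume xs: "edge_path Sq v xs w"
  show "hclass Sq v xs w \<noteq> {}" using hclass_self[OF xs] by auto
  fix z assume "z \<in> hclass Sq v xs w"
  then show "(case z of (v, xs, w) \<Rightarrow> path_weight xs) = path_weight xs"
    by (auto simp: hclass_def path_weight_homotopic)
qed

text \<open>Translation by \<open>g\<close> replaces \<open>p\<close> by \<open>g p\<close>, whose
  image is that of \<open>e p\<close>; on a normal path \<open>e p = p\<close>. Hence the weight is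
  additive on products of the star, although these translate the second factor.\<close>

lemma path_weight_lmap:
  assumes e: "e \<in> ET" and g: "g \<in> TC" "\<psi> g = \<psi> e" and ys: "npath e ys h"
  shows "path_weight (lmap g ys) = path_weight ys"
proof -
  have "map (weight \<circ> (\<lambda>((p, l, r, q), b). ((g \<cdot> p, l, r, q), b))) ys = map weight ys"
  proof (rule path_map_cong[OF npath_path[OF ys]])
    fix p l r q b assume p: "((p, l, r, q), b) \<in> set ys" "p \<in> TC"
    have "e \<cdot> p = p" using nfD[OF _ p(1)] ys by (auto simp: npath_def)
    then have "\<psi> e \<bullet> \<psi> p = \<psi> p" using psi_mult[OF T.idems_closed[OF e] p(2)] by simp
    then show "(weight \<circ> (\<lambda>((p, l, r, q), b). ((g \<cdot> p, l, r, q), b))) ((p, l, r, q), b) = weight ((p, l, r, q), b)"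
      using g p(2) by (simp add: weight_def psi_mult)
  qed
  then show ?thesis by (simp only: path_weight_def lmap_def map_map)
qed

lemma arrow_weight_hom:
  assumes e: "e \<in> ET"
  shows "arrow_weight \<in> hom (St e) FA"
proof (rule homI)
  fix \<alpha> \<beta> assume \<alpha>: "\<alpha> \<in> carrier (St e)" and \<beta>: "\<beta> \<in> carrier (St e)"
  obtain xs g where xs: "npath e xs g" "\<alpha> = hclass Sq e xs g" using star_carrierE[OF e \<alpha>] .
  obtain ys h where ys: "npath e ys h" "\<beta> = hclass Sq e ys h" using star_carrierE[OF e \<beta>] .
  have "path_weight (xs @ lmap g ys) = path_weight xs + path_weight ys"
    using path_weight_lmap[OF e npath_end(2,3)[OF xs(1)] ys(1)] by simp
  then show "arrow_weight (\<alpha> \<otimes>\<^bsub>St e\<^esub> \<beta>) = arrow_weight \<alpha> \<otimes>\<^bsub>FA\<^esub> arrow_weight \<beta>"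
    using arrow_weight_hclass[OF npath_path[OF npath_mult[OF e xs(1) ys(1)]]]
      arrow_weight_hclass[OF npath_path[OF xs(1)]] arrow_weight_hclass[OF npath_path[OF ys(1)]]
    unfolding xs(2) ys(2) star_mult_hclass[OF e xs(1) ys(1)] by simp
qed simp

text \<open>With \<open>a\<close> the left side of a relation, this describes a single normal edge
  starting at \<open>e\<close>. The edge is determined by the relation and \<open>p\<close>, where
  \<open>p\<close> is R-related to \<open>e\<close> and its domain lies below \<open>a a^-1\<close>;
  the last entry \<open>q\<close> is forced, being an inverse of \<open>p a\<close>.\<close>

lemma star_edge_shape:
  assumes e: "e \<in> ET" and c: "p \<in> TC" "a \<in> TC" "q \<in> TC" and p: "e \<cdot> p = p" and q: "q \<cdot> e = q"
    and paq: "p \<cdot> a \<cdot> q = e"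
  shows "p \<cdot> p\<star> = e" "p \<cdot> a \<cdot> a\<star> = p" "q = (p \<cdot> a)\<star>"
proof -
  note [simp] = c T.idems_closed[OF e]
  \<comment> \<open>From \<open>s b = e\<close> the idempotent \<open>s s^-1\<close> absorbs into
    \<open>e\<close>, and from \<open>e s = s\<close> the idempotent \<open>e\<close> absorbs into
    \<open>s s^-1\<close>. This is applied both to \<open>p\<close> and to
    \<open>p a\<close>.\<close>
  have range: "s \<cdot> s\<star> = e" if s: "s \<in> TC" "e \<cdot> s = s" and b: "b \<in> TC" "s \<cdot> b = e" for s b
  proof -
    have "s \<cdot> s\<star> \<cdot> e = s \<cdot> s\<star> \<cdot> (s \<cdot> b)" using b by simp
    also have "\<dots> = s \<cdot> b" using s(1) b(1) by (simp add: T.inv_simps)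
    finally have "s \<cdot> s\<star> \<cdot> e = e" using b by simp
    moreover have "s \<cdot> s\<star> \<cdot> e = e \<cdot> (s \<cdot> s\<star>)" using s e by (intro T.idem_comm) simp_all
    moreover have "e \<cdot> (s \<cdot> s\<star>) = s \<cdot> s\<star>" using s by (simp flip: T.m_assoc)
    ultimately show ?thesis by simp
  qed
  show "p \<cdot> p\<star> = e" using range[of p "a \<cdot> q"] p paq by (simp add: T.m_assoc)
  have epa: "e \<cdot> (p \<cdot> a) = p \<cdot> a" using p by (simp flip: T.m_assoc)
  have pa: "(p \<cdot> a) \<cdot> (p \<cdot> a)\<star> = e" using range[of "p \<cdot> a" q] epa paq by simp
  have "p \<cdot> a \<cdot> a\<star> = p \<cdot> ((p\<star> \<cdot> p) \<cdot> (a \<cdot> a\<star>))" by (simp add: T.inv_simps)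
  also have "(p\<star> \<cdot> p) \<cdot> (a \<cdot> a\<star>) = (a \<cdot> a\<star>) \<cdot> (p\<star> \<cdot> p)" by (rule T.idem_comm) simp_all
  also have "p \<cdot> ((a \<cdot> a\<star>) \<cdot> (p\<star> \<cdot> p)) = (p \<cdot> a) \<cdot> (p \<cdot> a)\<star> \<cdot> p" by (simp add: T.sinv_mult T.m_assoc)
  finally show "p \<cdot> a \<cdot> a\<star> = p" using pa p by simp
  have "p \<cdot> a \<cdot> q \<cdot> (p \<cdot> a) = p \<cdot> a" using paq epa by simp
  moreover have "q \<cdot> (p \<cdot> a) \<cdot> q = q" using paq q by (simp add: T.m_assoc)
  ultimately have "(p \<cdot> a)\<star> = q" by (intro T.sinv_unique) simp_all
  then show "q = (p \<cdot> a)\<star>" ..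
qed

section \<open>The generators attached to the relations\<close>

definition base_idem where
  "base_idem l = w\<^sub>T l \<cdot> (w\<^sub>T l)\<star>"

text \<open>The normal edge of \<open>(l, r)\<close> whose first entry is the idempotent
  \<open>l l^-1\<close>. The normal edges for \<open>(l, r)\<close> at the other idempotents are its
  translates.\<close>

definition base_arrow where
  "base_arrow l r = hclass Sq (base_idem l) [((base_idem l, l, r, (w\<^sub>T l)\<star>), True)] (w\<^sub>T r \<cdot> (w\<^sub>T l)\<star>)"

context
  fixes l r
  assumes lr: "(l, r) \<in> R"
begin

lemma lr_closed [simp]: "w\<^sub>T l \<in> TC" "w\<^sub>T r \<in> TC"
  using R_wordsD[OF lr] by simp_all

lemma base_idem_ET [simp]: "base_idem l \<in> ET" "base_idem l \<in> TC"
  using T.idems_closed[of "base_idem l"] by (simp_all add: base_idem_def)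

lemma base_npath:
  "npath (base_idem l) [((base_idem l, l, r, (w\<^sub>T l)\<star>), True)] (w\<^sub>T r \<cdot> (w\<^sub>T l)\<star>)"
proof -
  have r: "w\<^sub>T l \<cdot> (w\<^sub>T l)\<star> \<cdot> w\<^sub>T r = w\<^sub>T r"
    by (rule mult_idem_left)
      (simp_all add: psi_mult psi_sinv psi_wT_rel[OF lr] M.mult_sinv_mult)
  then show ?thesis
    using lr by (simp add: npath_def squier_simps base_idem_def T.inv_simps)
qed

lemma base_arrow_star: "base_arrow l r \<in> carrier (St (base_idem l))"
  unfolding base_arrow_def by (rule star_carrierI[OF base_idem_ET(1) base_npath])

text \<open>Conjugation by \<open>t\<close> gives the edge with first entry \<open>t^-1\<close>. So
  the edge with first entry \<open>p\<close> is the translate of the base edge by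
  \<open>p^-1\<close>, which explains the inverse in the labels of \<open>weight\<close>.\<close>

lemma act_base_arrow:
  assumes t [simp]: "t \<in> TC" and le: "base_idem l \<cdot> t = t"
  shows "npath (t\<star> \<cdot> t) [((t\<star>, l, r, (t\<star> \<cdot> w\<^sub>T l)\<star>), True)] (t\<star> \<cdot> (w\<^sub>T r \<cdot> (w\<^sub>T l)\<star>) \<cdot> t)"
    and "act t (base_arrow l r) = hclass Sq (t\<star> \<cdot> t) [((t\<star>, l, r, (t\<star> \<cdot> w\<^sub>T l)\<star>), True)]
      (t\<star> \<cdot> (w\<^sub>T r \<cdot> (w\<^sub>T l)\<star>) \<cdot> t)"
proof -
  have tb: "t\<star> \<cdot> base_idem l = t\<star>"
    using arg_cong[OF le, of "sinv (Tmon X R)"] by (simp add: T.sinv_mult T.sinv_idem)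
  then have "t\<star> \<cdot> base_idem l \<cdot> t = t\<star> \<cdot> t" by simp
  moreover have "cmap t [((base_idem l, l, r, (w\<^sub>T l)\<star>), True)] = [((t\<star>, l, r, (t\<star> \<cdot> w\<^sub>T l)\<star>), True)]"
    using tb by (simp add: cmap_def T.sinv_mult)
  ultimately show "npath (t\<star> \<cdot> t) [((t\<star>, l, r, (t\<star> \<cdot> w\<^sub>T l)\<star>), True)] (t\<star> \<cdot> (w\<^sub>T r \<cdot> (w\<^sub>T l)\<star>) \<cdot> t)"
    and "act t (base_arrow l r) = hclass Sq (t\<star> \<cdot> t) [((t\<star>, l, r, (t\<star> \<cdot> w\<^sub>T l)\<star>), True)]
      (t\<star> \<cdot> (w\<^sub>T r \<cdot> (w\<^sub>T l)\<star>) \<cdot> t)"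
    using npath_cmap[OF base_idem_ET(1) t base_npath] act_hclass[OF t base_npath]
    by (simp_all add: base_arrow_def)
qed

end

interpretation S: crossed_system X R "\<lambda>e. St (lft e)" act
  by (rule star_crossed)

interpretation SA: lausch_action "Mon X R" "star_ab_module X R" S.ab_act
  by (rule star_ab_action)

text \<open>The generators are classes rather than relations, because \<open>is_free_lausch\<close>
  takes them from the element type of the module. Different relations give different classes, since
  their weights differ.\<close>

definition basis_fam where
  "basis_fam f = {ab_class (St (lft f)) (base_arrow l r) | l r. (l, r) \<in> R \<and> \<psi> (base_idem l) = f}"

abbreviation basis where "basis \<equiv> free_basis (Mon X R) basis_fam"

lemma star_lcomp: "lcomp (star_ab_module X R) e = abelianisation (St (lft e))"
  by (simp add: star_ab_module_def)

text \<open>Replaces the coefficient in \<open>M\<close> by a preimage \<open>t\<close> in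
  \<open>T\<close>. The order condition of the free basis becomes that \<open>t\<close> absorbs
  \<open>base_idem l\<close>, so \<open>act_base_arrow\<close> applies.\<close>

lemma basisE:
  assumes "x \<in> basis e"
  obtains f b l r t where "x = ((f, b), \<psi> t)" "(l, r) \<in> R" "f = \<psi> (base_idem l)" "f \<in> EM"
    "b = ab_class (St (base_idem l)) (base_arrow l r)" "t \<in> TC" "base_idem l \<cdot> t = t" "e = \<psi> (t\<star> \<cdot> t)"
    "S.ab_act f (\<psi> t) b = ab_class (St (lft e)) (act t (base_arrow l r))"
    "act t (base_arrow l r) \<in> carrier (St (lft e))"
proof -
  obtain f b m where x: "x = ((f, b), m)" "f \<in> EM" "b \<in> basis_fam f" "m \<in> MC"
      "natural_le (Mon X R) (m \<bullet> m\<diamond>) f" "m\<diamond> \<bullet> m = e"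
    using assms by (auto simp: free_basis_def)
  obtain l r where lr: "(l, r) \<in> R" "\<psi> (base_idem l) = f" "b = ab_class (St (lft f)) (base_arrow l r)"
    using x(3) by (auto simp: basis_fam_def)
  obtain t where t: "t \<in> TC" "\<psi> t = m" using psi_surj[OF x(4)] .
  note b = base_idem_ET[OF lr(1)]
  have lf: "lft f = base_idem l" using lr(2) b lift_psi by blast
  have "m \<bullet> m\<diamond> \<bullet> f = m \<bullet> m\<diamond>" using x(2,4,5) by (simp add: M.natural_le_idem_iff)
  then have "f \<bullet> (m \<bullet> m\<diamond>) = m \<bullet> m\<diamond>" using M.idem_comm[OF x(2) M.range_idem[OF x(4)]] by simp
  then have "f \<bullet> m = m" using M.range_le_imp_left_id[OF x(4) M.idems_closed[OF x(2)]] by simp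
  then have bt: "base_idem l \<cdot> t = t" using b t lr(2) by (intro mult_idem_left) simp_all
  have e: "e = \<psi> (t\<star> \<cdot> t)" using t x(6) by (simp add: psi_mult psi_sinv)
  have le: "lft e = t\<star> \<cdot> t" unfolding e by (rule lift_psi) (simp add: t)
  have fe: "(\<psi> t)\<diamond> \<bullet> f \<bullet> \<psi> t = e"
    using \<open>f \<bullet> m = m\<close> x(2,4,6) t M.idems_closed by (simp add: M.m_assoc)
  have "S.ab_act f (\<psi> t) b = ab_class (St (lft e)) (act t (base_arrow l r))"
    using S.ab_act_class[OF x(2) t(1), of "base_arrow l r"] base_arrow_star[OF lr(1)]
    unfolding fe lr(3) lf by simp
  moreover have "act t (base_arrow l r) \<in> carrier (St (lft e))"
    unfolding le act_base_arrow(2)[OF lr(1) t(1) bt]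
    by (rule star_carrierI[OF T.domain_idem[OF t(1)] act_base_arrow(1)[OF lr(1) t(1) bt]])
  ultimately show ?thesis
    using that[of f b t l r] x(1,2) lr bt e t unfolding lf by blast
qed

lemma basis_arrowI:
  assumes lr: "(l, r) \<in> R" and t: "t \<in> TC" and bt: "base_idem l \<cdot> t = t"
  defines "f \<equiv> \<psi> (base_idem l)"
  shows "((f, ab_class (St (base_idem l)) (base_arrow l r)), \<psi> t) \<in> basis (\<psi> (t\<star> \<cdot> t))"
proof -
  note b = base_idem_ET[OF lr]
  have f: "f \<in> EM" "lft f = base_idem l" unfolding f_def using b psi_idem lift_psi by blast+
  have "f \<bullet> \<psi> t = \<psi> t" unfolding f_def using bt b t by (simp flip: psi_mult)
  then have "\<psi> t \<bullet> (\<psi> t)\<diamond> \<bullet> f = \<psi> t \<bullet> (\<psi> t)\<diamond>"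
    using M.idem_comm[OF f(1), of "\<psi> t \<bullet> (\<psi> t)\<diamond>"] t M.idems_closed[OF f(1)] by (simp flip: M.m_assoc)
  then show ?thesis
    using f t lr by (auto simp: free_basis_def basis_fam_def M.natural_le_idem_iff psi_mult psi_sinv f_def)
qed

section \<open>The weight on the abelianised star groups\<close>

definition ab_weight where
  "ab_weight k = the_elem (arrow_weight ` k)"

lemma ab_weight_class:
  assumes e: "e \<in> ET" and \<alpha>: "\<alpha> \<in> carrier (St e)"
  shows "ab_weight (ab_class (St e) \<alpha>) = arrow_weight \<alpha>"
  unfolding ab_weight_def
proof (rule the_elem_const)
  interpret w: group_hom "St e" FA arrow_weight
    by (simp add: group_hom_def group_hom_axioms_def star_group_group e arrow_weight_hom)
  show "ab_class (St e) \<alpha> \<noteq> {}" using w.G.ab_class_self[OF \<alpha>] by auto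
  fix \<beta> assume "\<beta> \<in> ab_class (St e) \<alpha>"
  then show "arrow_weight \<beta> = arrow_weight \<alpha>"
    using w.G.ab_class_eqI[OF _ \<alpha>] w.hom_comm_group_ab_class[OF abelian_free_Abelian_group _ \<alpha>] by blast
qed

lemma ab_weight_hom:
  assumes e: "e \<in> ET"
  shows "ab_weight \<in> hom (abelianisation (St e)) FA"
proof (rule homI)
  interpret g: group "St e" by (rule star_group_group[OF e])
  fix k k' assume "k \<in> carrier (abelianisation (St e))" "k' \<in> carrier (abelianisation (St e))"
  then obtain \<alpha> \<beta> where \<alpha>: "\<alpha> \<in> carrier (St e)" "k = ab_class (St e) \<alpha>"
    and \<beta>: "\<beta> \<in> carrier (St e)" "k' = ab_class (St e) \<beta>"
    by (elim g.ab_carrierE)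
  show "ab_weight (k \<otimes>\<^bsub>abelianisation (St e)\<^esub> k') = ab_weight k \<otimes>\<^bsub>FA\<^esub> ab_weight k'"
    using hom_mult[OF arrow_weight_hom[OF e] \<alpha>(1) \<beta>(1)] \<alpha>(1) \<beta>(1)
    unfolding \<alpha>(2) \<beta>(2) g.ab_class_mult[OF \<alpha>(1) \<beta>(1), symmetric] by (simp add: ab_weight_class[OF e])
qed simp

lemma arrow_weight_act_base:
  assumes lr: "(l, r) \<in> R" and t: "t \<in> TC" and bt: "base_idem l \<cdot> t = t"
  shows "arrow_weight (act t (base_arrow l r)) = frag_of ((l, r), \<psi> t)"
  unfolding act_base_arrow(2)[OF lr t bt] arrow_weight_hclass[OF npath_path[OF act_base_arrow(1)[OF lr t bt]]]
  using t by (simp add: weight_def psi_sinv)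

text \<open>Chosen by the universal property of the free abelian group: it sends a generator
  \<open>b\<close> with coefficient \<open>m\<close> to the translate of \<open>b\<close> by
  \<open>m\<close>.\<close>

definition free_map where
  "free_map e = (SOME h. h \<in> hom (free_Abelian_group (basis e)) (lcomp (star_ab_module X R) e) \<and>
     (\<forall>((f, b), m) \<in> basis e. h (frag_of ((f, b), m)) = S.ab_act f m b))"

lemma
  assumes e: "e \<in> EM"
  shows free_map_hom: "free_map e \<in> hom (free_Abelian_group (basis e)) (lcomp (star_ab_module X R) e)"
    and free_map_of: "((f, b), m) \<in> basis e \<Longrightarrow> free_map e (frag_of ((f, b), m)) = S.ab_act f m b"
proof -
  interpret A: comm_group "lcomp (star_ab_module X R) e" by (rule SA.comp_comm[OF e])
  interpret g: group "St (lft e)" using e by (simp add: star_group_group)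
  have "(\<lambda>((f, b), m). S.ab_act f m b) ` basis e \<subseteq> carrier (lcomp (star_ab_module X R) e)"
  proof (rule image_subsetI)
    fix x assume "x \<in> basis e"
    then show "(case x of (x, m) \<Rightarrow> (case x of (f, b) \<Rightarrow> \<lambda>m. S.ab_act f m b) m) \<in> carrier (lcomp (star_ab_module X R) e)"
    proof (cases rule: basisE)
      case (1 f b l r t)
      show ?thesis unfolding 1(1) prod.case 1(9) star_lcomp by (rule g.ab_class_closed[OF 1(10)])
    qed
  qed
  then obtain h where "h \<in> hom (free_Abelian_group (basis e)) (lcomp (star_ab_module X R) e)"
    "\<And>x. x \<in> basis e \<Longrightarrow> h (frag_of x) = (\<lambda>((f, b), m). S.ab_act f m b) x"
    by (rule A.free_Abelian_group_universal) blast
  then have ex: "\<exists>h. h \<in> hom (free_Abelian_group (basis e)) (lcomp (star_ab_module X R) e) \<and>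
     (\<forall>((f, b), m) \<in> basis e. h (frag_of ((f, b), m)) = S.ab_act f m b)"
    by (intro exI[of _ h]) auto
  note h = someI_ex[OF ex, folded free_map_def]
  show "free_map e \<in> hom (free_Abelian_group (basis e)) (lcomp (star_ab_module X R) e)" using h by blast
  show "((f, b), m) \<in> basis e \<Longrightarrow> free_map e (frag_of ((f, b), m)) = S.ab_act f m b" using h by fast
qed

text \<open>Counting edges is a left inverse: the image of a basis element is the class of one edge,
  whose weight is a single label, and \<open>?k\<close> turns the label back into the basis
  element.\<close>

lemma free_map_inj:
  assumes e: "e \<in> EM"
  shows "inj_on (free_map e) (carrier (free_Abelian_group (basis e)))"
proof (rule inj_on_inverseI)
  let ?F = "free_Abelian_group (basis e)"
  \<comment> \<open>A label holds the relation and the coefficient; the component and the class of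
    the base arrow are recovered from the relation.\<close>
  let ?k = "\<lambda>((l, r), m). frag_of ((\<psi> (base_idem l), ab_class (St (base_idem l)) (base_arrow l r)), m)"
  let ?U = "free_Abelian_group (UNIV :: (('x word set set \<times> 'x squier_arrow set) \<times> 'x word set set) set)"
  have "frag_extend ?k \<in> hom FA ?U" by (rule frag_extend_hom) simp
  then have "(frag_extend ?k \<circ> ab_weight) \<circ> free_map e \<in> hom ?F ?U"
    using Group.hom_compose[OF free_map_hom[OF e, unfolded star_lcomp]
        Group.hom_compose[OF ab_weight_hom[OF lift_ET[OF e]]]] by blast
  moreover have "id \<in> hom ?F ?U" by (simp add: group_hom_free_Abelian_groups_id)
  ultimately show "(frag_extend ?k \<circ> ab_weight) (free_map e x) = x" if "x \<in> carrier ?F" for x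
    using free_Abelian_group_hom_eq[OF group_free_Abelian_group _ _ _ that,
        of "(frag_extend ?k \<circ> ab_weight) \<circ> free_map e" UNIV id]
  proof (simp, goal_cases)
    case 1
    have "frag_extend ?k (ab_weight (free_map e (frag_of x))) = frag_of x" if x: "x \<in> basis e" for x
      using x
    proof (cases rule: basisE)
      case (1 f b l r t)
      have "free_map e (frag_of x) = ab_class (St (lft e)) (act t (base_arrow l r))"
        using free_map_of[OF e, of f b "\<psi> t"] x 1(1,9) by simp
      then have "ab_weight (free_map e (frag_of x)) = frag_of ((l, r), \<psi> t)"
        using ab_weight_class[OF lift_ET[OF e] 1(10)] arrow_weight_act_base[OF 1(2,6,7)] by simp
      then show ?thesis using 1(1,3,5) by simp
    qed
    then show ?case using 1 by auto
  qed
qed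

text \<open>Removing the last edge of a normal path splits off a factor that is a single edge at
  \<open>e\<close>. A positive one is a translate of a base arrow, by
  \<open>star_edge_shape\<close>; a negative one is the inverse of a positive one.\<close>

lemma free_map_surj:
  assumes e: "e \<in> EM"
  shows "free_map e ` carrier (free_Abelian_group (basis e)) = carrier (lcomp (star_ab_module X R) e)"
proof -
  let ?S = "St (lft e)" and ?A = "abelianisation (St (lft e))"
  note le = lift_ET[OF e]
  interpret g: group ?S by (rule star_group_group[OF le])
  interpret A: comm_group ?A by (rule g.ab_comm_group)
  interpret h: group_hom "free_Abelian_group (basis e)" ?A "free_map e"
    using free_map_hom[OF e] by (simp add: group_hom_def group_hom_axioms_def star_lcomp A.is_group)
  define H where "H = free_map e ` carrier (free_Abelian_group (basis e))"
  have sub: "subgroup H ?A" unfolding H_def by (rule h.img_is_subgroup)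
  have pos: "ab_class ?S (hclass Sq (lft e) [((p, l, r, q), True)] k) \<in> H"
    if n: "npath (lft e) [((p, l, r, q), True)] k" for p l r q k
  proof -
    have c: "p \<in> TC" "q \<in> TC" and lr: "(l, r) \<in> R" and src: "p \<cdot> w\<^sub>T l \<cdot> q = lft e"
      and nf: "lft e \<cdot> p = p" "q \<cdot> lft e = q"
      using n by (auto simp: npath_def squier_simps)
    note [simp] = c lr_closed[OF lr]
    note sh = star_edge_shape[OF le c(1) lr_closed(1)[OF lr] c(2) nf src]
    have pb: "p \<cdot> base_idem l = p" using sh(2) by (simp add: base_idem_def T.m_assoc)
    have "base_idem l \<cdot> p\<star> = (p \<cdot> base_idem l)\<star>"
      using base_idem_ET[OF lr] by (simp add: T.sinv_mult T.sinv_idem)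
    then have bp: "base_idem l \<cdot> p\<star> = p\<star>" unfolding pb .
    have pc: "p\<star> \<in> TC" by simp
    note ab = act_base_arrow[OF lr pc bp]
    have pp: "(p\<star>)\<star> = p" "(p\<star>)\<star> \<cdot> p\<star> = lft e" using sh(1) by simp_all
    have n': "npath (lft e) [((p, l, r, q), True)] (p \<cdot> (w\<^sub>T r \<cdot> (w\<^sub>T l)\<star>) \<cdot> p\<star>)"
      using ab(1) unfolding pp(2) unfolding pp(1) sh(3)[symmetric] .
    \<comment> \<open>The end point is determined by the start and the edge, so the two descriptions
      of it need not be compared by calculation.\<close>
    have k: "p \<cdot> (w\<^sub>T r \<cdot> (w\<^sub>T l)\<star>) \<cdot> p\<star> = k"
      by (rule edge_path_unique[OF npath_path[OF n'] npath_path[OF n]])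
    have act: "act (p\<star>) (base_arrow l r) = hclass Sq (lft e) [((p, l, r, q), True)] k"
      using ab(2) unfolding pp(2) unfolding pp(1) sh(3)[symmetric] k .
    let ?f = "\<psi> (base_idem l)" and ?b = "ab_class (St (base_idem l)) (base_arrow l r)"
    have f: "?f \<in> EM" "lft ?f = base_idem l" using base_idem_ET[OF lr] psi_idem lift_psi by blast+
    have x: "((?f, ?b), \<psi> (p\<star>)) \<in> basis e"
      using basis_arrowI[OF lr pc bp] e unfolding pp(2) by simp
    have fe: "(\<psi> (p\<star>))\<diamond> \<bullet> ?f \<bullet> \<psi> (p\<star>) = e"
      using e bp pp(2) base_idem_ET[OF lr] by (simp add: T.m_assoc flip: psi_sinv psi_mult)
    have "free_map e (frag_of ((?f, ?b), \<psi> (p\<star>))) = S.ab_act ?f (\<psi> (p\<star>)) ?b"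
      by (rule free_map_of[OF e x])
    also have "\<dots> = ab_class ?S (act (p\<star>) (base_arrow l r))"
      using S.ab_act_class[OF f(1) pc, of "base_arrow l r"] base_arrow_star[OF lr] unfolding f(2) fe by simp
    finally show ?thesis
      unfolding H_def act[symmetric] by (rule image_eqI[OF HOL.sym]) (simp add: x)
  qed
  have "\<forall>g. npath (lft e) xs g \<longrightarrow> ab_class ?S (hclass Sq (lft e) xs g) \<in> H" for xs
  proof (induction xs rule: rev_induct)
    case Nil
    have "ab_class ?S (hclass Sq (lft e) [] g) \<in> H" if "npath (lft e) [] g" for g
    proof -
      have "g = lft e" using that by (simp add: npath_def)
      then show ?thesis using subgroup.one_closed[OF sub] g.ab_class_one[unfolded star_one] by simp
    qed
    then show ?case by blast
  next
    case (snoc d xs)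
    show ?case
    proof (intro allI impI)
      fix h assume n: "npath (lft e) (xs @ [d]) h"
      then obtain g where xs: "npath (lft e) xs g" and d: "edge_path Sq g [d] h" "nf (lft e) [d]"
        by (auto simp only: npath_def edge_path_append nf_simps)
      note g = npath_end(2,3)[OF xs]
      have gc: "g\<star> \<in> TC" using g by simp
      note k = ker_domain[OF le g] ker_range[OF le g] ker_left[OF le gc ker_psi_sinv[OF le g]]
      obtain p l r q b where dd: "d = ((p, l, r, q), b)" by (metis surj_pair)
      have c: "p \<in> TC" "q \<in> TC" and nf: "lft e \<cdot> p = p" "q \<cdot> lft e = q"
        using d(2) squier_path_edges[OF d(1)] by (auto simp: dd)
      \<comment> \<open>The last edge starts at \<open>g\<close>, not at \<open>e\<close>.
        Translating it by \<open>g^-1\<close> puts it into the star, and the product formula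
        translates it back by \<open>g\<close>.\<close>
      have "edge_path Sq (lft e) (lmap (g\<star>) [d]) (g\<star> \<cdot> h)"
        using lmap_path[OF gc d(1)] k(1) by simp
      moreover have "lft e \<cdot> (g\<star> \<cdot> p) = g\<star> \<cdot> p" using k(3) c gc e by (simp flip: T.m_assoc)
      ultimately have n1: "npath (lft e) (lmap (g\<star>) [d]) (g\<star> \<cdot> h)"
        using nf by (simp add: npath_def dd)
      have hc: "h \<in> TC" "\<psi> h = \<psi> (lft e)" using npath_end[OF n] by blast+
      have "lmap g (lmap (g\<star>) [d]) = [d]"
        using lmap_lmap[OF d(1) g(1) gc] k(2) nf by (simp add: dd)
      moreover have "g \<cdot> (g\<star> \<cdot> h) = h" using k(2) g(1) hc ker_left[OF le hc] by (simp flip: T.m_assoc)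
      ultimately have split: "hclass Sq (lft e) (xs @ [d]) h
          = hclass Sq (lft e) xs g \<otimes>\<^bsub>?S\<^esub> hclass Sq (lft e) (lmap (g\<star>) [d]) (g\<star> \<cdot> h)"
        using star_mult_hclass[OF le xs n1] by simp
      have single: "ab_class ?S (hclass Sq (lft e) (lmap (g\<star>) [d]) (g\<star> \<cdot> h)) \<in> H"
      proof (cases b)
        case True
        then show ?thesis using pos n1 by (simp add: dd)
      next
        case False
        \<comment> \<open>Reversed and moved back to start at \<open>e\<close>, the negative edge
          becomes the positive edge of \<open>?\<beta>\<close>, which is its inverse in the
          star.\<close>
        let ?\<alpha> = "hclass Sq (lft e) (lmap (g\<star>) [d]) (g\<star> \<cdot> h)" and ?h = "g\<star> \<cdot> h"
        let ?\<beta> = "hclass Sq (lft e) (lmap (?h\<star>) (path_inv (lmap (g\<star>) [d]))) (?h\<star>)"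
        have \<alpha>: "?\<alpha> \<in> carrier ?S" by (rule star_carrierI[OF le n1])
        have \<beta>: "?\<beta> \<in> carrier ?S" by (rule star_carrierI[OF le npath_inverse[OF le n1]])
        have "?\<beta> \<otimes>\<^bsub>?S\<^esub> ?\<alpha> = \<one>\<^bsub>?S\<^esub>" by (rule star_inverse[OF le n1])
        then have "?\<alpha> = inv\<^bsub>?S\<^esub> ?\<beta>" using \<alpha> \<beta> g.inv_equality g.inv_inv by metis
        moreover have "ab_class ?S ?\<beta> \<in> H"
          using pos npath_inverse[OF le n1] False by (simp add: dd)
        ultimately show ?thesis
          using g.ab_class_inv[OF \<beta>] subgroup.m_inv_closed[OF sub] by simp
      qed
      have "ab_class ?S (hclass Sq (lft e) xs g) \<in> H" using snoc xs by blast
      then show "ab_class ?S (hclass Sq (lft e) (xs @ [d]) h) \<in> H"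
        unfolding split
        using g.ab_class_mult[OF star_carrierI[OF le xs] star_carrierI[OF le n1]] single
          subgroup.m_closed[OF sub] by simp
    qed
  qed
  then have "carrier ?A \<subseteq> H"
    using star_carrierE[OF le] g.ab_carrierE by (metis subsetI)
  then show ?thesis using subgroup.subset[OF sub] unfolding H_def star_lcomp by auto
qed

text \<open>Both sides are additive in \<open>x\<close>, so generators suffice. There it is
  functoriality: translating \<open>b\<close> by \<open>s\<close> and then by \<open>m\<close> is
  translating by their product.\<close>

lemma free_map_act:
  assumes e: "e \<in> EM" and m: "m \<in> MC" and x: "x \<in> carrier (free_Abelian_group (basis e))"
  shows "free_map (m\<diamond> \<bullet> e \<bullet> m) (frag_extend (\<lambda>(b, s). frag_of (b, s \<bullet> m)) x) = S.ab_act e m (free_map e x)"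
proof -
  let ?f = "m\<diamond> \<bullet> e \<bullet> m" and ?F = "\<lambda>(b, s). frag_of (b, s \<bullet> m)"
  let ?A = "lcomp (star_ab_module X R)"
  have f: "?f \<in> EM" by (rule M.conj_idem[OF e m])
  have basis: "((i, b), s \<bullet> m) \<in> basis ?f \<and> i \<in> EM \<and> s \<in> MC \<and> b \<in> carrier (?A i) \<and> s\<diamond> \<bullet> i \<bullet> s = e"
    if x: "((i, b), s) \<in> basis e" for i b s
  proof -
    have i: "i \<in> EM" "b \<in> basis_fam i" "s \<in> MC" "natural_le (Mon X R) (s \<bullet> s\<diamond>) i" "s\<diamond> \<bullet> s = e"
      using x by (auto simp: free_basis_def)
    note [simp] = m i(3) M.idems_closed[OF i(1)]
    have "s \<bullet> s\<diamond> \<bullet> i = s \<bullet> s\<diamond>" using i by (simp add: M.natural_le_idem_iff)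
    then have "s\<diamond> \<bullet> (s \<bullet> s\<diamond> \<bullet> i) = s\<diamond>" by (simp add: M.inv_simps)
    then have si: "s\<diamond> \<bullet> i = s\<diamond>" by (simp add: M.inv_simps)
    have "(s \<bullet> m) \<bullet> (s \<bullet> m)\<diamond> \<bullet> i = (s \<bullet> m) \<bullet> (s \<bullet> m)\<diamond>"
      using si by (simp add: M.sinv_mult M.m_assoc)
    moreover have "(s \<bullet> m)\<diamond> \<bullet> (s \<bullet> m) = ?f"
      using i(5)[symmetric] by (simp add: M.sinv_mult M.m_assoc)
    ultimately have "((i, b), s \<bullet> m) \<in> basis ?f"
      using i by (auto simp: free_basis_def M.natural_le_idem_iff)
    moreover have "b \<in> carrier (?A i)"
    proof -
      obtain l r where lr: "(l, r) \<in> R" "\<psi> (base_idem l) = i" "b = ab_class (St (lft i)) (base_arrow l r)"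
        using i(2) by (auto simp: basis_fam_def)
      have "lft i = base_idem l" using lr lift_psi[OF base_idem_ET(1)[OF lr(1)]] by simp
      then show ?thesis
        using base_arrow_star[OF lr(1)] group.ab_class_closed[OF star_group_group[OF base_idem_ET(1)[OF lr(1)]]]
        by (simp add: star_lcomp lr(3))
    qed
    ultimately show ?thesis using i si by simp
  qed
  have Fh: "frag_extend ?F \<in> hom (free_Abelian_group (basis e)) (free_Abelian_group (basis ?f))"
  proof (rule frag_extend_hom)
    fix y assume y: "y \<in> basis e"
    obtain i b s where "y = ((i, b), s)" by (metis surj_pair)
    then show "?F y \<in> carrier (free_Abelian_group (basis ?f))" using basis y by simp
  qed
  have "(free_map ?f \<circ> frag_extend ?F) x = (S.ab_act e m \<circ> free_map e) x"
  proof (rule free_Abelian_group_hom_eq[OF _ _ _ _ x])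
    show "group (?A ?f)" using SA.comp_comm[OF f] by (rule comm_group.axioms(2))
    show "free_map ?f \<circ> frag_extend ?F \<in> hom (free_Abelian_group (basis e)) (?A ?f)"
      by (rule Group.hom_compose[OF Fh free_map_hom[OF f]])
    show "S.ab_act e m \<circ> free_map e \<in> hom (free_Abelian_group (basis e)) (?A ?f)"
      by (rule Group.hom_compose[OF free_map_hom[OF e] SA.C_hom[OF e m]])
    fix y assume y: "y \<in> basis e"
    obtain i b s where ibs: "y = ((i, b), s)" by (metis surj_pair)
    note B = basis[OF y[unfolded ibs]]
    have "S.ab_act i (s \<bullet> m) b = S.ab_act e m (S.ab_act i s b)"
      using SA.C_mult[of i s m b] B m by simp
    then show "(free_map ?f \<circ> frag_extend ?F) (frag_of y) = (S.ab_act e m \<circ> free_map e) (frag_of y)"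
      using B y free_map_of[OF e] free_map_of[OF f] by (simp add: ibs)
  qed
  then show ?thesis by simp
qed

lemma star_ab_free: "is_free_lausch (Mon X R) (star_ab_module X R)"
  unfolding is_free_lausch_def
proof (intro exI conjI ballI)
  have lcomp: "lcomp (free_lausch (Mon X R) basis_fam) e = free_Abelian_group (basis e)" for e
    by (simp add: free_lausch_def)
  show "free_map e \<in> iso (lcomp (free_lausch (Mon X R) basis_fam) e) (lcomp (star_ab_module X R) e)"
    if "e \<in> EM" for e
    unfolding lcomp using free_map_hom free_map_inj free_map_surj that by (simp add: iso_def bij_betw_def)
  show "lausch_hom (Mon X R) (free_lausch (Mon X R) basis_fam) (star_ab_module X R) free_map"
    unfolding lausch_hom_def
  proof (intro conjI ballI impI)
    show "free_map e \<in> hom (lcomp (free_lausch (Mon X R) basis_fam) e) (lcomp (star_ab_module X R) e)"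
      if "e \<in> EM" for e
      unfolding lcomp by (rule free_map_hom[OF that])
    fix e f a assume e: "e \<in> EM" and f: "f \<in> EM" and "natural_le (Mon X R) f e"
      and a: "a \<in> carrier (lcomp (free_lausch (Mon X R) basis_fam) e)"
    then have fe: "f \<bullet> e = f" by (simp add: M.natural_le_idem_iff)
    have "free_map e a \<in> carrier (lcomp (star_ab_module X R) e)"
      using hom_in_carrier[OF free_map_hom[OF e]] a by (simp only: lcomp)
    \<comment> \<open>In both modules the restriction to \<open>f\<close> is the action of the
      idempotent \<open>f\<close>, so equivariance covers the structure maps.\<close>
    then show "free_map f (lres (free_lausch (Mon X R) basis_fam) e f a)
        = lres (star_ab_module X R) e f (free_map e a)"
      using free_map_act[OF e M.idems_closed[OF f], of a] a SA.conj_le[OF e f fe] SA.res_eq[OF e f fe]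
      by (simp only: lcomp) (simp add: free_lausch_def)
  next
    fix x assume "x \<in> ltotal (Mon X R) (free_lausch (Mon X R) basis_fam)"
    then obtain e a where x: "x = (e, a)" "e \<in> EM" "a \<in> carrier (free_Abelian_group (basis e))"
      by (auto simp: ltotal_def lcomp)
    have "free_map e a \<in> carrier (lcomp (star_ab_module X R) e)"
      using hom_in_carrier[OF free_map_hom[OF x(2)] x(3)] .
    then show "case x of (e, a) \<Rightarrow> \<forall>s\<in>MC. lact (star_ab_module X R) (e, free_map e a) s
        = (case lact (free_lausch (Mon X R) basis_fam) (e, a) s of (f, b) \<Rightarrow> (f, free_map f b))"
      using x free_map_act[OF x(2) _ x(3)] by (auto simp: SA.act_eq free_lausch_def)
  qed
qed

end

theorem theorem4p10:
  fixes X :: "'x set" and R :: "('x word \<times> 'x word) set"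
  assumes "R \<subseteq> words X \<times> words X"
  shows "\<exists>\<iota> rbar.
    lausch_short_exact (Mon X R) (pi_module X R) \<iota> (star_ab_module X R) rbar (relation_module X R) \<and>
    is_free_lausch (Mon X R) (star_ab_module X R) \<and>
    (\<forall>e\<in>idems (Mon X R). \<forall>\<alpha>\<in>carrier (star_group X R (lift_idem X R e)).
       rbar e (ab_class (star_group X R (lift_idem X R e)) \<alpha>) = ab_class (K_group X R e) (gran \<alpha>))"
proof -
  interpret presentation X R by unfold_locales (rule assms)
  show ?thesis using star_short_exact star_ab_free rbar_class by blast
qed

end
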